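(* Let $G \sim G_{n,1/2}$. There is a constant $c>0$ such that for any sequence of integers $g(n)$ satisfying \[ \mathbf{P}\big(\chi(G) - \zeta(G) \le g(n)\big) > 0.999 \quad \text{for all } n, \] there is a sequence of integers $n^*$ such that \[ g(n^* ) > c\, \frac{\sqrt{n^*}\, \log\log n^*}{\log^3 n^*}. \]
   Context: $G_{n,1/2}$ denotes the Erdős–Rényi random graph on $n$ vertices in which each of the $\binom{n}{2}$ possible edges is present independently with probability $1/2$. $\chi(G)$ is the chromatic number of $G$. The cochromatic number $\zeta(G)$ is the minimum number of colours in a vertex colouring of $G$ in which every colour class is either an independent set or a clique. *)

theory Defs
  imports Complex_Main
begin

definition all_edges :: "nat \<Rightarrow> nat set set" where
  "all_edges n = {e. \<exists>i j. i < j \<and> j < n \<and> e = {i, j}}"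

definition graphs :: "nat \<Rightarrow> nat set set set" where
  "graphs n = Pow (all_edges n)"

definition prob_Gn_half :: "nat \<Rightarrow> (nat set set \<Rightarrow> bool) \<Rightarrow> real" where
  "prob_Gn_half n P = real (card {E \<in> graphs n. P E}) / real (card (graphs n))"

definition chromatic_number :: "nat \<Rightarrow> nat set set \<Rightarrow> nat" where
  "chromatic_number n E = (LEAST k. \<exists>f :: nat \<Rightarrow> nat.
      (\<forall>v<n. f v < k) \<and> (\<forall>u<n. \<forall>v<n. {u, v} \<in> E \<longrightarrow> f u \<noteq> f v))"

definition independent_set :: "nat set set \<Rightarrow> nat set \<Rightarrow> bool" where
  "independent_set E S = (\<forall>u\<in>S. \<forall>v\<in>S. u \<noteq> v \<longrightarrow> {u, v} \<notin> E)"

definition is_clique :: "nat set set \<Rightarrow> nat set \<Rightarrow> bool" where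
  "is_clique E S = (\<forall>u\<in>S. \<forall>v\<in>S. u \<noteq> v \<longrightarrow> {u, v} \<in> E)"

definition cochromatic_number :: "nat \<Rightarrow> nat set set \<Rightarrow> nat" where
  "cochromatic_number n E = (LEAST k. \<exists>f :: nat \<Rightarrow> nat.
      (\<forall>v<n. f v < k) \<and>
      (\<forall>c<k. independent_set E {v. v < n \<and> f v = c} \<or> is_clique E {v. v < n \<and> f v = c}))"

end

theory Submission
  imports
    Defs
    "HOL-Library.FuncSet"
    "HOL-Library.Disjoint_Sets"
    "HOL-Analysis.Harmonic_Numbers"
    "HOL-Combinatorics.Permutations"
    "HOL-Real_Asymp.Real_Asymp"
begin

text \<open>Let \<open>n\<close> be such that the expected number of independent sets of size \<open>a\<close>, slightly more than the
  typical size of a color class, is of order \<open>n / a\<^sup>2\<close>. Suppose that the gap were at most \<open>s\<close> with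
  high probability for all sizes near \<open>n\<close>. By Harris' inequality applied to the graph and its
  complement, \<open>\<chi>\<close> would then satisfy a zero-one law: if \<open>k\<close> colors suffice with probability
  bounded below, then \<open>k + s\<close> colors suffice with probability close to \<open>1\<close>. Planting about
  \<open>\<surd>n / a\<close> disjoint independent sets of size \<open>a\<close> changes the distribution of the random graph only
  by a bounded second-moment factor, so every addition of \<open>r \<approx> \<surd>n / (10 a)\<close> such sets costs
  \<open>r + s\<close> colors. After about \<open>10 \<surd>n / a\<close> rounds, the graph has about \<open>n / a\<close> more vertices and is
  colored with \<open>n / a\<^sup>2\<close> additional colors up to an error of \<open>10 s \<surd>n / a\<close>. Starting from a
  coloring at \<open>n\<close> that is optimal up to \<open>O(n / a ^ 5)\<close> colors (second moment method for colorings of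
  almost all vertices, together with Azuma's inequality), one
  would obtain a coloring as good as if it used nearly \<open>n / a\<^sup>2\<close> classes of size \<open>a\<close>. The enlarged graph
  has at most about half as many independent sets of that size, and by the first moment bound this
  makes at least order \<open>n log a / a ^ 4\<close> further colors necessary. Hence \<open>s\<close> is at least of order
  \<open>\<surd>n log a / a\<^sup>3\<close>.\<close>

section \<open>Averages over the subsets of a finite set\<close>

definition subset_avg :: "'a set \<Rightarrow> ('a set \<Rightarrow> real) \<Rightarrow> real" where
  "subset_avg X f = (\<Sum>E\<in>Pow X. f E) / 2 ^ card X"

lemma subset_avg_empty [simp]: "subset_avg {} f = f {}"
  by (simp add: subset_avg_def)

lemma subset_avg_insert:
  assumes "finite X" "x \<notin> X"
  shows "subset_avg (insert x X) f = (subset_avg X f + subset_avg X (\<lambda>E. f (insert x E))) / 2"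
proof -
  have "inj_on (insert x) (Pow X)"
    using assms(2) by (auto simp: inj_on_def)
  then have image: "(\<Sum>E\<in>insert x ` Pow X. f E) = (\<Sum>E\<in>Pow X. f (insert x E))"
    by (simp add: sum.reindex)
  have "(\<Sum>E\<in>Pow (insert x X). f E) = (\<Sum>E\<in>Pow X. f E) + (\<Sum>E\<in>insert x ` Pow X. f E)"
    unfolding Pow_insert using assms by (intro sum.union_disjoint) auto
  then show ?thesis using assms image by (simp add: subset_avg_def field_simps)
qed

lemma subset_avg_const [simp]: "finite X \<Longrightarrow> subset_avg X (\<lambda>E. c) = c"
  by (simp add: subset_avg_def card_Pow)

lemma subset_avg_add: "subset_avg X (\<lambda>E. f E + g E) = subset_avg X f + subset_avg X g"
  by (simp add: subset_avg_def sum.distrib add_divide_distrib)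

lemma subset_avg_diff: "subset_avg X (\<lambda>E. f E - g E) = subset_avg X f - subset_avg X g"
  by (simp add: subset_avg_def sum_subtractf diff_divide_distrib)

lemma subset_avg_cmult: "subset_avg X (\<lambda>E. c * f E) = c * subset_avg X f"
  by (simp add: subset_avg_def sum_distrib_left)

lemma subset_avg_cmult_right: "subset_avg X (\<lambda>E. f E * c) = subset_avg X f * c"
  by (simp add: subset_avg_def sum_distrib_right)

lemma subset_avg_sum: "subset_avg X (\<lambda>E. \<Sum>i\<in>I. f i E) = (\<Sum>i\<in>I. subset_avg X (f i))"
  unfolding subset_avg_def by (subst sum.swap) (simp add: sum_divide_distrib)

lemma subset_avg_mono: "(\<And>E. E \<subseteq> X \<Longrightarrow> f E \<le> g E) \<Longrightarrow> subset_avg X f \<le> subset_avg X g"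
  unfolding subset_avg_def by (intro divide_right_mono sum_mono) auto

lemma subset_avg_cong: "(\<And>E. E \<subseteq> X \<Longrightarrow> f E = g E) \<Longrightarrow> subset_avg X f = subset_avg X g"
  unfolding subset_avg_def by (auto intro!: sum.cong arg_cong2[where f="(/)"])

lemma subset_avg_nonneg: "(\<And>E. E \<subseteq> X \<Longrightarrow> 0 \<le> f E) \<Longrightarrow> 0 \<le> subset_avg X f"
  unfolding subset_avg_def by (intro divide_nonneg_nonneg sum_nonneg) auto

lemma subset_avg_not:
  assumes "finite X"
  shows "subset_avg X (\<lambda>E. of_bool (\<not> P E)) = 1 - subset_avg X (\<lambda>E. of_bool (P E))"
  using assms by (simp add: of_bool_not_iff subset_avg_diff)

lemma subset_avg_card:
  assumes "finite C"
  shows "subset_avg X (\<lambda>E. real (card {c \<in> C. P c E})) = (\<Sum>c\<in>C. subset_avg X (\<lambda>E. of_bool (P c E)))"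
proof -
  have "real (card {c \<in> C. P c E}) = (\<Sum>c\<in>C. of_bool (P c E))" for E
    using assms by (simp add: Collect_conj_eq)
  then show ?thesis by (simp only: subset_avg_sum)
qed

lemma subset_avg_card_power2:
  assumes "finite C"
  shows "subset_avg X (\<lambda>E. (real (card {c \<in> C. P c E}))\<^sup>2)
       = (\<Sum>c\<in>C. \<Sum>c'\<in>C. subset_avg X (\<lambda>E. of_bool (P c E \<and> P c' E)))"
proof -
  have "(real (card {c \<in> C. P c E}))\<^sup>2 = (\<Sum>c\<in>C. \<Sum>c'\<in>C. of_bool (P c E \<and> P c' E))" for E
  proof -
    have "real (card {c \<in> C. P c E}) = (\<Sum>c\<in>C. of_bool (P c E))"
      using assms by (simp add: Collect_conj_eq)
    then show ?thesis by (simp only: power2_eq_square sum_product of_bool_conj)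
  qed
  then show ?thesis by (simp only: subset_avg_sum)
qed

lemma abs_subset_avg_diff_le:
  assumes "finite X" "\<And>E. E \<subseteq> X \<Longrightarrow> \<bar>f E - g E\<bar> \<le> c"
  shows "\<bar>subset_avg X f - subset_avg X g\<bar> \<le> c"
proof -
  have "subset_avg X (\<lambda>E. f E - g E) \<le> subset_avg X (\<lambda>E. c)"
    using assms(2) by (intro subset_avg_mono) (simp add: abs_le_iff)
  moreover have "subset_avg X (\<lambda>E. - c) \<le> subset_avg X (\<lambda>E. f E - g E)"
  proof (rule subset_avg_mono)
    fix E assume "E \<subseteq> X"
    then show "- c \<le> f E - g E" using assms(2)[of E] by linarith
  qed
  ultimately show ?thesis using assms(1) by (simp add: subset_avg_diff abs_le_iff)
qed

lemma subset_avg_Un: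
  assumes "finite X" "finite Y" "X \<inter> Y = {}"
  shows "subset_avg (X \<union> Y) f = subset_avg X (\<lambda>E. subset_avg Y (\<lambda>E'. f (E \<union> E')))"
  using assms
proof (induction X arbitrary: f rule: finite_induct)
  case empty
  then show ?case by simp
next
  case (insert x X)
  then show ?case by (simp add: subset_avg_insert)
qed

lemma subset_avg_restrict:
  assumes "finite Z" "X \<subseteq> Z"
  shows "subset_avg Z (\<lambda>E. f (E \<inter> X)) = subset_avg X f"
proof -
  have "finite X" using assms finite_subset by blast
  then have "subset_avg (X \<union> (Z - X)) (\<lambda>E. f (E \<inter> X))
      = subset_avg X (\<lambda>E. subset_avg (Z - X) (\<lambda>E'. f ((E \<union> E') \<inter> X)))"
    using assms by (intro subset_avg_Un) auto
  also have "\<dots> = subset_avg X (\<lambda>E. subset_avg (Z - X) (\<lambda>E'. f E))"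
    by (intro subset_avg_cong arg_cong[where f=f]) auto
  also have "\<dots> = subset_avg X f" using assms by simp
  finally show ?thesis using assms by (simp add: Un_absorb1)
qed

lemma subset_avg_indep:
  assumes "finite Z" "X \<subseteq> Z" "Y \<subseteq> Z" "X \<inter> Y = {}"
  shows "subset_avg Z (\<lambda>E. f (E \<inter> X) * g (E \<inter> Y)) = subset_avg X f * subset_avg Y g"
proof -
  have fin: "finite X" "finite Y" using assms finite_subset by blast+
  have "subset_avg Z (\<lambda>E. f (E \<inter> X) * g (E \<inter> Y))
      = subset_avg Z (\<lambda>E. (\<lambda>F. f (F \<inter> X) * g (F \<inter> Y)) (E \<inter> (X \<union> Y)))"
    by (intro subset_avg_cong arg_cong2[where f="(*)"] arg_cong[where f=f] arg_cong[where f=g]) auto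
  also have "\<dots> = subset_avg (X \<union> Y) (\<lambda>F. f (F \<inter> X) * g (F \<inter> Y))"
    using assms by (intro subset_avg_restrict) auto
  also have "\<dots> = subset_avg X (\<lambda>E. subset_avg Y (\<lambda>E'. f ((E \<union> E') \<inter> X) * g ((E \<union> E') \<inter> Y)))"
    using assms fin by (intro subset_avg_Un) auto
  also have "\<dots> = subset_avg X (\<lambda>E. subset_avg Y (\<lambda>E'. f E * g E'))"
    using assms
    by (intro subset_avg_cong arg_cong2[where f="(*)"] arg_cong[where f=f] arg_cong[where f=g]) auto
  also have "\<dots> = subset_avg X f * subset_avg Y g"
    by (simp add: subset_avg_cmult subset_avg_cmult_right)
  finally show ?thesis .
qed

lemma subset_avg_avoid:
  assumes "finite X" "Y \<subseteq> X"
  shows "subset_avg X (\<lambda>E. of_bool (E \<inter> Y = {})) = 1 / 2 ^ card Y"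
proof -
  have "finite Y" using assms finite_subset by blast
  have "subset_avg X (\<lambda>E. of_bool (E \<inter> Y = {})) = subset_avg Y (\<lambda>E. of_bool (E = {}))"
    using subset_avg_restrict[OF assms, of "\<lambda>E. of_bool (E = {})"] by simp
  also have "\<dots> = 1 / 2 ^ card Y"
    using \<open>finite Y\<close> by (simp add: subset_avg_def of_bool_def sum.delta)
  finally show ?thesis .
qed

lemma subset_avg_compl: "subset_avg X (\<lambda>E. f (X - E)) = subset_avg X f"
proof -
  have "(\<Sum>E\<in>Pow X. f (X - E)) = (\<Sum>E\<in>Pow X. f E)"
    by (rule sum.reindex_bij_witness[of _ "\<lambda>E. X - E" "\<lambda>E. X - E"]) auto
  then show ?thesis by (simp add: subset_avg_def)
qed

lemma subset_avg_bij:
  assumes "bij_betw \<phi> X Y"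
  shows "subset_avg Y f = subset_avg X (\<lambda>E. f (\<phi> ` E))"
proof -
  have "(\<Sum>E\<in>Pow Y. f E) = (\<Sum>E\<in>Pow X. f (\<phi> ` E))"
    using bij_betw_Pow[OF assms] by (simp add: sum.reindex_bij_betw)
  moreover have "card X = card Y" using assms bij_betw_same_card by blast
  ultimately show ?thesis by (simp add: subset_avg_def)
qed

lemma subset_avg_second_moment:
  "(subset_avg X f)\<^sup>2 \<le> subset_avg X (\<lambda>E. of_bool (f E \<noteq> 0)) * subset_avg X (\<lambda>E. (f E)\<^sup>2)"
proof -
  let ?b = "\<lambda>E. of_bool (f E \<noteq> 0) :: real"
  have bf: "?b E * f E = f E" and bb: "(?b E)\<^sup>2 = ?b E" for E by auto
  have "(\<Sum>E\<in>Pow X. f E)\<^sup>2 \<le> (\<Sum>E\<in>Pow X. ?b E) * (\<Sum>E\<in>Pow X. (f E)\<^sup>2)"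
    using Cauchy_Schwarz_ineq_sum[of ?b f "Pow X"] unfolding bf bb .
  from divide_right_mono[OF this, of "(2 ^ card X)\<^sup>2"] show ?thesis
    unfolding subset_avg_def by (simp add: power_divide power2_eq_square)
qed

lemma Harris_inequality:
  assumes "finite X"
    and "\<And>E F. E \<subseteq> F \<Longrightarrow> F \<subseteq> X \<Longrightarrow> f E \<le> f F"
    and "\<And>E F. E \<subseteq> F \<Longrightarrow> F \<subseteq> X \<Longrightarrow> g E \<le> g F"
  shows "subset_avg X f * subset_avg X g \<le> subset_avg X (\<lambda>E. f E * g E)"
  using assms
proof (induction X arbitrary: f g rule: finite_induct)
  case empty
  then show ?case by simp
next
  case (insert x X)
  let ?fx = "\<lambda>E. f (insert x E)" and ?gx = "\<lambda>E. g (insert x E)"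
  have without: "subset_avg X f * subset_avg X g \<le> subset_avg X (\<lambda>E. f E * g E)"
    by (rule insert.IH) (rule insert.prems; auto)+
  have "with": "subset_avg X ?fx * subset_avg X ?gx \<le> subset_avg X (\<lambda>E. ?fx E * ?gx E)"
    by (rule insert.IH) (rule insert.prems; auto)+
  have "subset_avg X f \<le> subset_avg X ?fx" "subset_avg X g \<le> subset_avg X ?gx"
    by (intro subset_avg_mono insert.prems; auto)+
  then have "0 \<le> (subset_avg X ?fx - subset_avg X f) * (subset_avg X ?gx - subset_avg X g)" by simp
  then show ?case using without "with" insert.hyps by (simp add: subset_avg_insert field_simps)
qed

lemma exp_le_quadratic:
  fixes y :: real
  assumes "\<bar>y\<bar> \<le> 1"
  shows "exp y \<le> 1 + y + y\<^sup>2"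
proof (cases "y \<ge> 0")
  case True
  then show ?thesis using exp_bound[of y] assms by simp
next
  case False
  have "1 + (-y) + (-y)\<^sup>2 / 2 \<le> exp (-y)" using False by (intro exp_lower_Taylor_quadratic) auto
  then have "exp y * (1 - y + y\<^sup>2 / 2) \<le> 1" by (simp add: exp_minus field_simps)
  also have "1 \<le> (1 + y + y\<^sup>2) * (1 - y + y\<^sup>2 / 2)"
  proof -
    have "(1 + y + y\<^sup>2) * (1 - y + y\<^sup>2 / 2) - 1 = y\<^sup>2 / 2 * (1 - y + y\<^sup>2)"
      by (simp add: field_simps power2_eq_square)
    moreover have "0 \<le> y\<^sup>2 / 2 * (1 - y + y\<^sup>2)" using False by (intro mult_nonneg_nonneg) auto
    ultimately show ?thesis by linarith
  qed
  finally have "exp y * (1 - y + y\<^sup>2 / 2) \<le> (1 + y + y\<^sup>2) * (1 - y + y\<^sup>2 / 2)" .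
  moreover have "0 < 1 - y + y\<^sup>2 / 2" using False by (simp add: add_pos_nonneg)
  ultimately show ?thesis by (simp add: mult_le_cancel_right)
qed

lemma subset_avg_exp_deviation:
  fixes l :: real
  assumes "finite X" "\<bar>l\<bar> \<le> 1"
    and diff: "\<And>E F. E \<subseteq> X \<Longrightarrow> F \<subseteq> X \<Longrightarrow> \<bar>f E - f F\<bar> \<le> 1"
  shows "subset_avg X (\<lambda>E. exp (l * (f E - subset_avg X f))) \<le> exp (l\<^sup>2)"
proof -
  let ?d = "\<lambda>E. f E - subset_avg X f"
  have "subset_avg X (\<lambda>E. exp (l * ?d E)) \<le> subset_avg X (\<lambda>E. 1 + l * ?d E + l\<^sup>2)"
  proof (rule subset_avg_mono)
    fix E assume "E \<subseteq> X"
    then have d: "\<bar>?d E\<bar> \<le> 1"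
      using abs_subset_avg_diff_le[of X "\<lambda>_. f E" f 1] diff assms(1) by simp
    then have "\<bar>l * ?d E\<bar> \<le> 1" using assms(2) by (simp add: abs_mult mult_le_one)
    moreover have "l\<^sup>2 * (?d E)\<^sup>2 \<le> l\<^sup>2" using d by (simp add: mult_left_le abs_square_le_1)
    ultimately show "exp (l * ?d E) \<le> 1 + l * ?d E + l\<^sup>2"
      using exp_le_quadratic[of "l * ?d E"] by (simp add: power_mult_distrib)
  qed
  also have "\<dots> = 1 + l\<^sup>2"
    using assms(1) by (simp add: subset_avg_add subset_avg_diff subset_avg_cmult)
  also have "\<dots> \<le> exp (l\<^sup>2)" by (rule exp_ge_add_one_self)
  finally show ?thesis .
qed

definition blockwise_Lipschitz :: "('i \<Rightarrow> 'a set) \<Rightarrow> 'i set \<Rightarrow> ('a set \<Rightarrow> real) \<Rightarrow> bool" where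
  "blockwise_Lipschitz X I f \<longleftrightarrow> (\<forall>i\<in>I. \<forall>E F. E \<subseteq> (\<Union>i\<in>I. X i) \<longrightarrow> F \<subseteq> (\<Union>i\<in>I. X i)
     \<longrightarrow> E - X i = F - X i \<longrightarrow> \<bar>f E - f F\<bar> \<le> 1)"

lemma blockwise_LipschitzD:
  assumes "blockwise_Lipschitz X I f" "i \<in> I" "E \<subseteq> (\<Union>i\<in>I. X i)" "F \<subseteq> (\<Union>i\<in>I. X i)" "E - X i = F - X i"
  shows "\<bar>f E - f F\<bar> \<le> 1"
  using assms unfolding blockwise_Lipschitz_def by blast

lemma blockwise_Lipschitz_subset_avg:
  assumes "blockwise_Lipschitz X (insert i I) f" "finite (X i)"
  shows "blockwise_Lipschitz X I (\<lambda>E. subset_avg (X i) (\<lambda>E'. f (E \<union> E')))"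
  unfolding blockwise_Lipschitz_def
proof (intro ballI allI impI)
  fix j E F
  assume j: "j \<in> I" and sub: "E \<subseteq> (\<Union>i\<in>I. X i)" "F \<subseteq> (\<Union>i\<in>I. X i)" and eq: "E - X j = F - X j"
  have "\<bar>f (E \<union> E') - f (F \<union> E')\<bar> \<le> 1" if "E' \<subseteq> X i" for E'
    using j sub that eq by (intro blockwise_LipschitzD[OF assms(1), of j]) auto
  then show "\<bar>subset_avg (X i) (\<lambda>E'. f (E \<union> E')) - subset_avg (X i) (\<lambda>E'. f (F \<union> E'))\<bar> \<le> 1"
    using assms(2) by (intro abs_subset_avg_diff_le)
qed

lemma Azuma_exp_moment:
  fixes l :: real
  assumes "finite I" "\<And>i. i \<in> I \<Longrightarrow> finite (X i)" "disjoint_family_on X I"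
    and "blockwise_Lipschitz X I f" "\<bar>l\<bar> \<le> 1"
  shows "subset_avg (\<Union>i\<in>I. X i) (\<lambda>E. exp (l * (f E - subset_avg (\<Union>i\<in>I. X i) f))) \<le> exp (l\<^sup>2 * card I)"
  using assms(1-4)
proof (induction I arbitrary: f rule: finite_induct)
  case empty
  then show ?case by simp
next
  case (insert i I)
  let ?U = "\<Union>j\<in>I. X j"
  define h where "h E = subset_avg (X i) (\<lambda>E'. f (E \<union> E'))" for E
  have fin: "finite ?U" "finite (X i)" using insert by auto
  have disjoint: "?U \<inter> X i = {}"
    using insert.prems(2) insert.hyps by (simp add: disjoint_family_on_insert Int_commute)
  have avg_h: "subset_avg (?U \<union> X i) f = subset_avg ?U h"
    unfolding h_def by (rule subset_avg_Un[OF fin disjoint])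
  have IH: "subset_avg ?U (\<lambda>E. exp (l * (h E - subset_avg ?U h))) \<le> exp (l\<^sup>2 * card I)"
    unfolding h_def using insert.prems insert.hyps fin(2)
    by (intro insert.IH blockwise_Lipschitz_subset_avg) (auto simp: disjoint_family_on_insert)
  have one_block: "subset_avg (X i) (\<lambda>E'. exp (l * (f (E \<union> E') - subset_avg ?U h)))
      \<le> exp (l * (h E - subset_avg ?U h)) * exp (l\<^sup>2)" if E: "E \<subseteq> ?U" for E
  proof -
    have "\<bar>f (E \<union> E') - f (E \<union> F)\<bar> \<le> 1" if "E' \<subseteq> X i" "F \<subseteq> X i" for E' F
      using E that by (intro blockwise_LipschitzD[OF insert.prems(3), of i]) auto
    then have "subset_avg (X i) (\<lambda>E'. exp (l * (f (E \<union> E') - h E))) \<le> exp (l\<^sup>2)"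
      unfolding h_def by (intro subset_avg_exp_deviation[OF fin(2) assms(5)])
    moreover have "subset_avg (X i) (\<lambda>E'. exp (l * (f (E \<union> E') - subset_avg ?U h)))
       = subset_avg (X i) (\<lambda>E'. exp (l * (h E - subset_avg ?U h)) * exp (l * (f (E \<union> E') - h E)))"
      by (intro subset_avg_cong) (simp add: exp_add[symmetric] right_diff_distrib)
    ultimately show ?thesis by (simp add: subset_avg_cmult)
  qed
  have "subset_avg (?U \<union> X i) (\<lambda>E. exp (l * (f E - subset_avg ?U h)))
      = subset_avg ?U (\<lambda>E. subset_avg (X i) (\<lambda>E'. exp (l * (f (E \<union> E') - subset_avg ?U h))))"
    by (rule subset_avg_Un[OF fin disjoint])
  also have "\<dots> \<le> subset_avg ?U (\<lambda>E. exp (l * (h E - subset_avg ?U h)) * exp (l\<^sup>2))"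
    using one_block by (rule subset_avg_mono)
  also have "\<dots> = subset_avg ?U (\<lambda>E. exp (l * (h E - subset_avg ?U h))) * exp (l\<^sup>2)"
    by (rule subset_avg_cmult_right)
  also have "\<dots> \<le> exp (l\<^sup>2 * card I) * exp (l\<^sup>2)" using IH by simp
  also have "\<dots> = exp (l\<^sup>2 * card (insert i I))"
    using insert.hyps by (simp add: exp_add[symmetric] algebra_simps)
  finally show ?case by (simp only: UN_insert Un_commute[of "X i"] avg_h)
qed

lemma Azuma_tail:
  fixes l t :: real
  assumes "finite I" "\<And>i. i \<in> I \<Longrightarrow> finite (X i)" "disjoint_family_on X I"
    and "blockwise_Lipschitz X I f" "\<bar>l\<bar> \<le> 1"
  shows "subset_avg (\<Union>i\<in>I. X i) (\<lambda>E. of_bool (t \<le> l * (f E - subset_avg (\<Union>i\<in>I. X i) f))) \<le> exp (l\<^sup>2 * card I - t)"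
proof -
  let ?U = "\<Union>i\<in>I. X i"
  have "subset_avg ?U (\<lambda>E. of_bool (t \<le> l * (f E - subset_avg ?U f)))
      \<le> subset_avg ?U (\<lambda>E. exp (-t) * exp (l * (f E - subset_avg ?U f)))"
    by (intro subset_avg_mono) (auto simp: of_bool_def exp_add[symmetric])
  also have "\<dots> = exp (-t) * subset_avg ?U (\<lambda>E. exp (l * (f E - subset_avg ?U f)))"
    by (rule subset_avg_cmult)
  also have "\<dots> \<le> exp (-t) * exp (l\<^sup>2 * card I)"
    using Azuma_exp_moment[OF assms] by simp
  finally show ?thesis by (simp add: exp_add[symmetric] algebra_simps)
qed

section \<open>Colorings of random graphs\<close>

definition edges_in :: "'a set \<Rightarrow> 'a set set" where
  "edges_in V = {e \<in> Pow V. card e = 2}"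

lemma edges_inE:
  assumes "e \<in> edges_in V"
  obtains i j where "i \<in> V" "j \<in> V" "i \<noteq> j" "e = {i, j}"
  using assms by (auto simp: edges_in_def card_2_iff)

lemma pair_in_edges_in [simp]: "{i, j} \<in> edges_in V \<longleftrightarrow> i \<in> V \<and> j \<in> V \<and> i \<noteq> j"
  by (auto simp: edges_in_def card_2_iff doubleton_eq_iff)

lemma finite_edges_in [simp]: "finite V \<Longrightarrow> finite (edges_in V)"
  by (simp add: edges_in_def)

lemma card_edges_in: "finite V \<Longrightarrow> card (edges_in V) = card V choose 2"
  using n_subsets[of V 2] by (simp add: edges_in_def)

lemma edges_in_mono: "V \<subseteq> W \<Longrightarrow> edges_in V \<subseteq> edges_in W"
  by (auto simp: edges_in_def)

lemma edges_in_Int: "edges_in (V \<inter> W) = edges_in V \<inter> edges_in W"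
  by (auto simp: edges_in_def)

lemma edges_in_disjoint:
  assumes "V \<inter> W = {}" shows "edges_in V \<inter> edges_in W = {}"
  using assms by (auto simp: edges_in_def card_2_iff)

lemma bij_betw_edges_in:
  assumes "bij_betw \<phi> V W"
  shows "bij_betw ((`) \<phi>) (edges_in V) (edges_in W)"
  unfolding edges_in_def
proof (rule bij_betw_Collect[OF bij_betw_Pow[OF assms]])
  fix e assume "e \<in> Pow V"
  then have "inj_on \<phi> e" using assms by (auto simp: bij_betw_def intro: inj_on_subset)
  then show "card (\<phi> ` e) = 2 \<longleftrightarrow> card e = 2" by (simp add: card_image)
qed

lemma all_edges_eq: "all_edges n = edges_in {..<n}"
proof (intro equalityI subsetI)
  fix e assume "e \<in> all_edges n"
  then show "e \<in> edges_in {..<n}" by (auto simp: all_edges_def)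
next
  fix e assume "e \<in> edges_in {..<n}"
  then obtain i j where "i < n" "j < n" "i \<noteq> j" "e = {i, j}" by (auto elim: edges_inE)
  then show "e \<in> all_edges n" unfolding all_edges_def
    by (intro CollectI exI[of _ "min i j"] exI[of _ "max i j"]) (auto simp: min_def max_def)
qed

definition proper_coloring :: "'a set \<Rightarrow> nat \<Rightarrow> 'a set set \<Rightarrow> ('a \<Rightarrow> nat) \<Rightarrow> bool" where
  "proper_coloring V k E f \<longleftrightarrow> (\<forall>v\<in>V. f v < k) \<and> (\<forall>u\<in>V. \<forall>v\<in>V. u \<noteq> v \<longrightarrow> {u, v} \<in> E \<longrightarrow> f u \<noteq> f v)"

definition colorable :: "'a set \<Rightarrow> nat \<Rightarrow> 'a set set \<Rightarrow> bool" where
  "colorable V k E \<longleftrightarrow> (\<exists>f. proper_coloring V k E f)"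

lemma colorableI:
  assumes "\<And>v. v \<in> V \<Longrightarrow> f v < k"
    and "\<And>u v. u \<in> V \<Longrightarrow> v \<in> V \<Longrightarrow> u \<noteq> v \<Longrightarrow> {u, v} \<in> E \<Longrightarrow> f u \<noteq> f v"
  shows "colorable V k E"
  using assms unfolding colorable_def proper_coloring_def by blast

lemma proper_coloring_less: "proper_coloring V k E f \<Longrightarrow> v \<in> V \<Longrightarrow> f v < k"
  by (simp add: proper_coloring_def)

lemma proper_coloring_neq:
  "proper_coloring V k E f \<Longrightarrow> u \<in> V \<Longrightarrow> v \<in> V \<Longrightarrow> u \<noteq> v \<Longrightarrow> {u, v} \<in> E \<Longrightarrow> f u \<noteq> f v"
  by (simp add: proper_coloring_def)

lemma colorable_mono: "colorable V k E \<Longrightarrow> k \<le> k' \<Longrightarrow> colorable V k' E"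
  unfolding colorable_def proper_coloring_def by (meson order_less_le_trans)

lemma proper_coloring_antimono:
  assumes "proper_coloring V k F f" "E \<subseteq> F"
  shows "proper_coloring V k E f"
  unfolding proper_coloring_def
proof (intro conjI ballI impI)
  fix u v assume "u \<in> V" "v \<in> V" "u \<noteq> v" "{u, v} \<in> E"
  then show "f u \<noteq> f v" using assms(2) by (intro proper_coloring_neq[OF assms(1)]) auto
qed (rule proper_coloring_less[OF assms(1)])

lemma colorable_antimono: "colorable V k F \<Longrightarrow> E \<subseteq> F \<Longrightarrow> colorable V k E"
  unfolding colorable_def using proper_coloring_antimono by blast

lemma colorable_Int_edges_in: "colorable V k (E \<inter> edges_in V) \<longleftrightarrow> colorable V k E"
  by (simp add: colorable_def proper_coloring_def)

lemma colorable_card: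
  assumes "finite V" "card V \<le> k"
  shows "colorable V k E"
proof -
  obtain f where "f ` V \<subseteq> {..<k}" "inj_on f V"
    using card_le_inj[OF assms(1), of "{..<k}"] assms by auto
  then show ?thesis by (intro colorableI[of _ f]) (auto simp: inj_on_def)
qed

lemma colorable_Un:
  assumes "colorable V k E" "colorable W l E"
  shows "colorable (V \<union> W) (k + l) E"
proof -
  obtain f g where f: "proper_coloring V k E f" and g: "proper_coloring W l E g"
    using assms unfolding colorable_def by blast
  show ?thesis
  proof (rule colorableI)
    fix v assume "v \<in> V \<union> W"
    then show "(if v \<in> V then f v else k + g v) < k + l"
      using proper_coloring_less[OF f] proper_coloring_less[OF g] by (auto simp: trans_less_add1)
  next
    fix u v assume "u \<in> V \<union> W" "v \<in> V \<union> W" "u \<noteq> v" "{u, v} \<in> E"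
    then show "(if u \<in> V then f u else k + g u) \<noteq> (if v \<in> V then f v else k + g v)"
      using proper_coloring_less[OF f, of u] proper_coloring_less[OF f, of v]
        proper_coloring_neq[OF f, of u v] proper_coloring_neq[OF g, of u v] by auto
  qed
qed

lemma colorable_hom:
  assumes "colorable W k F" "inj_on \<phi> V" "\<phi> ` V \<subseteq> W"
    and hom: "\<And>u v. u \<in> V \<Longrightarrow> v \<in> V \<Longrightarrow> {u, v} \<in> E \<Longrightarrow> {\<phi> u, \<phi> v} \<in> F"
  shows "colorable V k E"
proof -
  obtain f where f: "proper_coloring W k F f" using assms(1) unfolding colorable_def by blast
  show ?thesis
  proof (rule colorableI)
    fix v assume "v \<in> V"
    then show "f (\<phi> v) < k" using assms(3) by (intro proper_coloring_less[OF f]) auto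
  next
    fix u v assume "u \<in> V" "v \<in> V" "u \<noteq> v" "{u, v} \<in> E"
    then show "f (\<phi> u) \<noteq> f (\<phi> v)"
      using assms(2,3) by (intro proper_coloring_neq[OF f] hom) (auto simp: inj_on_def)
  qed
qed

lemma colorable_image_iff:
  assumes "inj_on \<phi> V" "E \<subseteq> edges_in V"
  shows "colorable (\<phi> ` V) k ((`) \<phi> ` E) \<longleftrightarrow> colorable V k E"
proof
  assume "colorable (\<phi> ` V) k ((`) \<phi> ` E)"
  then show "colorable V k E"
  proof (rule colorable_hom[OF _ assms(1) subset_refl])
    fix u v assume "{u, v} \<in> E"
    from imageI[OF this, of "(`) \<phi>"] show "{\<phi> u, \<phi> v} \<in> (`) \<phi> ` E" by simp
  qed
next
  assume "colorable V k E"
  then show "colorable (\<phi> ` V) k ((`) \<phi> ` E)"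
  proof (rule colorable_hom)
    show "inj_on (inv_into V \<phi>) (\<phi> ` V)" by (rule inj_on_inv_into) simp
    show "inv_into V \<phi> ` \<phi> ` V \<subseteq> V" using assms(1) by auto
    fix u v assume "{u, v} \<in> (`) \<phi> ` E"
    then obtain e where e: "e \<in> E" "{u, v} = \<phi> ` e" by auto
    then have "e \<subseteq> V" using assms(2) by (auto simp: edges_in_def)
    then have "inv_into V \<phi> ` {u, v} = e"
      unfolding e(2) using assms(1) by (rule inv_into_image_cancel[rotated])
    then show "{inv_into V \<phi> u, inv_into V \<phi> v} \<in> E" using e(1) by simp
  qed
qed

definition colorable_prob :: "nat \<Rightarrow> nat \<Rightarrow> real" where
  "colorable_prob n k = subset_avg (edges_in {..<n}) (\<lambda>E. of_bool (colorable {..<n} k E))"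

lemma colorable_prob_nonneg: "0 \<le> colorable_prob n k"
  unfolding colorable_prob_def by (intro subset_avg_nonneg) auto

lemma colorable_prob_le_1: "colorable_prob n k \<le> 1"
proof -
  have "colorable_prob n k \<le> subset_avg (edges_in {..<n}) (\<lambda>E. 1)"
    unfolding colorable_prob_def by (intro subset_avg_mono) auto
  then show ?thesis by simp
qed

lemma colorable_prob_eq_1: "n \<le> k \<Longrightarrow> colorable_prob n k = 1"
  by (simp add: colorable_prob_def colorable_card)

lemma subset_avg_colorable:
  assumes "finite V"
  shows "subset_avg (edges_in V) (\<lambda>E. of_bool (colorable V k E)) = colorable_prob (card V) k"
proof -
  obtain \<phi> where bij: "bij_betw \<phi> {..<card V} V"
    using ex_bij_betw_nat_finite[OF assms] by (auto simp: lessThan_atLeast0)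
  then have "inj_on \<phi> {..<card V}" "\<phi> ` {..<card V} = V" by (auto simp: bij_betw_def)
  then have "colorable V k ((`) \<phi> ` E) \<longleftrightarrow> colorable {..<card V} k E" if "E \<subseteq> edges_in {..<card V}" for E
    using colorable_image_iff[OF _ that, of \<phi>] by simp
  then show ?thesis
    unfolding colorable_prob_def subset_avg_bij[OF bij_betw_edges_in[OF bij]]
    by (intro subset_avg_cong) simp
qed

lemma prob_Gn_half_eq_subset_avg: "prob_Gn_half n P = subset_avg (edges_in {..<n}) (\<lambda>E. of_bool (P E))"
proof -
  have "{E \<in> graphs n. P E} = Pow (edges_in {..<n}) \<inter> {E. P E}"
    by (auto simp: graphs_def all_edges_eq)
  then show ?thesis
    by (simp add: prob_Gn_half_def graphs_def all_edges_eq subset_avg_def card_Pow)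
qed

lemma chromatic_number_le_iff:
  assumes "E \<subseteq> edges_in {..<n}"
  shows "chromatic_number n E \<le> k \<longleftrightarrow> colorable {..<n} k E"
proof -
  have "u \<noteq> v" if "{u, v} \<in> E" for u v using assms pair_in_edges_in[of u v] that by blast
  then have proper: "(\<exists>f :: nat \<Rightarrow> nat. (\<forall>v<n. f v < k) \<and> (\<forall>u<n. \<forall>v<n. {u, v} \<in> E \<longrightarrow> f u \<noteq> f v))
      \<longleftrightarrow> colorable {..<n} k E" for k
    unfolding colorable_def proper_coloring_def Ball_def lessThan_iff by blast
  have chi: "chromatic_number n E = (LEAST k. colorable {..<n} k E)"
    unfolding chromatic_number_def proper ..
  have "colorable {..<n} n E" by (simp add: colorable_card)
  then have "colorable {..<n} (chromatic_number n E) E" unfolding chi by (rule LeastI)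
  then show ?thesis using colorable_mono chi Least_le by metis
qed

lemma cochromatic_number_le:
  assumes "colorable {..<n} k (edges_in {..<n} - E)"
  shows "cochromatic_number n E \<le> k"
proof -
  obtain f where f: "proper_coloring {..<n} k (edges_in {..<n} - E) f"
    using assms unfolding colorable_def by blast
  have "is_clique E {v. v < n \<and> f v = c}" for c
    unfolding is_clique_def using proper_coloring_neq[OF f] by fastforce
  then show ?thesis unfolding cochromatic_number_def
    using proper_coloring_less[OF f] by (intro Least_le exI[of _ f]) simp
qed

text \<open>Cliques of \<open>G\<close> are independent sets of its complement, and colorability of the complement
  increases with \<open>G\<close> while colorability of \<open>G\<close> decreases; so Harris' inequality makes a large
  \<open>\<chi>(G)\<close> together with a small \<open>\<zeta>(G)\<close> at least as likely as for independent events.\<close>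

lemma colorable_prob_gap:
  "colorable_prob n k * (1 - colorable_prob n (k + s))
     \<le> 1 - prob_Gn_half n (\<lambda>E. int (chromatic_number n E) - int (cochromatic_number n E) \<le> int s)"
proof -
  let ?X = "edges_in {..<n}"
  let ?not_col = "\<lambda>E. of_bool (\<not> colorable {..<n} (k + s) E) :: real"
  let ?co_col = "\<lambda>E. of_bool (colorable {..<n} k (?X - E)) :: real"
  let ?gap = "\<lambda>E. int (chromatic_number n E) - int (cochromatic_number n E) \<le> int s"
  have "subset_avg ?X ?not_col * subset_avg ?X ?co_col \<le> subset_avg ?X (\<lambda>E. ?not_col E * ?co_col E)"
  proof (rule Harris_inequality)
    fix E F assume "E \<subseteq> F" "F \<subseteq> ?X"
    show "?not_col E \<le> ?not_col F" using colorable_antimono[OF _ \<open>E \<subseteq> F\<close>] by auto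
    have "?X - F \<subseteq> ?X - E" using \<open>E \<subseteq> F\<close> by auto
    then show "?co_col E \<le> ?co_col F" using colorable_antimono by auto
  qed simp
  also have "\<dots> \<le> subset_avg ?X (\<lambda>E. of_bool (\<not> ?gap E))"
  proof (rule subset_avg_mono)
    fix E assume E: "E \<subseteq> ?X"
    have "\<not> ?gap E" if "\<not> colorable {..<n} (k + s) E" "colorable {..<n} k (?X - E)"
      using that chromatic_number_le_iff[OF E, of "k + s"] cochromatic_number_le[of n k E] by linarith
    then show "?not_col E * ?co_col E \<le> of_bool (\<not> ?gap E)" by auto
  qed
  also have "\<dots> = 1 - prob_Gn_half n ?gap"
    unfolding prob_Gn_half_eq_subset_avg by (rule subset_avg_not) simp
  also have "subset_avg ?X ?co_col = colorable_prob n k"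
    unfolding colorable_prob_def by (rule subset_avg_compl)
  also have "subset_avg ?X ?not_col = 1 - colorable_prob n (k + s)"
    unfolding colorable_prob_def by (rule subset_avg_not) simp
  finally show ?thesis by (simp only: mult.commute)
qed

lemma chromatic_number_le_Suc:
  assumes "E \<subseteq> edges_in {..<n}" "F \<subseteq> edges_in {..<n}"
    and off: "\<And>e. e \<in> E \<Longrightarrow> i \<notin> e \<Longrightarrow> e \<in> F"
  shows "chromatic_number n E \<le> Suc (chromatic_number n F)"
proof -
  define k where "k = chromatic_number n F"
  have "colorable {..<n} k F" using chromatic_number_le_iff[OF assms(2)] k_def by blast
  then obtain c where c: "proper_coloring {..<n} k F c" unfolding colorable_def by blast
  have "colorable {..<n} (Suc k) E"
  proof (rule colorableI)
    fix v assume "v \<in> {..<n}"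
    then show "(c(i := k)) v < Suc k" using proper_coloring_less[OF c] by (auto simp: less_SucI)
  next
    fix u v assume uv: "u \<in> {..<n}" "v \<in> {..<n}" "u \<noteq> v" "{u, v} \<in> E"
    show "(c(i := k)) u \<noteq> (c(i := k)) v"
    proof (cases "u = i \<or> v = i")
      case True
      then show ?thesis using proper_coloring_less[OF c, of u] proper_coloring_less[OF c, of v] uv by auto
    next
      case False
      then have "{u, v} \<in> F" using uv by (intro off) auto
      then show ?thesis using proper_coloring_neq[OF c] uv False by auto
    qed
  qed
  then show ?thesis using chromatic_number_le_iff[OF assms(1)] k_def by blast
qed

definition edges_with_max :: "nat \<Rightarrow> nat \<Rightarrow> nat set set" where
  "edges_with_max n i = {e \<in> edges_in {..<n}. Max e = i}"

lemma disjoint_edges_with_max: "disjoint_family_on (edges_with_max n) I"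
  by (auto simp: disjoint_family_on_def edges_with_max_def)

lemma UN_edges_with_max: "(\<Union>i<n. edges_with_max n i) = edges_in {..<n}"
proof -
  have "Max e < n" if "e \<in> edges_in {..<n}" for e
    using that by (auto elim!: edges_inE)
  then show ?thesis by (auto simp: edges_with_max_def)
qed

lemma chromatic_number_Lipschitz:
  "blockwise_Lipschitz (edges_with_max n) {..<n} (\<lambda>E. real (chromatic_number n E))"
  unfolding blockwise_Lipschitz_def UN_edges_with_max
proof (intro ballI allI impI)
  fix i E F
  assume E: "E \<subseteq> edges_in {..<n}" and F: "F \<subseteq> edges_in {..<n}"
    and eq: "E - edges_with_max n i = F - edges_with_max n i"
  have off: "e \<notin> edges_with_max n i" if "i \<notin> e" for e
    using that by (auto simp: edges_with_max_def max_def elim!: edges_inE split: if_splits)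
  have "chromatic_number n E \<le> Suc (chromatic_number n F)"
    using eq off by (intro chromatic_number_le_Suc[OF E F]) blast
  moreover have "chromatic_number n F \<le> Suc (chromatic_number n E)"
    using eq off by (intro chromatic_number_le_Suc[OF F E]) blast
  ultimately show "\<bar>real (chromatic_number n E) - real (chromatic_number n F)\<bar> \<le> 1" by linarith
qed

definition mean_chromatic_number :: "nat \<Rightarrow> real" where
  "mean_chromatic_number n = subset_avg (edges_in {..<n}) (\<lambda>E. real (chromatic_number n E))"

lemma chromatic_number_tail:
  assumes "\<bar>l\<bar> \<le> 1"
  shows "subset_avg (edges_in {..<n}) (\<lambda>E. of_bool (t \<le> l * (real (chromatic_number n E) - mean_chromatic_number n)))
     \<le> exp (l\<^sup>2 * n - t)"
proof -
  have "finite (edges_with_max n i)" for i by (simp add: edges_with_max_def)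
  then show ?thesis
    using Azuma_tail[OF _ _ disjoint_edges_with_max chromatic_number_Lipschitz assms]
    by (simp add: UN_edges_with_max mean_chromatic_number_def)
qed

lemma colorable_prob_le_exp:
  assumes "0 \<le> l" "l \<le> 1"
  shows "colorable_prob n k \<le> exp (l\<^sup>2 * n - l * (mean_chromatic_number n - k))"
proof -
  let ?M = "mean_chromatic_number n"
  have "colorable_prob n k
      \<le> subset_avg (edges_in {..<n}) (\<lambda>E. of_bool (l * (?M - k) \<le> (- l) * (real (chromatic_number n E) - ?M)))"
    unfolding colorable_prob_def
  proof (rule subset_avg_mono)
    fix E assume "E \<subseteq> edges_in {..<n}"
    then have "l * chromatic_number n E \<le> l * k" if "colorable {..<n} k E"
      using that assms(1) by (intro mult_left_mono) (simp_all add: chromatic_number_le_iff[symmetric])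
    then show "of_bool (colorable {..<n} k E)
        \<le> (of_bool (l * (?M - k) \<le> (- l) * (real (chromatic_number n E) - ?M)) :: real)"
      by (auto simp: algebra_simps)
  qed
  also have "\<dots> \<le> exp ((- l)\<^sup>2 * n - l * (?M - k))"
    using assms by (intro chromatic_number_tail) simp
  finally show ?thesis by simp
qed

lemma not_colorable_prob_le_exp:
  assumes "0 \<le> l" "l \<le> 1"
  shows "1 - colorable_prob n k \<le> exp (l\<^sup>2 * n - l * (k - mean_chromatic_number n))"
proof -
  let ?M = "mean_chromatic_number n"
  have "1 - colorable_prob n k = subset_avg (edges_in {..<n}) (\<lambda>E. of_bool (\<not> colorable {..<n} k E))"
    unfolding colorable_prob_def by (rule subset_avg_not[symmetric]) simp
  also have "\<dots> \<le> subset_avg (edges_in {..<n}) (\<lambda>E. of_bool (l * (k - ?M) \<le> l * (real (chromatic_number n E) - ?M)))"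
  proof (rule subset_avg_mono)
    fix E assume "E \<subseteq> edges_in {..<n}"
    then have "l * k \<le> l * chromatic_number n E" if "\<not> colorable {..<n} k E"
      using that assms(1) by (intro mult_left_mono) (simp_all add: chromatic_number_le_iff[symmetric])
    then show "of_bool (\<not> colorable {..<n} k E)
        \<le> (of_bool (l * (k - ?M) \<le> l * (real (chromatic_number n E) - ?M)) :: real)"
      by (auto simp: algebra_simps)
  qed
  also have "\<dots> \<le> exp (l\<^sup>2 * n - l * (k - ?M))"
    using assms by (intro chromatic_number_tail) simp
  finally show ?thesis .
qed

lemma mean_chromatic_number_le:
  assumes "exp (- s) \<le> colorable_prob n k" "0 < s" "s \<le> real n"
  shows "mean_chromatic_number n - k \<le> 2 * sqrt (n * s)"
proof -
  let ?M = "mean_chromatic_number n"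
  define l where "l = sqrt (s / n)"
  have n: "0 < real n" using assms by linarith
  then have l: "0 < l" "l \<le> 1" "l\<^sup>2 * n = s" using assms by (auto simp: l_def)
  have "exp (- s) \<le> exp (l\<^sup>2 * n - l * (?M - k))"
    by (rule order_trans[OF assms(1) colorable_prob_le_exp]) (use l in auto)
  then have "l * (?M - k) \<le> 2 * s" unfolding l(3) by simp
  also have "\<dots> = l * (2 * (l * n))" using l(3) by (simp add: power2_eq_square algebra_simps)
  finally have "?M - k \<le> 2 * (l * n)" using l(1) by simp
  also have "l * n = sqrt (n * s)"
    using l n by (intro real_sqrt_unique[symmetric]) (simp_all add: power2_eq_square algebra_simps)
  finally show ?thesis .
qed

lemma colorable_prob_amplify:
  assumes "exp (- s) \<le> colorable_prob n k" "0 < s" "s \<le> real n" "2 * sqrt (n * s) + 2 * sqrt n \<le> real m"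
  shows "1 / 2 \<le> colorable_prob n (k + m)"
proof -
  define l where "l = 1 / sqrt n"
  have "0 < n" using assms by (cases n) auto
  then have l: "0 < l" "l \<le> 1" "l\<^sup>2 * n = 1" "l * sqrt n = 1"
    by (auto simp: l_def power_divide)
  have "2 * sqrt n \<le> real (k + m) - mean_chromatic_number n"
    using mean_chromatic_number_le[OF assms(1-3)] assms(4) by simp
  then have "l * (2 * sqrt n) \<le> l * (real (k + m) - mean_chromatic_number n)"
    using l(1) by (intro mult_left_mono) auto
  then have exponent: "l\<^sup>2 * n - l * (real (k + m) - mean_chromatic_number n) \<le> - 1"
    unfolding l(3) mult.left_commute[of l 2] l(4) by linarith
  have "1 - colorable_prob n (k + m) \<le> exp (l\<^sup>2 * n - l * (real (k + m) - mean_chromatic_number n))"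
    using l(1,2) by (intro not_colorable_prob_le_exp) auto
  also have "\<dots> \<le> exp (- 1)" using exponent by simp
  also have "exp (- 1 :: real) \<le> 1 / 2"
    using exp_ge_add_one_self[of "1 :: real"] by (simp add: exp_minus field_simps)
  finally show ?thesis by simp
qed

section \<open>Falling factorials\<close>

definition ffact :: "nat \<Rightarrow> nat \<Rightarrow> real" where
  "ffact n m = (\<Prod>i<m. real n - real i)"

lemma ffact_0 [simp]: "ffact n 0 = 1"
  by (simp add: ffact_def)

lemma ffact_Suc: "ffact n (Suc m) = ffact n m * (real n - real m)"
  by (simp add: ffact_def)

lemma ffact_pos: "m \<le> n \<Longrightarrow> 0 < ffact n m"
  unfolding ffact_def by (intro prod_pos) auto

lemma ffact_eq_0: "n < m \<Longrightarrow> ffact n m = 0"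
  unfolding ffact_def by (rule prod_zero) (auto intro!: bexI[of _ n])

lemma ffact_nonneg [simp]: "0 \<le> ffact n m"
  by (cases "m \<le> n") (auto simp: ffact_pos less_imp_le ffact_eq_0 not_le)

lemma ffact_le_power: "ffact n m \<le> real n ^ m"
proof (cases "m \<le> n")
  case True
  then have "ffact n m \<le> (\<Prod>i<m. real n)" unfolding ffact_def by (intro prod_mono) auto
  then show ?thesis by simp
qed (simp add: ffact_eq_0)

lemma ffact_add: "ffact n (m + l) = ffact n m * ffact (n - m) l" if "m \<le> n"
  using that by (induction l) (simp_all add: ffact_Suc of_nat_diff algebra_simps)

lemma ffact_add_le: "ffact n (m + l) \<le> ffact n m * ffact n l"
proof (cases "m + l \<le> n")
  case True
  then have "ffact (n - m) l \<le> ffact n l" unfolding ffact_def by (intro prod_mono) auto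
  then show ?thesis using True by (simp add: ffact_add mult_left_mono)
qed (simp add: ffact_eq_0)

lemma ffact_sum_le: "finite A \<Longrightarrow> ffact n (\<Sum>x\<in>A. f x) \<le> (\<Prod>x\<in>A. ffact n (f x))"
proof (induction A rule: finite_induct)
  case (insert x A)
  have "ffact n (f x + (\<Sum>x\<in>A. f x)) \<le> ffact n (f x) * ffact n (\<Sum>x\<in>A. f x)" by (rule ffact_add_le)
  also have "\<dots> \<le> ffact n (f x) * (\<Prod>x\<in>A. ffact n (f x))" using insert.IH by (intro mult_left_mono) auto
  finally show ?case using insert by simp
qed simp

lemma ffact_eq_fact_div: "m \<le> n \<Longrightarrow> ffact n m = fact n / fact (n - m)"
proof (induction m)
  case (Suc m)
  then have "fact (n - m) = real (n - m) * fact (n - Suc m)"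
    by (metis Suc_diff_Suc Suc_le_eq fact_Suc of_nat_fact of_nat_mult)
  moreover have "real (n - m) = real n - real m" "real n - real m \<noteq> 0" using Suc.prems by auto
  ultimately show ?case using Suc by (simp add: ffact_Suc)
qed simp

lemma ffact_eq_binomial: "m \<le> n \<Longrightarrow> ffact n m = fact m * real (n choose m)"
  using fact_binomial[of m n, where 'a = real] by (simp add: ffact_eq_fact_div)

lemma fact_le_ffact:
  assumes "m \<le> n"
  shows "fact m \<le> ffact n m"
proof -
  have "fact m = (\<Prod>i<m. real m - real i)"
    using ffact_eq_fact_div[of m m] by (simp add: ffact_def)
  also have "\<dots> \<le> ffact n m" unfolding ffact_def using assms by (intro prod_mono) auto
  finally show ?thesis .
qed

definition type_count :: "('i \<Rightarrow> 's) \<Rightarrow> 'i set \<Rightarrow> 's \<Rightarrow> nat" where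
  "type_count u I s = card {i \<in> I. u i = s}"

lemma type_count_empty [simp]: "type_count u {} s = 0"
  by (simp add: type_count_def)

lemma type_count_insert:
  assumes "finite I" "i \<notin> I"
  shows "type_count u (insert i I) s = (if s = u i then Suc (type_count u I s) else type_count u I s)"
proof -
  have "{j \<in> insert i I. u j = s} = (if s = u i then insert i {j \<in> I. u j = s} else {j \<in> I. u j = s})"
    by auto
  then show ?thesis using assms by (simp add: type_count_def)
qed

lemma type_count_mono: "finite J \<Longrightarrow> I \<subseteq> J \<Longrightarrow> type_count u I s \<le> type_count u J s"
  unfolding type_count_def by (intro card_mono) auto

lemma type_count_le_card: "finite I \<Longrightarrow> type_count u I s \<le> card I"
  unfolding type_count_def by (intro card_mono) auto

lemma prod_ffact_type_count_insert:
  assumes "finite S" "finite I" "i \<notin> I" "u i \<in> S"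
  shows "(\<Prod>s\<in>S. ffact (N s) (type_count u (insert i I) s))
       = (\<Prod>s\<in>S. ffact (N s) (type_count u I s)) * (real (N (u i)) - type_count u I (u i))"
proof -
  have "(\<Prod>s\<in>S. ffact (N s) (type_count u (insert i I) s))
      = (\<Prod>s\<in>S. ffact (N s) (type_count u I s) * (if s = u i then real (N s) - type_count u I s else 1))"
    using assms by (intro prod.cong) (auto simp: type_count_insert ffact_Suc)
  also have "\<dots> = (\<Prod>s\<in>S. ffact (N s) (type_count u I s)) * (real (N (u i)) - type_count u I (u i))"
    using assms by (simp add: prod.distrib)
  finally show ?thesis .
qed

section \<open>Colorings with prescribed class sizes\<close>

definition color_class :: "nat \<Rightarrow> (nat \<Rightarrow> nat) \<Rightarrow> nat \<Rightarrow> nat set" where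
  "color_class n c j = {v \<in> {..<n}. c v = j}"

text \<open>The color \<open>k\<close> marks the vertices left over.\<close>

definition sized_colorings :: "nat \<Rightarrow> nat \<Rightarrow> (nat \<Rightarrow> nat) \<Rightarrow> (nat \<Rightarrow> nat) set" where
  "sized_colorings n k u = {c \<in> {..<n} \<rightarrow>\<^sub>E {..k}. \<forall>j<k. card (color_class n c j) = u j}"

lemma finite_color_class [simp]: "finite (color_class n c j)"
  by (simp add: color_class_def)

lemma color_class_subset: "color_class n c j \<subseteq> {..<n}"
  by (auto simp: color_class_def)

lemma color_class_disjoint: "i \<noteq> j \<Longrightarrow> color_class n c i \<inter> color_class n c j = {}"
  by (auto simp: color_class_def)

lemma finite_sized_colorings [simp]: "finite (sized_colorings n k u)"
  by (rule finite_subset[of _ "{..<n} \<rightarrow>\<^sub>E {..k}"]) (auto simp: sized_colorings_def intro: finite_PiE)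

lemma card_color_class: "c \<in> sized_colorings n k u \<Longrightarrow> j < k \<Longrightarrow> card (color_class n c j) = u j"
  by (simp add: sized_colorings_def)

lemma card_leftover_class:
  assumes "c \<in> sized_colorings n k u"
  shows "card (color_class n c k) + (\<Sum>j<k. u j) = n"
proof -
  have "{..<n} = (\<Union>j\<in>{..k}. color_class n c j)"
    using assms by (auto simp: sized_colorings_def color_class_def)
  then have "n = card (\<Union>j\<in>{..k}. color_class n c j)" by (metis card_lessThan)
  also have "\<dots> = (\<Sum>j\<in>{..k}. card (color_class n c j))"
    by (rule card_UN_disjoint) (auto simp: color_class_def)
  also have "\<dots> = card (color_class n c k) + (\<Sum>j<k. card (color_class n c j))"
    by (simp add: lessThan_Suc_atMost[symmetric])
  also have "(\<Sum>j<k. card (color_class n c j)) = (\<Sum>j<k. u j)"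
    using assms by (simp add: card_color_class)
  finally show ?thesis by simp
qed

lemma sized_colorings_nonempty:
  assumes "(\<Sum>j<k. u j) \<le> n"
  shows "sized_colorings n k u \<noteq> {}"
  using assms
proof (induction k)
  case 0
  have "(\<lambda>v\<in>{..<n}. 0) \<in> sized_colorings n 0 u" by (auto simp: sized_colorings_def)
  then show ?case by blast
next
  case (Suc k)
  then obtain c where c: "c \<in> sized_colorings n k u" by auto
  have "u k \<le> card (color_class n c k)" using card_leftover_class[OF c] Suc.prems by simp
  then obtain B where B: "B \<subseteq> color_class n c k" "card B = u k" by (rule obtain_subset_with_card_n)
  define c' where "c' v = (if v \<in> color_class n c k - B then Suc k else c v)" for v
  have "color_class n c' k = B" using B by (auto simp: c'_def color_class_def split: if_splits)
  moreover have "color_class n c' j = color_class n c j" if "j < k" for j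
    using B that by (auto simp: c'_def color_class_def split: if_splits)
  moreover have "c' \<in> {..<n} \<rightarrow>\<^sub>E {..Suc k}"
    using c B by (auto simp: c'_def sized_colorings_def color_class_def PiE_def Pi_def extensional_def le_Suc_eq)
  ultimately have "c' \<in> sized_colorings n (Suc k) u"
    using c B by (auto simp: sized_colorings_def less_Suc_eq)
  then show ?case by blast
qed

definition class_edges :: "nat \<Rightarrow> nat \<Rightarrow> (nat \<Rightarrow> nat) \<Rightarrow> nat set set" where
  "class_edges n k c = (\<Union>j<k. edges_in (color_class n c j))"

lemma class_edges_subset: "class_edges n k c \<subseteq> edges_in {..<n}"
  unfolding class_edges_def by (intro UN_least edges_in_mono color_class_subset)

lemma finite_class_edges [simp]: "finite (class_edges n k c)"
  by (rule finite_subset[OF class_edges_subset]) simp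

lemma class_edges_disjoint_leftover: "class_edges n k c \<inter> edges_in (color_class n c k) = {}"
proof -
  have "edges_in (color_class n c j) \<inter> edges_in (color_class n c k) = {}" if "j < k" for j
    by (intro edges_in_disjoint color_class_disjoint) (use that in auto)
  then show ?thesis unfolding class_edges_def by blast
qed

lemma card_class_edges: "card (class_edges n k c) = (\<Sum>j<k. card (color_class n c j) choose 2)"
proof -
  have "card (class_edges n k c) = (\<Sum>j<k. card (edges_in (color_class n c j)))"
    unfolding class_edges_def
    by (rule card_UN_disjoint) (auto intro!: edges_in_disjoint color_class_disjoint simp del: edges_in_Int)
  then show ?thesis by (simp add: card_edges_in)
qed

definition class_overlap :: "nat \<Rightarrow> (nat \<Rightarrow> nat) \<Rightarrow> (nat \<Rightarrow> nat) \<Rightarrow> nat \<times> nat \<Rightarrow> nat set" where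
  "class_overlap n c c' p = color_class n c (fst p) \<inter> color_class n c' (snd p)"

lemma finite_class_overlap [simp]: "finite (class_overlap n c c' p)"
  by (simp add: class_overlap_def)

lemma class_overlap_disjoint:
  assumes "p \<noteq> q"
  shows "class_overlap n c c' p \<inter> class_overlap n c c' q = {}"
proof -
  have "fst p \<noteq> fst q \<or> snd p \<noteq> snd q" using assms by (simp add: prod_eq_iff)
  then show ?thesis
    using color_class_disjoint[of "fst p" "fst q" n c] color_class_disjoint[of "snd p" "snd q" n c']
    by (auto simp: class_overlap_def)
qed

definition overlap_weight :: "nat \<Rightarrow> nat \<Rightarrow> (nat \<Rightarrow> nat) \<Rightarrow> (nat \<Rightarrow> nat) \<Rightarrow> real" where
  "overlap_weight n k c c' = (\<Prod>p\<in>{..<k} \<times> {..<k}. 2 ^ (card (class_overlap n c c' p) choose 2))"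

lemma overlap_weight_nonneg: "0 \<le> overlap_weight n k c c'"
  unfolding overlap_weight_def by (intro prod_nonneg) simp

lemma overlap_weight_eq: "overlap_weight n k c c' = 2 ^ card (class_edges n k c \<inter> class_edges n k c')"
proof -
  let ?K = "{..<k} \<times> {..<k}" and ?e = "\<lambda>p. edges_in (class_overlap n c c' p)"
  have "class_edges n k c \<inter> class_edges n k c' = (\<Union>p\<in>?K. ?e p)"
    by (auto simp: class_edges_def class_overlap_def edges_in_Int)
  moreover have "card (\<Union>p\<in>?K. ?e p) = (\<Sum>p\<in>?K. card (?e p))"
    by (intro card_UN_disjoint ballI impI edges_in_disjoint class_overlap_disjoint) auto
  ultimately show ?thesis
    by (simp add: overlap_weight_def card_edges_in power_sum)
qed

definition proper_sized_colorings :: "nat \<Rightarrow> nat \<Rightarrow> (nat \<Rightarrow> nat) \<Rightarrow> nat \<Rightarrow> nat set set \<Rightarrow> (nat \<Rightarrow> nat) set" where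
  "proper_sized_colorings n k u f E =
     {c \<in> sized_colorings n k u. E \<inter> class_edges n k c = {} \<and> colorable (color_class n c k) f E}"

lemma finite_proper_sized_colorings [simp]: "finite (proper_sized_colorings n k u f E)"
  by (simp add: proper_sized_colorings_def)

lemma proper_sized_colorings_imp_colorable:
  assumes "c \<in> proper_sized_colorings n k u f E"
  shows "colorable {..<n} (f + k) E"
proof -
  let ?W = "{v \<in> {..<n}. c v < k}"
  have c: "c \<in> {..<n} \<rightarrow>\<^sub>E {..k}" "E \<inter> class_edges n k c = {}" "colorable (color_class n c k) f E"
    using assms by (auto simp: proper_sized_colorings_def sized_colorings_def)
  have "colorable ?W k E"
  proof (rule colorableI[of _ c])
    fix u v assume uv: "u \<in> ?W" "v \<in> ?W" "u \<noteq> v" "{u, v} \<in> E"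
    show "c u \<noteq> c v"
    proof
      assume "c u = c v"
      then have "{u, v} \<in> edges_in (color_class n c (c u))" using uv by (simp add: color_class_def)
      then have "{u, v} \<in> class_edges n k c" using uv by (auto simp: class_edges_def)
      then show False using c(2) uv by blast
    qed
  qed simp
  then have "colorable (color_class n c k \<union> ?W) (f + k) E" by (rule colorable_Un[OF c(3)])
  also have "color_class n c k \<union> ?W = {..<n}"
    using c(1) by (auto simp: color_class_def PiE_def Pi_def le_less)
  finally show ?thesis .
qed

lemma subset_avg_card_proper_sized_colorings:
  "subset_avg (edges_in {..<n}) (\<lambda>E. real (card (proper_sized_colorings n k u f E)))
     = card (sized_colorings n k u) * colorable_prob (n - (\<Sum>j<k. u j)) f / 2 ^ (\<Sum>j<k. u j choose 2)"
proof -
  let ?Z = "edges_in {..<n}" and ?m = "\<Sum>j<k. u j choose 2" and ?p = "colorable_prob (n - (\<Sum>j<k. u j)) f"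
  have "subset_avg ?Z (\<lambda>E. of_bool (E \<inter> class_edges n k c = {} \<and> colorable (color_class n c k) f E)) = ?p / 2 ^ ?m"
    if c: "c \<in> sized_colorings n k u" for c
  proof -
    let ?I = "class_edges n k c" and ?R = "edges_in (color_class n c k)"
    have cardI: "card ?I = ?m" using c by (simp add: card_class_edges card_color_class)
    have "subset_avg ?Z (\<lambda>E. of_bool (E \<inter> ?I = {} \<and> colorable (color_class n c k) f E))
        = subset_avg ?Z (\<lambda>E. (\<lambda>F. of_bool (F = {})) (E \<inter> ?I) * (\<lambda>F. of_bool (colorable (color_class n c k) f F)) (E \<inter> ?R))"
      by (simp add: colorable_Int_edges_in of_bool_conj)
    also have "\<dots> = subset_avg ?I (\<lambda>F. of_bool (F = {})) * subset_avg ?R (\<lambda>F. of_bool (colorable (color_class n c k) f F))"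
      by (rule subset_avg_indep[OF _ class_edges_subset edges_in_mono[OF color_class_subset]
          class_edges_disjoint_leftover]) simp
    also have "subset_avg ?I (\<lambda>F. of_bool (F = {})) = subset_avg ?I (\<lambda>F. of_bool (F \<inter> ?I = {}))"
      by (intro subset_avg_cong) (auto simp: Int_absorb2)
    also have "\<dots> = 1 / 2 ^ ?m" unfolding cardI[symmetric] by (rule subset_avg_avoid) simp_all
    also have "subset_avg ?R (\<lambda>F. of_bool (colorable (color_class n c k) f F)) = colorable_prob (card (color_class n c k)) f"
      by (rule subset_avg_colorable) simp
    also have "card (color_class n c k) = n - (\<Sum>j<k. u j)" using card_leftover_class[OF c] by simp
    finally show ?thesis by simp
  qed
  then show ?thesis unfolding proper_sized_colorings_def by (simp add: subset_avg_card)
qed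

lemma subset_avg_avoid_both:
  assumes "c \<in> sized_colorings n k u" "c' \<in> sized_colorings n k u"
  shows "subset_avg (edges_in {..<n}) (\<lambda>E. of_bool (E \<inter> (class_edges n k c \<union> class_edges n k c') = {}))
       = overlap_weight n k c c' / 4 ^ (\<Sum>j<k. u j choose 2)"
proof -
  let ?I = "class_edges n k" and ?m = "\<Sum>j<k. u j choose 2"
  have "card (?I c \<union> ?I c') + card (?I c \<inter> ?I c') = 2 * ?m"
    using card_Un_Int[of "?I c" "?I c'"] assms by (simp add: card_class_edges card_color_class)
  then have "(2::real) ^ card (?I c \<union> ?I c') * 2 ^ card (?I c \<inter> ?I c') = 4 ^ ?m"
    by (simp add: power_add[symmetric] power_mult)
  then have "1 / 2 ^ card (?I c \<union> ?I c') = overlap_weight n k c c' / 4 ^ ?m"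
    by (simp add: overlap_weight_eq field_simps)
  then show ?thesis by (subst subset_avg_avoid) (simp_all add: class_edges_subset)
qed

lemma subset_avg_card_proper_sized_colorings_power2_le:
  "subset_avg (edges_in {..<n}) (\<lambda>E. (real (card (proper_sized_colorings n k u f E)))\<^sup>2)
     \<le> (\<Sum>c\<in>sized_colorings n k u. \<Sum>c'\<in>sized_colorings n k u. overlap_weight n k c c') / 4 ^ (\<Sum>j<k. u j choose 2)"
proof -
  let ?Z = "edges_in {..<n}" and ?C = "sized_colorings n k u" and ?I = "class_edges n k"
  let ?P = "\<lambda>c E. E \<inter> ?I c = {} \<and> colorable (color_class n c k) f E"
  have "subset_avg ?Z (\<lambda>E. (real (card (proper_sized_colorings n k u f E)))\<^sup>2)
      = (\<Sum>c\<in>?C. \<Sum>c'\<in>?C. subset_avg ?Z (\<lambda>E. of_bool (?P c E \<and> ?P c' E)))"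
    unfolding proper_sized_colorings_def by (rule subset_avg_card_power2) simp
  also have "\<dots> \<le> (\<Sum>c\<in>?C. \<Sum>c'\<in>?C. subset_avg ?Z (\<lambda>E. of_bool (E \<inter> (?I c \<union> ?I c') = {})))"
    by (intro sum_mono subset_avg_mono) (auto simp: Int_Un_distrib)
  also have "\<dots> = (\<Sum>c\<in>?C. \<Sum>c'\<in>?C. overlap_weight n k c c' / 4 ^ (\<Sum>j<k. u j choose 2))"
    by (intro sum.cong refl subset_avg_avoid_both)
  finally show ?thesis by (simp add: sum_divide_distrib)
qed

lemma colorable_prob_second_moment:
  fixes S :: real
  assumes sizes: "(\<Sum>j<k. u j) \<le> n"
    and S: "\<And>c. c \<in> sized_colorings n k u \<Longrightarrow>
      (\<Sum>c'\<in>sized_colorings n k u. overlap_weight n k c c') \<le> S * card (sized_colorings n k u)"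
  shows "(colorable_prob (n - (\<Sum>j<k. u j)) f)\<^sup>2 \<le> S * colorable_prob n (f + k)"
proof -
  let ?Z = "edges_in {..<n}" and ?C = "sized_colorings n k u" and ?m = "\<Sum>j<k. u j choose 2"
  let ?X = "\<lambda>E. real (card (proper_sized_colorings n k u f E))"
  let ?p = "colorable_prob (n - (\<Sum>j<k. u j)) f" and ?N = "real (card ?C)"
  have N: "0 < ?N" using sized_colorings_nonempty[OF sizes] by (simp add: card_gt_0_iff)
  have mean: "subset_avg ?Z ?X = ?N * ?p / 2 ^ ?m"
    by (rule subset_avg_card_proper_sized_colorings)
  have "(\<Sum>c\<in>?C. \<Sum>c'\<in>?C. overlap_weight n k c c') / 4 ^ ?m \<le> (\<Sum>c\<in>?C. S * ?N) / 4 ^ ?m"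
    using S by (intro divide_right_mono sum_mono) auto
  then have square: "subset_avg ?Z (\<lambda>E. (?X E)\<^sup>2) \<le> S * ?N\<^sup>2 / 4 ^ ?m"
    using subset_avg_card_proper_sized_colorings_power2_le[of n k u f] by (simp add: power2_eq_square mult_ac)
  have "subset_avg ?Z (\<lambda>E. of_bool (?X E \<noteq> 0)) \<le> colorable_prob n (f + k)"
    unfolding colorable_prob_def
  proof (rule subset_avg_mono)
    fix E
    have "colorable {..<n} (f + k) E" if "proper_sized_colorings n k u f E \<noteq> {}"
      using that proper_sized_colorings_imp_colorable by blast
    then show "of_bool (?X E \<noteq> 0) \<le> (of_bool (colorable {..<n} (f + k) E) :: real)" by auto
  qed
  then have "(?N * ?p / 2 ^ ?m)\<^sup>2 \<le> colorable_prob n (f + k) * (S * ?N\<^sup>2 / 4 ^ ?m)"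
    using subset_avg_second_moment[of ?Z ?X] square unfolding mean
    by (meson mult_mono colorable_prob_nonneg subset_avg_nonneg zero_le_power2 order_trans)
  moreover have "((2::real) ^ ?m)\<^sup>2 = 4 ^ ?m" by (simp add: power_even_eq[symmetric] power_mult)
  ultimately have "?N\<^sup>2 * ?p\<^sup>2 \<le> ?N\<^sup>2 * (S * colorable_prob n (f + k))"
    by (simp add: power_divide power_mult_distrib field_simps)
  then show ?thesis using N by (simp only: mult_le_cancel_left_pos zero_less_power)
qed

section \<open>Extensions of partial colorings\<close>

definition extensions :: "nat \<Rightarrow> nat \<Rightarrow> (nat \<Rightarrow> nat) \<Rightarrow> nat set \<Rightarrow> (nat \<Rightarrow> nat) \<Rightarrow> (nat \<Rightarrow> nat) set" where
  "extensions n k u D \<tau> = {c \<in> sized_colorings n k u. \<forall>v\<in>D. c v = \<tau> v}"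

lemma finite_extensions [simp]: "finite (extensions n k u D \<tau>)"
  by (simp add: extensions_def)

lemma extensions_empty [simp]: "extensions n k u {} \<tau> = sized_colorings n k u"
  by (simp add: extensions_def)

lemma extensions_cong: "(\<And>v. v \<in> D \<Longrightarrow> \<tau> v = \<tau>' v) \<Longrightarrow> extensions n k u D \<tau> = extensions n k u D \<tau>'"
  by (auto simp: extensions_def)

lemma sized_colorings_comp_permutes:
  assumes "c \<in> sized_colorings n k u" "\<sigma> permutes {..<n}"
  shows "c \<circ> \<sigma> \<in> sized_colorings n k u"
proof -
  have "bij_betw \<sigma> (color_class n (c \<circ> \<sigma>) j) (color_class n c j)" for j
    unfolding color_class_def using permutes_imp_bij[OF assms(2)] by (rule bij_betw_Collect) simp
  then have "card (color_class n (c \<circ> \<sigma>) j) = card (color_class n c j)" for j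
    by (rule bij_betw_same_card)
  moreover have "c \<circ> \<sigma> \<in> {..<n} \<rightarrow>\<^sub>E {..k}"
  proof (rule PiE_I)
    fix v assume "v \<in> {..<n}"
    then show "(c \<circ> \<sigma>) v \<in> {..k}"
      using assms permutes_in_image[OF assms(2), of v] by (auto simp: sized_colorings_def)
  next
    fix v assume "v \<notin> {..<n}"
    then show "(c \<circ> \<sigma>) v = undefined"
      using assms by (auto simp: sized_colorings_def permutes_not_in)
  qed
  ultimately show ?thesis using assms(1) by (simp add: sized_colorings_def)
qed

lemma card_extensions_same_color:
  assumes "v \<in> {..<n} - D" "w \<in> {..<n} - D"
  shows "card {c \<in> extensions n k u D \<tau>. c w = j} = card {c \<in> extensions n k u D \<tau>. c v = j}"
proof -
  let ?\<sigma> = "Transposition.transpose v w"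
  have mem: "c \<circ> ?\<sigma> \<in> extensions n k u D \<tau>" if "c \<in> extensions n k u D \<tau>" for c
  proof -
    have "?\<sigma> x = x" if "x \<in> D" for x
      using that assms by (intro transpose_apply_other) auto
    then show ?thesis
      using that assms permutes_swap_id[of v "{..<n}" w]
      by (auto simp: extensions_def intro: sized_colorings_comp_permutes)
  qed
  have "bij_betw (\<lambda>c. c \<circ> ?\<sigma>) {c \<in> extensions n k u D \<tau>. c w = j} {c \<in> extensions n k u D \<tau>. c v = j}"
    using mem by (intro bij_betw_byWitness[where f' = "\<lambda>c. c \<circ> ?\<sigma>"]) (auto simp: comp_assoc)
  then show ?thesis by (rule bij_betw_same_card)
qed

lemma card_extension_class_outside:
  assumes "c \<in> extensions n k u D \<tau>" "D \<subseteq> {..<n}" "j < k"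
  shows "card {w \<in> {..<n} - D. c w = j} + type_count \<tau> D j = u j"
proof -
  have "finite D" using assms(2) finite_subset by blast
  moreover have "color_class n c j = {w \<in> {..<n} - D. c w = j} \<union> {w \<in> D. c w = j}"
    using assms(2) by (auto simp: color_class_def)
  moreover have "{w \<in> D. c w = j} = {w \<in> D. \<tau> w = j}" using assms(1) by (auto simp: extensions_def)
  ultimately have "card (color_class n c j) = card {w \<in> {..<n} - D. c w = j} + type_count \<tau> D j"
    unfolding type_count_def by (simp add: card_Un_disjoint disjoint_iff)
  then show ?thesis using assms(1,3) card_color_class[of c n k u j] by (simp add: extensions_def)
qed

lemma card_extensions_insert:
  assumes "D \<subseteq> {..<n}" "v < n" "v \<notin> D" "\<tau> v < k"
  shows "real (card (extensions n k u (insert v D) \<tau>)) * (real n - card D)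
       = real (card (extensions n k u D \<tau>)) * (real (u (\<tau> v)) - type_count \<tau> D (\<tau> v))"
proof -
  let ?X = "extensions n k u D \<tau>" and ?j = "\<tau> v" and ?R = "{..<n} - D"
  have finD: "finite D" using assms finite_subset by blast
  have card_filter: "real (card {x \<in> A. P x}) = (\<Sum>x\<in>A. of_bool (P x))" if "finite A" for A :: "'b set" and P
    using that by (simp add: Collect_conj_eq)
  have "{c \<in> ?X. c v = ?j} = extensions n k u (insert v D) \<tau>" by (auto simp: extensions_def)
  then have same: "card {c \<in> ?X. c w = ?j} = card (extensions n k u (insert v D) \<tau>)" if "w \<in> ?R" for w
    using card_extensions_same_color[of v n D w] that assms by simp
  have "card ?R = n - card D" using assms finD by (simp add: card_Diff_subset)
  then have "real (card ?R) = real n - card D" using assms card_mono[of "{..<n}" D] by (simp add: of_nat_diff)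
  then have "real (card (extensions n k u (insert v D) \<tau>)) * (real n - card D)
      = (\<Sum>w\<in>?R. real (card {c \<in> ?X. c w = ?j}))"
    using same by simp
  also have "\<dots> = (\<Sum>w\<in>?R. \<Sum>c\<in>?X. of_bool (c w = ?j))"
    by (intro sum.cong refl card_filter) simp
  also have "\<dots> = (\<Sum>c\<in>?X. \<Sum>w\<in>?R. of_bool (c w = ?j))" by (rule sum.swap)
  also have "\<dots> = (\<Sum>c\<in>?X. real (card {w \<in> ?R. c w = ?j}))"
    by (intro sum.cong refl card_filter[symmetric]) simp
  also have "\<dots> = (\<Sum>c\<in>?X. real (u ?j) - type_count \<tau> D ?j)"
  proof (intro sum.cong refl)
    fix c assume "c \<in> ?X"
    from card_extension_class_outside[OF this assms(1,4)]
    show "real (card {w \<in> ?R. c w = ?j}) = real (u ?j) - type_count \<tau> D ?j" by linarith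
  qed
  finally show ?thesis by simp
qed

lemma type_count_le_of_extension:
  assumes "c \<in> extensions n k u D \<tau>" "D \<subseteq> {..<n}" "j < k"
  shows "type_count \<tau> D j \<le> u j"
  using card_extension_class_outside[OF assms] by simp

lemma card_extensions_Un_le:
  assumes "finite D'" "D \<union> D' \<subseteq> {..<n}" "D \<inter> D' = {}" "\<And>v. v \<in> D' \<Longrightarrow> \<tau> v < k"
  shows "card (extensions n k u (D \<union> D') \<tau>) * ffact (n - card D) (card D')
       \<le> card (extensions n k u D \<tau>) * (\<Prod>j<k. ffact (u j) (type_count \<tau> D' j))"
  using assms
proof (induction D' rule: finite_induct)
  case empty
  then show ?case by simp
next
  case (insert v D')
  let ?j = "\<tau> v"
  let ?X = "\<lambda>D'. real (card (extensions n k u (D \<union> D') \<tau>))"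
    and ?P = "\<lambda>D'. \<Prod>j<k. ffact (u j) (type_count \<tau> D' j)"
  have fin: "finite D" "finite (D \<union> D')" using insert.prems insert.hyps finite_subset by auto
  have cards: "card D \<le> n" "card (D \<union> D') = card D + card D'"
    using insert.prems insert.hyps fin card_mono[of "{..<n}" D] by (auto intro: card_Un_disjoint)
  show ?case
  proof (cases "extensions n k u (D \<union> insert v D') \<tau> = {}")
    case True
    then show ?thesis by (simp add: prod_nonneg)
  next
    case False
    then obtain c where "c \<in> extensions n k u (D \<union> D') \<tau>" by (auto simp: extensions_def)
    then have "type_count \<tau> (D \<union> D') ?j \<le> u ?j"
      using insert.prems by (intro type_count_le_of_extension) auto
    moreover have mono: "type_count \<tau> D' ?j \<le> type_count \<tau> (D \<union> D') ?j"
      using fin by (intro type_count_mono) auto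
    ultimately have nonneg: "0 \<le> real (u ?j) - type_count \<tau> D' ?j" by linarith
    have "?X (insert v D') * ffact (n - card D) (card (insert v D'))
        = (?X (insert v D') * (real n - card (D \<union> D'))) * ffact (n - card D) (card D')"
      using insert.hyps cards by (simp add: ffact_Suc of_nat_diff algebra_simps)
    also have "\<dots> = ?X D' * (real (u ?j) - type_count \<tau> (D \<union> D') ?j) * ffact (n - card D) (card D')"
      using insert.prems insert.hyps card_extensions_insert[of "D \<union> D'" n v \<tau> k u] by simp
    also have "\<dots> \<le> ?X D' * (real (u ?j) - type_count \<tau> D' ?j) * ffact (n - card D) (card D')"
      using mono by (intro mult_right_mono mult_left_mono) auto
    also have "\<dots> = ?X D' * ffact (n - card D) (card D') * (real (u ?j) - type_count \<tau> D' ?j)" by simp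
    also have "\<dots> \<le> card (extensions n k u D \<tau>) * ?P D' * (real (u ?j) - type_count \<tau> D' ?j)"
      using insert nonneg by (intro mult_right_mono insert.IH) auto
    also have "\<dots> = card (extensions n k u D \<tau>) * ?P (insert v D')"
      using insert.hyps insert.prems by (simp add: prod_ffact_type_count_insert)
    finally show ?thesis .
  qed
qed

lemma card_extensions_UN_le:
  assumes "finite P" "D \<subseteq> {..<n}" "\<And>p. p \<in> P \<Longrightarrow> h p \<subseteq> {..<n} - D" "disjoint_family_on h P"
    and color: "\<And>p v. p \<in> P \<Longrightarrow> v \<in> h p \<Longrightarrow> \<tau> v = s p" and s: "\<And>p. p \<in> P \<Longrightarrow> s p < k"
  shows "card (extensions n k u (D \<union> (\<Union>p\<in>P. h p)) \<tau>) * ffact (n - card D) (\<Sum>p\<in>P. card (h p))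
       \<le> card (extensions n k u D \<tau>) * (\<Prod>p\<in>P. ffact (u (s p)) (card (h p)))"
proof -
  have finh: "finite (h p)" if "p \<in> P" for p using assms(3)[OF that] finite_subset by blast
  have card_UN: "card (\<Union>p\<in>Q. h p) = (\<Sum>p\<in>Q. card (h p))" if "Q \<subseteq> P" for Q
    using finite_subset[OF that assms(1)] disjoint_family_on_mono[OF that assms(4)] finh that
    by (intro card_UN_disjoint') auto
  have "(\<Prod>j<k. ffact (u j) (type_count \<tau> (\<Union>p\<in>P. h p) j)) \<le> (\<Prod>j<k. \<Prod>p\<in>{p \<in> P. s p = j}. ffact (u (s p)) (card (h p)))"
  proof (intro prod_mono conjI ffact_nonneg)
    fix j
    have "{v \<in> (\<Union>p\<in>P. h p). \<tau> v = j} = (\<Union>p\<in>{p \<in> P. s p = j}. h p)" using color by auto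
    then have "type_count \<tau> (\<Union>p\<in>P. h p) j = (\<Sum>p\<in>{p \<in> P. s p = j}. card (h p))"
      by (simp add: type_count_def card_UN)
    then have "ffact (u j) (type_count \<tau> (\<Union>p\<in>P. h p) j) \<le> (\<Prod>p\<in>{p \<in> P. s p = j}. ffact (u j) (card (h p)))"
      using ffact_sum_le[of "{p \<in> P. s p = j}" "u j" "\<lambda>p. card (h p)"] assms(1) by simp
    also have "\<dots> = (\<Prod>p\<in>{p \<in> P. s p = j}. ffact (u (s p)) (card (h p)))" by (intro prod.cong) auto
    finally show "ffact (u j) (type_count \<tau> (\<Union>p\<in>P. h p) j) \<le> (\<Prod>p\<in>{p \<in> P. s p = j}. ffact (u (s p)) (card (h p)))" .
  qed
  also have "\<dots> = (\<Prod>p\<in>P. ffact (u (s p)) (card (h p)))"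
    using assms(1) s by (intro prod.group) auto
  finally have prod_le: "(\<Prod>j<k. ffact (u j) (type_count \<tau> (\<Union>p\<in>P. h p) j)) \<le> (\<Prod>p\<in>P. ffact (u (s p)) (card (h p)))" .
  have "card (extensions n k u (D \<union> (\<Union>p\<in>P. h p)) \<tau>) * ffact (n - card D) (card (\<Union>p\<in>P. h p))
      \<le> card (extensions n k u D \<tau>) * (\<Prod>j<k. ffact (u j) (type_count \<tau> (\<Union>p\<in>P. h p) j))"
    using assms(1-3) finh color s by (intro card_extensions_Un_le) fastforce+
  also have "\<dots> \<le> card (extensions n k u D \<tau>) * (\<Prod>p\<in>P. ffact (u (s p)) (card (h p)))"
    using prod_le by (intro mult_left_mono) auto
  finally show ?thesis by (simp add: card_UN)
qed

section \<open>Overlaps of two colorings\<close>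

lemma prod_of_bool: "finite A \<Longrightarrow> (\<Prod>x\<in>A. of_bool (P x)) = (of_bool (\<forall>x\<in>A. P x) :: real)"
  by (induction A rule: finite_induct) auto

lemma sum_subsets_by_card:
  fixes g :: "nat \<Rightarrow> real"
  assumes "finite A" "finite I"
  shows "(\<Sum>T\<in>{T. T \<subseteq> A \<and> card T \<in> I}. g (card T)) = (\<Sum>t\<in>I. real (card A choose t) * g t)"
proof -
  have "{T. T \<subseteq> A \<and> card T \<in> I} = (\<Union>t\<in>I. {T. T \<subseteq> A \<and> card T = t})" by auto
  then have "(\<Sum>T\<in>{T. T \<subseteq> A \<and> card T \<in> I}. g (card T)) = (\<Sum>t\<in>I. \<Sum>T\<in>{T. T \<subseteq> A \<and> card T = t}. g (card T))"
    using assms by (simp only:) (intro sum.UNION_disjoint; auto)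
  also have "\<dots> = (\<Sum>t\<in>I. real (card A choose t) * g t)"
    using n_subsets[OF assms(1)] by (intro sum.cong refl) simp
  finally show ?thesis .
qed

lemma sum_Pow_by_card:
  fixes g :: "nat \<Rightarrow> real"
  assumes "finite A"
  shows "(\<Sum>T\<in>Pow A. g (card T)) = (\<Sum>t\<le>card A. real (card A choose t) * g t)"
proof -
  have "Pow A = {T. T \<subseteq> A \<and> card T \<in> {..card A}}" using assms by (auto intro: card_mono)
  then show ?thesis using sum_subsets_by_card[OF assms, of "{..card A}" g] by simp
qed

lemma disjoint_family_on_class_overlap:
  "(\<And>p. p \<in> P \<Longrightarrow> h p \<subseteq> class_overlap n c c' p) \<Longrightarrow> disjoint_family_on h P"
  unfolding disjoint_family_on_def using class_overlap_disjoint[of _ _ n c c'] by blast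

lemma sum_card_overlaps_le:
  assumes "c \<in> sized_colorings n k u" "finite P" "P \<subseteq> {..<k} \<times> {..<k}"
    and "\<And>p. p \<in> P \<Longrightarrow> h p \<subseteq> color_class n c (fst p)" "disjoint_family_on h P"
  shows "(\<Sum>p\<in>P. card (h p)) \<le> (\<Sum>j<k. u j)"
proof -
  have "(\<Sum>p\<in>P. card (h p)) = card (\<Union>p\<in>P. h p)"
    using assms(2,5) finite_subset[OF assms(4)] by (intro card_UN_disjoint'[symmetric]) auto
  also have "\<dots> \<le> card (\<Union>j<k. color_class n c j)"
    using assms(3,4) by (intro card_mono) fastforce+
  also have "\<dots> \<le> (\<Sum>j<k. card (color_class n c j))" by (rule card_UN_le) simp
  also have "\<dots> = (\<Sum>j<k. u j)" using assms(1) by (simp add: card_color_class)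
  finally show ?thesis .
qed

text \<open>Every part \<open>h p\<close> fixed inside a class of the second coloring costs a factor
  \<open>ffact (u (snd p)) (card (h p)) * x ^ card (h p)\<close>, where \<open>1 / x\<close> plays the role of the number
  of uncovered vertices.\<close>

lemma card_extensions_containing_le:
  fixes x C\<^sub>0 :: real
  assumes c: "c \<in> sized_colorings n k u" and D: "D \<subseteq> {..<n}"
    and P: "finite P" "P \<subseteq> {..<k} \<times> {..<k}"
    and h: "\<And>p. p \<in> P \<Longrightarrow> h p \<subseteq> color_class n c (fst p) - D"
    and nonneg: "0 \<le> x" "0 \<le> C\<^sub>0"
    and C\<^sub>0: "\<And>t. t \<le> n - card D \<Longrightarrow> t \<le> (\<Sum>j<k. u j) \<Longrightarrow> 1 \<le> C\<^sub>0 * x ^ t * ffact (n - card D) t"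
  shows "real (card {c' \<in> extensions n k u D \<tau>. \<forall>p\<in>P. h p \<subseteq> color_class n c' (snd p)})
     \<le> card (extensions n k u D \<tau>) * C\<^sub>0 * (\<Prod>p\<in>P. ffact (u (snd p)) (card (h p)) * x ^ card (h p))"
    (is "real (card ?A) \<le> ?rhs")
proof (cases "?A = {}")
  case True
  have "0 \<le> ?rhs" using nonneg by (intro mult_nonneg_nonneg prod_nonneg) auto
  then show ?thesis unfolding True by simp
next
  case False
  then obtain c' where c': "c' \<in> extensions n k u D \<tau>" "\<And>p. p \<in> P \<Longrightarrow> h p \<subseteq> color_class n c' (snd p)" by blast
  let ?t = "\<Sum>p\<in>P. card (h p)" and ?U = "\<Union>p\<in>P. h p"
  have disjoint: "disjoint_family_on h P"
    using h c'(2) by (intro disjoint_family_on_class_overlap[of _ _ n c c']) (auto simp: class_overlap_def)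
  have outside: "h p \<subseteq> {..<n} - D" if "p \<in> P" for p using h[OF that] color_class_subset[of n c] by blast
  have color: "c' v = snd p" if "p \<in> P" "v \<in> h p" for p v
    using subsetD[OF c'(2)[OF that(1)] that(2)] by (simp add: color_class_def)
  have "card ?U = ?t"
    using P(1) disjoint finite_subset[OF outside] by (intro card_UN_disjoint') auto
  moreover have "card ?U \<le> card ({..<n} - D)" using outside by (intro card_mono) auto
  ultimately have "?t \<le> n - card D" using D finite_subset[OF D] by (simp add: card_Diff_subset)
  moreover have "?t \<le> (\<Sum>j<k. u j)"
    using h by (intro sum_card_overlaps_le[OF c P _ disjoint]) auto
  ultimately have cost: "1 \<le> C\<^sub>0 * x ^ ?t * ffact (n - card D) ?t" by (rule C\<^sub>0)
  have "?A \<subseteq> extensions n k u (D \<union> ?U) c'"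
    using c'(1) color by (force simp: extensions_def color_class_def)
  then have "real (card ?A) \<le> real (card (extensions n k u (D \<union> ?U) c')) * 1"
    using card_mono[OF finite_extensions] by simp
  also have "\<dots> \<le> card (extensions n k u (D \<union> ?U) c') * (C\<^sub>0 * x ^ ?t * ffact (n - card D) ?t)"
    using cost by (intro mult_left_mono) auto
  also have "\<dots> = C\<^sub>0 * x ^ ?t * (card (extensions n k u (D \<union> ?U) c') * ffact (n - card D) ?t)" by simp
  also have "\<dots> \<le> C\<^sub>0 * x ^ ?t * (card (extensions n k u D c') * (\<Prod>p\<in>P. ffact (u (snd p)) (card (h p))))"
    using nonneg P by (intro mult_left_mono card_extensions_UN_le[OF P(1) D outside disjoint color]) auto
  also have "extensions n k u D c' = extensions n k u D \<tau>"
    using c'(1) by (intro extensions_cong) (auto simp: extensions_def)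
  finally show ?thesis by (simp add: power_sum prod.distrib mult_ac)
qed

lemma sum_extensions_prod_le:
  fixes x C\<^sub>0 :: real
  assumes c: "c \<in> sized_colorings n k u" and D: "D \<subseteq> {..<n}"
    and P: "finite P" "P \<subseteq> {..<k} \<times> {..<k}"
    and finF: "\<And>p. p \<in> P \<Longrightarrow> finite (F p)"
    and F: "\<And>p T. p \<in> P \<Longrightarrow> T \<in> F p \<Longrightarrow> T \<subseteq> color_class n c (fst p) - D"
    and w: "\<And>T. 0 \<le> w T" and nonneg: "0 \<le> x" "0 \<le> C\<^sub>0"
    and C\<^sub>0: "\<And>t. t \<le> n - card D \<Longrightarrow> t \<le> (\<Sum>j<k. u j) \<Longrightarrow> 1 \<le> C\<^sub>0 * x ^ t * ffact (n - card D) t"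
  shows "(\<Sum>c'\<in>extensions n k u D \<tau>. \<Prod>p\<in>P. \<Sum>T\<in>F p. of_bool (T \<subseteq> color_class n c' (snd p)) * w T)
     \<le> card (extensions n k u D \<tau>) * C\<^sub>0 * (\<Prod>p\<in>P. \<Sum>T\<in>F p. w T * ffact (u (snd p)) (card T) * x ^ card T)"
proof -
  let ?X = "extensions n k u D \<tau>"
  have in_class: "h p \<subseteq> color_class n c (fst p) - D" if "h \<in> PiE P F" "p \<in> P" for h p
    using F[OF that(2) PiE_mem[OF that]] .
  let ?cost = "\<lambda>h. \<Prod>p\<in>P. ffact (u (snd p)) (card (h p)) * x ^ card (h p)"
  have "(\<Sum>c'\<in>?X. \<Prod>p\<in>P. \<Sum>T\<in>F p. of_bool (T \<subseteq> color_class n c' (snd p)) * w T)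
      = (\<Sum>c'\<in>?X. \<Sum>h\<in>PiE P F. \<Prod>p\<in>P. of_bool (h p \<subseteq> color_class n c' (snd p)) * w (h p))"
    using P(1) finF by (intro sum.cong refl prod_sum_PiE) auto
  also have "\<dots> = (\<Sum>h\<in>PiE P F. (\<Prod>p\<in>P. w (h p)) * (\<Sum>c'\<in>?X. of_bool (\<forall>p\<in>P. h p \<subseteq> color_class n c' (snd p))))"
    unfolding sum_distrib_left using P(1)
    by (subst sum.swap) (simp only: prod.distrib prod_of_bool mult.commute)
  also have "\<dots> = (\<Sum>h\<in>PiE P F. (\<Prod>p\<in>P. w (h p)) * real (card {c' \<in> ?X. \<forall>p\<in>P. h p \<subseteq> color_class n c' (snd p)}))"
    by (simp add: Collect_conj_eq)
  also have "\<dots> \<le> (\<Sum>h\<in>PiE P F. (\<Prod>p\<in>P. w (h p)) * (card ?X * C\<^sub>0 * ?cost h))"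
    using w in_class
    by (intro sum_mono mult_left_mono prod_nonneg card_extensions_containing_le[OF c D P _ nonneg C\<^sub>0]) auto
  also have "\<dots> = card ?X * C\<^sub>0 * (\<Sum>h\<in>PiE P F. \<Prod>p\<in>P. w (h p) * ffact (u (snd p)) (card (h p)) * x ^ card (h p))"
    unfolding sum_distrib_left by (intro sum.cong refl) (simp add: prod.distrib algebra_simps)
  also have "(\<Sum>h\<in>PiE P F. \<Prod>p\<in>P. w (h p) * ffact (u (snd p)) (card (h p)) * x ^ card (h p))
      = (\<Prod>p\<in>P. \<Sum>T\<in>F p. w T * ffact (u (snd p)) (card T) * x ^ card T)"
    using P(1) finF by (intro prod_sum_PiE[symmetric]) auto
  finally show ?thesis .
qed

definition pair_term :: "nat \<Rightarrow> nat \<Rightarrow> real \<Rightarrow> nat \<Rightarrow> real" where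
  "pair_term u v x t = real (u choose t) * ffact v t * 2 ^ (t choose 2) * x ^ t"

definition pair_weight :: "nat \<Rightarrow> nat \<Rightarrow> nat \<Rightarrow> real \<Rightarrow> real" where
  "pair_weight u v L x = (\<Sum>t=2..<L. pair_term u v x t)"

definition small_subsets :: "nat \<Rightarrow> 'a set \<Rightarrow> 'a set set" where
  "small_subsets L X = {T. T \<subseteq> X \<and> card T \<in> insert 0 {2..<L}}"

lemma finite_small_subsets [simp]: "finite X \<Longrightarrow> finite (small_subsets L X)"
  unfolding small_subsets_def by (rule finite_subset[of _ "Pow X"]) auto

lemma two_power_choose_le_sum_small_subsets:
  assumes "finite X" "card (X \<inter> Y) < L"
  shows "2 ^ (card (X \<inter> Y) choose 2) \<le> (\<Sum>T\<in>small_subsets L X. of_bool (T \<subseteq> Y) * (2::real) ^ (card T choose 2))"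
proof -
  define T where "T = (if card (X \<inter> Y) = 1 then {} else X \<inter> Y)"
  have "card T = 0 \<or> 2 \<le> card T \<and> card T < L" using assms(2) by (auto simp: T_def)
  then have "T \<in> small_subsets L X" by (auto simp: T_def small_subsets_def)
  then have "of_bool (T \<subseteq> Y) * (2::real) ^ (card T choose 2)
      \<le> (\<Sum>T\<in>small_subsets L X. of_bool (T \<subseteq> Y) * 2 ^ (card T choose 2))"
    using assms(1) by (intro member_le_sum) auto
  then show ?thesis by (auto simp: T_def binomial_eq_0 split: if_splits)
qed

lemma sum_small_subsets_le_exp:
  assumes "finite A" "X \<subseteq> A" "0 < L" "0 \<le> x"
  shows "(\<Sum>T\<in>small_subsets L X. 2 ^ (card T choose 2) * ffact v (card T) * x ^ card T) \<le> exp (pair_weight (card A) v L x)"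
proof -
  let ?g = "\<lambda>t. (2::real) ^ (t choose 2) * ffact v t * x ^ t"
  have "(\<Sum>T\<in>small_subsets L X. ?g (card T)) \<le> (\<Sum>T\<in>small_subsets L A. ?g (card T))"
    using assms by (intro sum_mono2) (auto simp: small_subsets_def)
  also have "\<dots> = (\<Sum>t\<in>insert 0 {2..<L}. real (card A choose t) * ?g t)"
    unfolding small_subsets_def by (rule sum_subsets_by_card) (use assms in auto)
  also have "\<dots> = 1 + pair_weight (card A) v L x"
    by (simp add: pair_weight_def pair_term_def binomial_eq_0 algebra_simps)
  also have "\<dots> \<le> exp (pair_weight (card A) v L x)" by (rule exp_ge_add_one_self)
  finally show ?thesis .
qed

lemma sum_small_overlaps_le:
  fixes x C\<^sub>0 :: real
  assumes c: "c \<in> sized_colorings n k u" and D: "D \<subseteq> {..<n}"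
    and P: "P \<subseteq> {..<k} \<times> {..<k}" and L: "0 < L"
    and C': "C' \<subseteq> extensions n k u D \<tau>"
      "\<And>c' p. c' \<in> C' \<Longrightarrow> p \<in> P \<Longrightarrow> card (class_overlap n c c' p) < L"
      "\<And>c' p. c' \<in> C' \<Longrightarrow> p \<in> P \<Longrightarrow> class_overlap n c c' p \<inter> D = {}"
    and nonneg: "0 \<le> x" "0 \<le> C\<^sub>0"
    and C\<^sub>0: "\<And>t. t \<le> n - card D \<Longrightarrow> t \<le> (\<Sum>j<k. u j) \<Longrightarrow> 1 \<le> C\<^sub>0 * x ^ t * ffact (n - card D) t"
  shows "(\<Sum>c'\<in>C'. \<Prod>p\<in>P. 2 ^ (card (class_overlap n c c' p) choose 2))
     \<le> card (extensions n k u D \<tau>) * C\<^sub>0 * exp (\<Sum>p\<in>P. pair_weight (u (fst p)) (u (snd p)) L x)"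
proof -
  have finP: "finite P" using P finite_subset by blast
  let ?F = "\<lambda>p. small_subsets L (color_class n c (fst p) - D)" and ?w = "\<lambda>T. (2::real) ^ (card T choose 2)"
  let ?S = "\<lambda>c' p. \<Sum>T\<in>?F p. of_bool (T \<subseteq> color_class n c' (snd p)) * ?w T"
  have overlap_le: "2 ^ (card (class_overlap n c c' p) choose 2) \<le> ?S c' p" if "c' \<in> C'" "p \<in> P" for c' p
  proof -
    have "class_overlap n c c' p = (color_class n c (fst p) - D) \<inter> color_class n c' (snd p)"
      using C'(3)[OF that] by (auto simp: class_overlap_def)
    then show ?thesis
      using two_power_choose_le_sum_small_subsets[of "color_class n c (fst p) - D" "color_class n c' (snd p)" L]
        C'(2)[OF that]
      by simp
  qed
  have weight_le: "(\<Sum>T\<in>?F p. ?w T * ffact (u (snd p)) (card T) * x ^ card T) \<le> exp (pair_weight (u (fst p)) (u (snd p)) L x)"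
    if "p \<in> P" for p
  proof -
    have "card (color_class n c (fst p)) = u (fst p)" using c P that by (intro card_color_class) auto
    then show ?thesis
      using sum_small_subsets_le_exp[of "color_class n c (fst p)" "color_class n c (fst p) - D" L x "u (snd p)"] L nonneg
      by simp
  qed
  have "(\<Sum>c'\<in>C'. \<Prod>p\<in>P. 2 ^ (card (class_overlap n c c' p) choose 2)) \<le> (\<Sum>c'\<in>C'. \<Prod>p\<in>P. ?S c' p)"
    using overlap_le by (intro sum_mono prod_mono) auto
  also have "\<dots> \<le> (\<Sum>c'\<in>extensions n k u D \<tau>. \<Prod>p\<in>P. ?S c' p)"
    using C'(1) by (intro sum_mono2 prod_nonneg sum_nonneg ballI) auto
  also have "\<dots> \<le> card (extensions n k u D \<tau>) * C\<^sub>0 * (\<Prod>p\<in>P. \<Sum>T\<in>?F p. ?w T * ffact (u (snd p)) (card T) * x ^ card T)"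
    by (rule sum_extensions_prod_le[OF c D finP P _ _ _ nonneg C\<^sub>0])
      (auto simp: small_subsets_def intro: finite_subset[OF _ finite_small_subsets])
  also have "\<dots> \<le> card (extensions n k u D \<tau>) * C\<^sub>0 * (\<Prod>p\<in>P. exp (pair_weight (u (fst p)) (u (snd p)) L x))"
    using weight_le nonneg by (intro mult_left_mono prod_mono conjI sum_nonneg) auto
  also have "(\<Prod>p\<in>P. exp (pair_weight (u (fst p)) (u (snd p)) L x)) = exp (\<Sum>p\<in>P. pair_weight (u (fst p)) (u (snd p)) L x)"
    using finP by (simp add: exp_sum)
  finally show ?thesis .
qed

section \<open>Planting independent sets\<close>

lemma colorable_prob_plant:
  assumes "0 < m"
  shows "(colorable_prob m f)\<^sup>2
     \<le> exp (real r ^ 2 * pair_weight a a (Suc a) (1 / m)) * colorable_prob (m + a * r) (f + r)"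
proof -
  let ?n = "m + a * r" and ?u = "\<lambda>j::nat. a"
  let ?S = "exp (real r ^ 2 * pair_weight a a (Suc a) (1 / m))"
  have overlaps: "(\<Sum>c'\<in>sized_colorings ?n r ?u. overlap_weight ?n r c c') \<le> ?S * card (sized_colorings ?n r ?u)"
    if c: "c \<in> sized_colorings ?n r ?u" for c
  proof -
    have "(\<Sum>c'\<in>sized_colorings ?n r ?u. overlap_weight ?n r c c')
       \<le> real (card (extensions ?n r ?u {} c)) * 1 * exp (\<Sum>p\<in>{..<r} \<times> {..<r}. pair_weight a a (Suc a) (1 / m))"
      unfolding overlap_weight_def
    proof (rule sum_small_overlaps_le[OF c])
      fix c' and p :: "nat \<times> nat" assume "p \<in> {..<r} \<times> {..<r}"
      then have "card (color_class ?n c (fst p)) = a" using c by (auto simp: card_color_class)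
      then show "card (class_overlap ?n c c' p) < Suc a"
        unfolding class_overlap_def by (metis card_mono finite_color_class inf_le1 less_Suc_eq_le)
    next
      fix t assume "t \<le> (\<Sum>j<r. a)"
      then have t: "t \<le> a * r" by (simp add: mult.commute)
      have "real m ^ t = (\<Prod>i<t. real m)" by simp
      also have "\<dots> \<le> ffact ?n t" unfolding ffact_def using t
        by (intro prod_mono) (auto simp: of_nat_mult[symmetric] simp del: of_nat_mult)
      finally show "1 \<le> 1 * (1 / real m) ^ t * ffact (?n - card {}) t"
        using assms by (simp add: power_divide field_simps)
    qed auto
    then show ?thesis by (simp add: card_cartesian_product power2_eq_square algebra_simps)
  qed
  have "(colorable_prob (?n - (\<Sum>j<r. a)) f)\<^sup>2 \<le> ?S * colorable_prob ?n (f + r)"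
    by (rule colorable_prob_second_moment[OF _ overlaps]) (auto simp: mult.commute)
  moreover have "?n - (\<Sum>j<r. a) = m" by (simp add: mult.commute)
  ultimately show ?thesis by simp
qed

definition indep_weight :: "nat \<Rightarrow> real" where
  "indep_weight u = fact u * 2 ^ (u choose 2)"

definition indep_mean :: "nat \<Rightarrow> nat \<Rightarrow> real" where
  "indep_mean n u = real n ^ u / indep_weight u"

lemma indep_weight_pos [simp]: "0 < indep_weight u"
  by (simp add: indep_weight_def)

lemma indep_weight_nonzero [simp]: "indep_weight u \<noteq> 0"
  by (simp add: indep_weight_def)

lemma indep_mean_pos: "0 < n \<Longrightarrow> 0 < indep_mean n u"
  by (simp add: indep_mean_def)

lemma real_choose_2: "real (t choose 2) = real t * (real t - 1) / 2"
proof (induction t)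
  case (Suc t)
  have "Suc t choose 2 = t + (t choose 2)" by (simp add: numeral_2_eq_2)
  then show ?case using Suc by (simp add: field_simps)
qed simp

lemma two_powr_power: "(2 powr y) ^ s = 2 powr (y * real s)" for y :: real
  by (simp add: powr_power mult.commute)

lemma two_power_choose_2: "(2::real) ^ (t choose 2) = 2 powr (real t * (real t - 1) / 2)"
  by (simp add: powr_realpow[symmetric] real_choose_2)

lemma binomial_le_power_div_fact: "real (n choose t) \<le> real n ^ t / fact t"
proof -
  have "real ((n choose t) * fact t) \<le> real (n ^ t)" by (rule of_nat_mono[OF binomial_fact_pow])
  then show ?thesis by (simp add: pos_le_divide_eq)
qed

lemma binomial_le_power: "real (n choose t) \<le> real n ^ t"
proof -
  have "real n ^ t / fact t \<le> real n ^ t / 1" by (intro divide_left_mono) (auto simp: fact_ge_1)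
  then show ?thesis using binomial_le_power_div_fact[of n t] by linarith
qed

lemma pair_term_le_half:
  fixes m R :: real
  assumes a: "1 \<le> a" and m: "2 powr (real a / 2) \<le> m" and R: "0 \<le> R" "R \<le> m" and t: "2 \<le> t" "2 * t \<le> a"
  shows "R * pair_term a a (1 / m) t \<le> (real a ^ 4 * 2 powr (- real a / 4)) ^ (t - 1)"
proof -
  define s where "s = t - 1"
  have s: "t = Suc s" "1 \<le> s" using t(1) by (auto simp: s_def)
  have m_pos: "0 < m" using m powr_gt_zero[of 2 "real a / 2"] by linarith
  have m_inv: "1 / m \<le> 2 powr (- real a / 2)"
    using m m_pos by (simp add: powr_minus_divide field_simps)
  have "R * pair_term a a (1 / m) t \<le> m * (real a ^ t * real a ^ t * 2 powr (real t * (real t - 1) / 2) * (1 / m) ^ t)"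
    unfolding pair_term_def two_power_choose_2 using R m_pos
    by (intro mult_mono binomial_le_power ffact_le_power order_refl mult_nonneg_nonneg zero_le_power) auto
  also have "\<dots> = (real a ^ t * real a ^ t) * 2 powr (real t * (real t - 1) / 2) * (1 / m) ^ s"
    using m_pos by (simp add: s(1))
  also have "\<dots> \<le> real a ^ (4 * s) * 2 powr (real t * (real t - 1) / 2) * (2 powr (- real a / 2)) ^ s"
  proof -
    have "real a ^ t * real a ^ t \<le> real a ^ (4 * s)"
      unfolding power_add[symmetric] by (rule power_increasing) (use s a in auto)
    moreover have "(1 / m) ^ s \<le> (2 powr (- real a / 2)) ^ s"
      by (rule power_mono[OF m_inv]) (use m_pos in simp)
    ultimately show ?thesis using m_pos by (intro mult_mono) auto
  qed
  also have "\<dots> = real a ^ (4 * s) * 2 powr (real t * (real t - 1) / 2 + (- real a / 2) * s)"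
    by (simp only: two_powr_power powr_add mult.assoc)
  also have "\<dots> \<le> real a ^ (4 * s) * 2 powr ((- real a / 4) * s)"
  proof -
    have "real s * (real t - real a / 2) \<le> 0" using t(2) by (intro mult_nonneg_nonpos) auto
    then have "real t * (real t - 1) / 2 + (- real a / 2) * s \<le> (- real a / 4) * s"
      using s by (simp add: algebra_simps)
    then show ?thesis by (intro mult_left_mono powr_mono) auto
  qed
  also have "\<dots> = (real a ^ 4 * 2 powr (- real a / 4)) ^ s"
    by (simp add: power_mult_distrib power_mult two_powr_power)
  finally show ?thesis by (simp add: s_def)
qed

lemma ffact_inverse_power_le:
  fixes m R :: real
  assumes m: "0 < m" and R: "0 \<le> R" "R * indep_weight a \<le> m ^ a" and t: "t \<le> a"
  shows "R * ffact a t * (1 / m) ^ t \<le> m ^ (a - t) / 2 powr (real a * (real a - 1) / 2)"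
proof -
  have "ffact a t \<le> fact a"
    using t by (simp add: ffact_eq_fact_div divide_le_eq fact_ge_1 mult_le_cancel_left1)
  then have "R * ffact a t * (1 / m) ^ t * 2 ^ (a choose 2) \<le> R * fact a * (1 / m) ^ t * 2 ^ (a choose 2)"
    using R m by (intro mult_right_mono mult_left_mono) auto
  also have "\<dots> = R * indep_weight a * (1 / m) ^ t" by (simp add: indep_weight_def)
  also have "\<dots> \<le> m ^ a * (1 / m) ^ t" using R(2) m by (intro mult_right_mono) auto
  also have "\<dots> = m ^ (a - t)" using m t by (simp add: power_diff power_divide)
  finally show ?thesis by (simp add: pos_le_divide_eq two_power_choose_2)
qed

lemma pair_term_le_above_half:
  fixes m R :: real
  assumes a: "2 \<le> a" and m: "0 < m" "m \<le> 2 * a * 2 powr (real a / 2)"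
    and R: "0 \<le> R" "R * indep_weight a \<le> m ^ a" and t: "a < 2 * t" "t < a"
  shows "R * pair_term a a (1 / m) t \<le> (real a ^ 4 * 2 powr (- real a / 4)) ^ (a - t)"
proof -
  define s where "s = a - t"
  have s: "1 \<le> s" "a = t + s" "2 * s < a" using t by (auto simp: s_def)
  have rs: "real a = real t + real s" using s(2) by simp
  have choose_le: "real (a choose t) \<le> real a ^ s"
    using binomial_le_power[of a s] binomial_symmetric[of t a] s(2) by simp
  have "R * pair_term a a (1 / m) t
      = (R * ffact a t * (1 / m) ^ t) * (real (a choose t) * 2 powr (real t * (real t - 1) / 2))"
    by (simp add: pair_term_def two_power_choose_2)
  also have "\<dots> \<le> (m ^ s / 2 powr (real a * (real a - 1) / 2)) * (real a ^ s * 2 powr (real t * (real t - 1) / 2))"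
    using ffact_inverse_power_le[OF m(1) R, of t] t(2) choose_le m by (intro mult_mono) (auto simp: s_def)
  also have "\<dots> = (real a * m) ^ s * 2 powr (real t * (real t - 1) / 2 - real a * (real a - 1) / 2)"
    by (simp add: powr_diff power_mult_distrib)
  also have "\<dots> \<le> (real a * (2 * a * 2 powr (real a / 2))) ^ s
      * 2 powr (real t * (real t - 1) / 2 - real a * (real a - 1) / 2)"
    using m by (intro mult_right_mono power_mono mult_left_mono) auto
  also have "\<dots> = (2 * real a ^ 2) ^ s * 2 powr (real a / 2 * s + (real t * (real t - 1) / 2 - real a * (real a - 1) / 2))"
    by (simp add: power_mult_distrib two_powr_power power2_eq_square powr_add)
  also have "\<dots> \<le> (2 * real a ^ 2) ^ s * 2 powr ((1 - real a / 4) * s)"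
  proof -
    have "0 \<le> real s * (real a / 2 - s + 1)" using s(3) by (intro mult_nonneg_nonneg) auto
    then have "real a / 2 * s + (real t * (real t - 1) / 2 - real a * (real a - 1) / 2) \<le> (1 - real a / 4) * s"
      unfolding rs by (simp add: field_simps)
    then show ?thesis by (intro mult_left_mono powr_mono) auto
  qed
  also have "\<dots> = (4 * real a ^ 2 * 2 powr (- real a / 4)) ^ s"
  proof -
    have "2 powr ((1 - real a / 4) * s) = (2 * 2 powr (- real a / 4)) ^ s"
      unfolding two_powr_power[symmetric] by (simp add: powr_diff powr_minus_divide)
    then show ?thesis by (simp only: power_mult_distrib[symmetric]) (simp add: mult_ac)
  qed
  also have "\<dots> \<le> (real a ^ 4 * 2 powr (- real a / 4)) ^ s"
  proof (intro power_mono mult_right_mono)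
    have "4 * real a ^ 2 \<le> real a ^ 2 * real a ^ 2"
      using a power_mono[of 2 "real a" 2] by (intro mult_right_mono) auto
    then show "4 * real a ^ 2 \<le> real a ^ 4" by (simp add: power_add[symmetric])
  qed auto
  finally show ?thesis by (simp add: s_def)
qed

lemma plant_pair_weight_le:
  assumes a: "2 \<le> a" and \<delta>: "real a ^ 4 * 2 powr (- real a / 4) \<le> 1 / a"
    and m: "2 powr (real a / 2) \<le> real m" "real m \<le> 2 * a * 2 powr (real a / 2)"
    and r: "real r ^ 2 \<le> m" "real r ^ 2 \<le> indep_mean m a"
  shows "real r ^ 2 * pair_weight a a (Suc a) (1 / m) \<le> 2"
proof -
  define \<delta> where "\<delta> = real a ^ 4 * 2 powr (- real a / 4)"
  let ?X = "\<lambda>t. real r ^ 2 * pair_term a a (1 / m) t"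
  have m_pos: "0 < real m" using m(1) powr_gt_zero[of 2 "real a / 2"] by linarith
  have R: "real r ^ 2 * indep_weight a \<le> real m ^ a"
    using r(2) by (simp add: indep_mean_def pos_le_divide_eq)
  have "1 / real a \<le> 1" using a by simp
  then have "\<delta> ^ s \<le> 1 / a" if "1 \<le> s" for s
    using power_decreasing[OF that, of \<delta>] \<delta> by (simp add: \<delta>_def)
  then have small: "y \<le> 1 / a" if "y \<le> \<delta> ^ s" "1 \<le> s" for y s using order_trans[OF that(1)] that(2) by blast
  have "?X t \<le> 1 / a" if t: "2 \<le> t" "t < a" for t
  proof (cases "2 * t \<le> a")
    case True
    then show ?thesis
      using a m(1) r(1) t unfolding \<delta>_def by (intro small[unfolded \<delta>_def, OF pair_term_le_half]) auto
  next
    case False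
    then show ?thesis
      using a m(2) m_pos R t by (intro small[unfolded \<delta>_def, OF pair_term_le_above_half]) auto
  qed
  then have below: "(\<Sum>t=2..<a. ?X t) \<le> (\<Sum>t=2..<a. 1 / a)" by (intro sum_mono) auto
  have "?X a = real r ^ 2 * indep_weight a / m ^ a"
    by (simp add: pair_term_def ffact_eq_fact_div indep_weight_def power_divide)
  then have top: "?X a \<le> 1" using R m_pos by (simp add: divide_le_eq)
  have "real r ^ 2 * pair_weight a a (Suc a) (1 / m) = (\<Sum>t=2..<a. ?X t) + ?X a"
    using a by (simp add: pair_weight_def sum_distrib_left distrib_left)
  also have "\<dots> \<le> (\<Sum>t=2..<a. 1 / a) + 1" using below top by linarith
  also have "(\<Sum>t=2..<a. 1 / real a) \<le> 1" using a by simp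
  finally show ?thesis by simp
qed

section \<open>Counting matchings by type\<close>

lemma sum_Pow_prod:
  fixes g :: "'s \<Rightarrow> 'a set \<Rightarrow> real"
  assumes "finite S" "\<And>s. s \<in> S \<Longrightarrow> finite (X s)" "disjoint_family_on X S"
  shows "(\<Sum>Z\<in>Pow (\<Union>s\<in>S. X s). \<Prod>s\<in>S. g s (Z \<inter> X s)) = (\<Prod>s\<in>S. \<Sum>Z\<in>Pow (X s). g s Z)"
  using assms
proof (induction S rule: finite_induct)
  case empty
  then show ?case by simp
next
  case (insert s S)
  let ?U = "\<Union>t\<in>S. X t"
  have fin: "finite ?U" "finite (X s)" using insert by auto
  have disjoint: "X s \<inter> ?U = {}" "disjoint_family_on X S"
    using insert.prems(2) insert.hyps by (auto simp: disjoint_family_on_insert)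
  have sum_eq_avg: "(\<Sum>Z\<in>Pow Y. f Z) = subset_avg Y f * 2 ^ card Y" for Y :: "'a set" and f
    by (simp add: subset_avg_def)
  have "(\<Sum>Z\<in>Pow (X s \<union> ?U). \<Prod>t\<in>insert s S. g t (Z \<inter> X t))
      = (\<Sum>Z\<in>Pow (X s \<union> ?U). g s (Z \<inter> X s) * (\<lambda>F. \<Prod>t\<in>S. g t (F \<inter> X t)) (Z \<inter> ?U))"
  proof (intro sum.cong refl)
    fix Z
    have "(\<Prod>t\<in>S. g t (Z \<inter> X t)) = (\<Prod>t\<in>S. g t (Z \<inter> ?U \<inter> X t))"
      by (intro prod.cong refl arg_cong[where f = "g _"]) auto
    then show "(\<Prod>t\<in>insert s S. g t (Z \<inter> X t)) = g s (Z \<inter> X s) * (\<lambda>F. \<Prod>t\<in>S. g t (F \<inter> X t)) (Z \<inter> ?U)"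
      using insert.hyps by simp
  qed
  also have "\<dots> = subset_avg (X s) (g s) * subset_avg ?U (\<lambda>F. \<Prod>t\<in>S. g t (F \<inter> X t)) * 2 ^ card (X s \<union> ?U)"
    unfolding sum_eq_avg using fin disjoint by (subst subset_avg_indep) auto
  also have "\<dots> = (\<Sum>Z\<in>Pow (X s). g s Z) * (\<Sum>Z\<in>Pow ?U. \<Prod>t\<in>S. g t (Z \<inter> X t))"
    unfolding sum_eq_avg using fin disjoint by (simp add: card_Un_disjoint power_add)
  also have "(\<Sum>Z\<in>Pow ?U. \<Prod>t\<in>S. g t (Z \<inter> X t)) = (\<Prod>t\<in>S. \<Sum>Z\<in>Pow (X t). g t Z)"
    using insert.prems disjoint by (intro insert.IH) auto
  finally show ?case using insert.hyps by simp
qed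

lemma sum_Pow_prod_type_count:
  fixes g :: "'s \<Rightarrow> nat \<Rightarrow> real"
  assumes "finite I" "finite S" "u ` I \<subseteq> S"
  shows "(\<Sum>Z\<in>Pow I. \<Prod>s\<in>S. g s (type_count u Z s))
       = (\<Prod>s\<in>S. \<Sum>t\<le>type_count u I s. real (type_count u I s choose t) * g s t)"
proof -
  let ?X = "\<lambda>s. {i \<in> I. u i = s}"
  have "type_count u Z s = card (Z \<inter> ?X s)" if "Z \<in> Pow I" for Z s
    using that unfolding type_count_def by (intro arg_cong[where f = card]) auto
  then have "(\<Sum>Z\<in>Pow I. \<Prod>s\<in>S. g s (type_count u Z s)) = (\<Sum>Z\<in>Pow I. \<Prod>s\<in>S. g s (card (Z \<inter> ?X s)))"
    by (intro sum.cong prod.cong) auto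
  also have "\<dots> = (\<Prod>s\<in>S. \<Sum>Z\<in>Pow (?X s). g s (card Z))"
  proof -
    have "(\<Union>s\<in>S. ?X s) = I" using assms(3) by auto
    then show ?thesis
      using sum_Pow_prod[of S ?X "\<lambda>s Z. g s (card Z)"] assms(1,2)
      by (simp add: disjoint_family_on_def disjoint_iff)
  qed
  also have "\<dots> = (\<Prod>s\<in>S. \<Sum>t\<le>type_count u I s. real (type_count u I s choose t) * g s t)"
    unfolding type_count_def using assms(1) by (intro prod.cong refl sum_Pow_by_card) auto
  finally show ?thesis .
qed

lemma sum_type_count:
  assumes "finite I" "finite S" "u ` I \<subseteq> S"
  shows "(\<Sum>s\<in>S. type_count u I s) = card I"
  using sum.group[OF assms, of "\<lambda>_. 1 :: nat"] by (simp add: type_count_def)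

definition typed_maps :: "('i \<Rightarrow> 's) \<Rightarrow> 'i set \<Rightarrow> 'i set \<Rightarrow> 'i set \<Rightarrow> ('i \<Rightarrow> 'i) set" where
  "typed_maps u I Z K = {f \<in> I \<rightarrow>\<^sub>E K. inj_on f (I - Z) \<and> (\<forall>i\<in>I - Z. u (f i) = u i)}"

lemma finite_typed_maps: "finite I \<Longrightarrow> finite K \<Longrightarrow> finite (typed_maps u I Z K)"
  by (rule finite_subset[of _ "I \<rightarrow>\<^sub>E K"]) (auto simp: typed_maps_def intro: finite_PiE)

lemma typed_maps_restrict:
  assumes "f \<in> typed_maps u (insert i I) Z K" "i \<notin> I"
  shows "f(i := undefined) \<in> typed_maps u I Z K"
proof -
  have "inj_on (f(i := undefined)) (I - Z) \<longleftrightarrow> inj_on f (I - Z)"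
    using assms(2) by (intro inj_on_cong) auto
  then show ?thesis
    using assms by (auto simp: typed_maps_def intro: fun_upd_in_PiE inj_on_subset)
qed

lemma typed_maps_last_value:
  assumes "f \<in> typed_maps u (insert i I) Z K" "i \<notin> I" "i \<notin> Z"
  shows "f i \<in> {j \<in> K. u j = u i} - (f(i := undefined)) ` {l \<in> I - Z. u l = u i}"
proof -
  have "(f(i := undefined)) ` {l \<in> I - Z. u l = u i} = f ` {l \<in> I - Z. u l = u i}"
    using assms(2) by (intro image_cong) auto
  moreover have "f i \<notin> f ` {l \<in> I - Z. u l = u i}"
    using assms by (auto simp: typed_maps_def inj_on_def)
  ultimately show ?thesis using assms by (auto simp: typed_maps_def)
qed

lemma card_unused_same_type:
  assumes "f \<in> typed_maps u I Z K" "finite K"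
  shows "real (card ({j \<in> K. u j = s} - f ` {l \<in> I - Z. u l = s})) = real (type_count u K s) - type_count u (I - Z) s"
proof -
  let ?used = "f ` {l \<in> I - Z. u l = s}"
  have sub: "?used \<subseteq> {j \<in> K. u j = s}" using assms(1) by (auto simp: typed_maps_def)
  have "inj_on f {l \<in> I - Z. u l = s}" using assms(1) by (auto simp: typed_maps_def intro: inj_on_subset)
  then have "card ?used = type_count u (I - Z) s" unfolding type_count_def by (rule card_image)
  moreover have "card ?used \<le> type_count u K s"
    unfolding type_count_def using sub assms(2) by (intro card_mono) auto
  ultimately show ?thesis
    using sub assms(2) finite_subset[OF sub] by (simp add: card_Diff_subset type_count_def)
qed

lemma card_le_sum_extensions:
  assumes "finite A" "\<And>f. f \<in> A \<Longrightarrow> finite (B f)"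
    and "\<And>f. f \<in> C \<Longrightarrow> f(i := undefined) \<in> A \<and> f i \<in> B (f(i := undefined))"
  shows "card C \<le> (\<Sum>f\<in>A. card (B f))"
proof -
  have "inj_on (\<lambda>f. (f(i := undefined), f i)) C"
    by (rule inj_onI) (metis fun_upd_triv fun_upd_upd prod.inject)
  then have "card C \<le> card (SIGMA f:A. B f)"
    using assms by (intro card_inj_on_le) (auto intro: finite_SigmaI)
  also have "\<dots> = (\<Sum>f\<in>A. card (B f))" using assms by (intro card_SigmaI) auto
  finally show ?thesis .
qed

lemma card_typed_maps_insert_le:
  assumes "finite I" "finite K" "i \<notin> I"
  shows "real (card (typed_maps u (insert i I) Z K))
     \<le> real (card (typed_maps u I Z K))
       * (if i \<in> Z then real (card K) else real (type_count u K (u i)) - type_count u (I - Z) (u i))"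
proof -
  let ?N = "typed_maps u I Z K"
  define opts where "opts f = (if i \<in> Z then K else {j \<in> K. u j = u i} - f ` {l \<in> I - Z. u l = u i})" for f
  have "card (typed_maps u (insert i I) Z K) \<le> (\<Sum>f\<in>?N. card (opts f))"
  proof (rule card_le_sum_extensions[OF finite_typed_maps[OF assms(1,2)]])
    fix f assume f: "f \<in> typed_maps u (insert i I) Z K"
    then have "f i \<in> K" by (auto simp: typed_maps_def)
    then show "f(i := undefined) \<in> ?N \<and> f i \<in> opts (f(i := undefined))"
      using typed_maps_restrict[OF f] typed_maps_last_value[OF f] assms(3) by (simp add: opts_def)
  qed (use assms(2) in \<open>auto simp: opts_def\<close>)
  from of_nat_mono[OF this, where 'a = real]
  have "real (card (typed_maps u (insert i I) Z K)) \<le> (\<Sum>f\<in>?N. real (card (opts f)))"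
    by (simp only: of_nat_sum)
  also have "\<dots> = (\<Sum>f\<in>?N. if i \<in> Z then real (card K) else real (type_count u K (u i)) - type_count u (I - Z) (u i))"
  proof (intro sum.cong refl)
    fix f assume "f \<in> ?N"
    from card_unused_same_type[OF this assms(2), of "u i"]
    show "real (card (opts f)) = (if i \<in> Z then real (card K) else real (type_count u K (u i)) - type_count u (I - Z) (u i))"
      by (simp add: opts_def)
  qed
  finally show ?thesis by simp
qed

lemma card_typed_maps_le:
  assumes "finite I" "finite K" "finite S" "u ` I \<subseteq> S"
  shows "real (card (typed_maps u I Z K))
     \<le> real (card K) ^ card (I \<inter> Z) * (\<Prod>s\<in>S. ffact (type_count u K s) (type_count u (I - Z) s))"
  using assms
proof (induction I rule: finite_induct)
  case empty
  then show ?case by (simp add: typed_maps_def)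
next
  case (insert i I)
  let ?bound = "\<lambda>I. real (card K) ^ card (I \<inter> Z) * (\<Prod>s\<in>S. ffact (type_count u K s) (type_count u (I - Z) s))"
  let ?new = "if i \<in> Z then real (card K) else real (type_count u K (u i)) - type_count u (I - Z) (u i)"
  have step: "real (card (typed_maps u (insert i I) Z K)) \<le> real (card (typed_maps u I Z K)) * ?new"
    using insert by (intro card_typed_maps_insert_le)
  show ?case
  proof (cases "typed_maps u I Z K = {}")
    case True
    then have "real (card (typed_maps u (insert i I) Z K)) \<le> 0" using step by simp
    also have "0 \<le> ?bound (insert i I)" by (intro mult_nonneg_nonneg prod_nonneg) auto
    finally show ?thesis .
  next
    case False
    then obtain f where "f \<in> typed_maps u I Z K" by blast
    then have "0 \<le> real (type_count u K (u i)) - type_count u (I - Z) (u i)"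
      using insert.prems(1) by (simp only: card_unused_same_type[symmetric] of_nat_0_le_iff)
    then have "real (card (typed_maps u I Z K)) * ?new \<le> ?bound I * ?new"
      using insert.prems by (intro mult_right_mono insert.IH) auto
    also have "\<dots> = ?bound (insert i I)"
      using insert by (simp add: insert_Diff_if prod_ffact_type_count_insert)
    finally show ?thesis using step by linarith
  qed
qed

lemma ffact_diff_le: "z \<le> q \<Longrightarrow> q \<le> k \<Longrightarrow> ffact k (q - z) \<le> ffact k q / fact z"
proof -
  assume zq: "z \<le> q" "q \<le> k"
  have "ffact k q = ffact k (q - z) * ffact (k - (q - z)) z"
    using ffact_add[of "q - z" k z] zq by simp
  moreover have "fact z \<le> ffact (k - (q - z)) z" using zq by (intro fact_le_ffact) auto
  ultimately show ?thesis by (simp add: mult_left_mono pos_le_divide_eq)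
qed

lemma sum_power_fact_le_exp:
  assumes "0 \<le> y"
  shows "(\<Sum>z\<le>q. y ^ z / fact z) \<le> exp (y::real)"
proof -
  have "sum (\<lambda>n. y ^ n /\<^sub>R fact n) {..q} \<le> (\<Sum>n. y ^ n /\<^sub>R fact n)"
    by (rule sum_le_suminf[OF summable_exp_generic]) (use assms in auto)
  then show ?thesis by (simp add: exp_def divide_inverse mult.commute)
qed

lemma power_le_exp_fact:
  assumes "0 \<le> y"
  shows "y ^ z \<le> exp (y::real) * fact z"
proof -
  have "y ^ z / fact z \<le> (\<Sum>z\<le>z. y ^ z / fact z)"
    using assms by (intro member_le_sum[of z "{..z}" "\<lambda>z. y ^ z / fact z"]) auto
  also have "\<dots> \<le> exp y" by (rule sum_power_fact_le_exp[OF assms])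
  finally show ?thesis by (simp add: pos_divide_le_eq)
qed

lemma sum_choose_power_fact_le_exp:
  fixes y :: real and n N :: nat
  assumes "n \<le> N" "0 \<le> y"
  shows "(\<Sum>z\<le>n. real (n choose z) * (y ^ z / fact z)) \<le> exp (2 * sqrt (N * y))"
proof -
  define v where "v = sqrt (N * y)"
  have v: "0 \<le> v" "v ^ 2 = N * y" using assms by (auto simp: v_def)
  have "(\<Sum>z\<le>n. real (n choose z) * (y ^ z / fact z)) \<le> (\<Sum>z\<le>n. (v ^ z / fact z)\<^sup>2)"
  proof (intro sum_mono)
    fix z
    have "real (n choose z) \<le> real N ^ z / fact z"
      using binomial_le_power_div_fact[of n z] power_mono[of "real n" "real N" z] assms(1)
      by (meson divide_right_mono fact_ge_zero of_nat_0_le_iff of_nat_le_iff order_trans)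
    then have "real (n choose z) * (y ^ z / fact z) \<le> (real N ^ z / fact z) * (y ^ z / fact z)"
      using assms by (intro mult_right_mono) auto
    also have "\<dots> = (v ^ 2) ^ z / (fact z)\<^sup>2" unfolding v by (simp add: power_mult_distrib power2_eq_square)
    also have "\<dots> = (v ^ z / fact z)\<^sup>2" by (simp add: power_divide power_mult[symmetric] mult.commute)
    finally show "real (n choose z) * (y ^ z / fact z) \<le> (v ^ z / fact z)\<^sup>2" .
  qed
  also have "\<dots> = (L2_set (\<lambda>z. v ^ z / fact z) {..n})\<^sup>2" by (simp add: L2_set_def sum_nonneg)
  also have "\<dots> \<le> (\<Sum>z\<le>n. v ^ z / fact z)\<^sup>2" using v by (intro power_mono L2_set_le_sum) auto
  also have "\<dots> \<le> (exp v)\<^sup>2" using v by (intro power_mono sum_power_fact_le_exp sum_nonneg) auto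
  also have "\<dots> = exp (2 * v)" by (simp add: exp_double)
  finally show ?thesis by (simp add: v_def)
qed

definition matchings :: "nat \<Rightarrow> (nat \<times> nat) set set" where
  "matchings k = {m. m \<subseteq> {..<k} \<times> {..<k} \<and> inj_on fst m \<and> inj_on snd m}"

lemma finite_matchings [simp]: "finite (matchings k)"
  by (rule finite_subset[of _ "Pow ({..<k} \<times> {..<k})"]) (auto simp: matchings_def)

lemma finite_matching: "m \<in> matchings k \<Longrightarrow> finite m"
  by (auto simp: matchings_def intro: finite_subset)

lemma matchings_with_domain:
  "{m \<in> matchings k. fst ` m = I} \<subseteq> (\<lambda>f. (\<lambda>i. (i, f i)) ` I) ` {f \<in> I \<rightarrow>\<^sub>E {..<k}. inj_on f I}"
proof
  fix m assume "m \<in> {m \<in> matchings k. fst ` m = I}"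
  then have m: "m \<subseteq> {..<k} \<times> {..<k}" "inj_on fst m" "inj_on snd m" "fst ` m = I" by (auto simp: matchings_def)
  define f where "f = (\<lambda>i\<in>I. SOME j. (i, j) \<in> m)"
  have f: "(i, f i) \<in> m" if "i \<in> I" for i
  proof -
    have "\<exists>j. (i, j) \<in> m" using that m(4) by force
    then have "(i, SOME j. (i, j) \<in> m) \<in> m" by (rule someI_ex)
    then show ?thesis using that by (simp add: f_def)
  qed
  have "inj_on f I"
  proof (rule inj_onI)
    fix i i' assume "i \<in> I" "i' \<in> I" "f i = f i'"
    then show "i = i'" using inj_onD[OF m(3) _ f f] by force
  qed
  moreover have "f \<in> I \<rightarrow>\<^sub>E {..<k}" using f m(1) by (auto simp: f_def)
  moreover have "m = (\<lambda>i. (i, f i)) ` I"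
  proof (intro equalityI subsetI)
    fix p assume p: "p \<in> m"
    then have "fst p \<in> I" using m(4) by blast
    then have "p = (fst p, f (fst p))" using inj_onD[OF m(2) _ p f[of "fst p"]] by simp
    then show "p \<in> (\<lambda>i. (i, f i)) ` I" using \<open>fst p \<in> I\<close> by blast
  qed (use f in auto)
  ultimately show "m \<in> (\<lambda>f. (\<lambda>i. (i, f i)) ` I) ` {f \<in> I \<rightarrow>\<^sub>E {..<k}. inj_on f I}" by blast
qed

lemma sum_matchings_le_sum_typed_maps:
  fixes u :: "nat \<Rightarrow> 's" and \<epsilon> :: real
  assumes I: "I \<subseteq> {..<k}" and \<epsilon>: "0 \<le> \<epsilon>"
  shows "(\<Sum>m\<in>{m \<in> matchings k. fst ` m = I}. \<Prod>p\<in>m. of_bool (u (fst p) = u (snd p)) + \<epsilon>)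
     \<le> (\<Sum>Z\<in>Pow I. \<epsilon> ^ card Z * real (card (typed_maps u I Z {..<k})))"
proof -
  let ?F = "\<lambda>m. \<Prod>p\<in>m. of_bool (u (fst p) = u (snd p)) + \<epsilon>"
  let ?graph = "\<lambda>f. (\<lambda>i. (i, f i)) ` I"
  define A where "A = {f \<in> I \<rightarrow>\<^sub>E {..<k}. inj_on f I}"
  have finI: "finite I" using I finite_subset by blast
  have finA: "finite A"
    by (rule finite_subset[of _ "I \<rightarrow>\<^sub>E {..<k}"]) (use finI in \<open>auto simp: A_def intro: finite_PiE\<close>)
  have F_nonneg: "0 \<le> ?F m" for m using \<epsilon> by (intro prod_nonneg) auto
  have F_graph: "?F (?graph f) = (\<Sum>Z\<in>Pow I. \<epsilon> ^ card Z * of_bool (\<forall>i\<in>I - Z. u (f i) = u i))" for f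
  proof -
    have "?F (?graph f) = (\<Prod>i\<in>I. \<epsilon> + of_bool (u (f i) = u i))"
      by (subst prod.reindex) (auto simp: inj_on_def add.commute eq_commute)
    also have "\<dots> = (\<Sum>Z\<in>Pow I. (\<Prod>i\<in>Z. \<epsilon>) * (\<Prod>i\<in>I - Z. of_bool (u (f i) = u i)))"
      by (rule prod_add[OF finI])
    finally show ?thesis using finI by (simp add: prod_of_bool)
  qed
  have "(\<Sum>m\<in>{m \<in> matchings k. fst ` m = I}. ?F m) \<le> (\<Sum>m\<in>?graph ` A. ?F m)"
    using matchings_with_domain[of k I] finA F_nonneg unfolding A_def[symmetric] by (intro sum_mono2) auto
  also have "\<dots> \<le> (\<Sum>f\<in>A. ?F (?graph f))"
    using sum_image_le[OF finA, of ?F ?graph] F_nonneg by (simp add: o_def)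
  also have "\<dots> = (\<Sum>Z\<in>Pow I. \<epsilon> ^ card Z * (\<Sum>f\<in>A. of_bool (\<forall>i\<in>I - Z. u (f i) = u i)))"
    unfolding F_graph sum_distrib_left by (rule sum.swap)
  also have "\<dots> \<le> (\<Sum>Z\<in>Pow I. \<epsilon> ^ card Z * real (card (typed_maps u I Z {..<k})))"
  proof (intro sum_mono mult_left_mono)
    fix Z
    have "A \<inter> {f. \<forall>i\<in>I - Z. u (f i) = u i} \<subseteq> typed_maps u I Z {..<k}"
      by (auto simp: A_def typed_maps_def intro: inj_on_subset)
    then show "(\<Sum>f\<in>A. of_bool (\<forall>i\<in>I - Z. u (f i) = u i)) \<le> real (card (typed_maps u I Z {..<k}))"
      using finA finI by (simp add: card_mono finite_typed_maps)
  qed (use \<epsilon> in simp)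
  finally show ?thesis .
qed

definition type_arrangements :: "nat \<Rightarrow> (nat \<Rightarrow> 's) \<Rightarrow> nat set \<Rightarrow> real" where
  "type_arrangements k u I = (\<Prod>s\<in>u ` {..<k}. ffact (type_count u {..<k} s) (type_count u I s))"

definition type_choices :: "nat \<Rightarrow> (nat \<Rightarrow> 's) \<Rightarrow> nat set \<Rightarrow> real" where
  "type_choices k u I = (\<Prod>s\<in>u ` {..<k}. real (type_count u {..<k} s choose type_count u I s))"

lemma type_arrangements_nonneg: "0 \<le> type_arrangements k u I"
  unfolding type_arrangements_def by (intro prod_nonneg) simp

lemma type_choices_pos:
  assumes "I \<subseteq> {..<k}"
  shows "0 < type_choices k u I"
  unfolding type_choices_def using assms by (intro prod_pos) (simp add: type_count_mono)

lemma typed_maps_term_le: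
  fixes \<epsilon> :: real
  assumes "Z \<subseteq> I" and I: "I \<subseteq> {..<k}" and \<epsilon>: "0 \<le> \<epsilon>"
  shows "\<epsilon> ^ card Z * real (card (typed_maps u I Z {..<k}))
     \<le> type_arrangements k u I * (\<Prod>s\<in>u ` {..<k}. (\<epsilon> * k) ^ type_count u Z s / fact (type_count u Z s))"
proof -
  let ?S = "u ` {..<k}" and ?\<kappa> = "type_count u {..<k}"
  have "finite I" using I finite_subset by blast
  then have fin: "finite I" "finite Z" using finite_subset[OF assms(1)] by auto
  have count_diff: "type_count u (I - Z) s = type_count u I s - type_count u Z s" for s
  proof -
    have "{i \<in> I - Z. u i = s} = {i \<in> I. u i = s} - {i \<in> Z. u i = s}" using assms(1) by auto
    then show ?thesis unfolding type_count_def using assms(1) fin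
      by (simp add: card_Diff_subset subset_iff)
  qed
  have "\<epsilon> ^ card Z * real (card (typed_maps u I Z {..<k}))
      \<le> \<epsilon> ^ card Z * (real (card {..<k}) ^ card (I \<inter> Z) * (\<Prod>s\<in>?S. ffact (?\<kappa> s) (type_count u (I - Z) s)))"
    using \<epsilon> I fin by (intro mult_left_mono card_typed_maps_le) auto
  also have "\<dots> = (\<epsilon> * k) ^ (\<Sum>s\<in>?S. type_count u Z s) * (\<Prod>s\<in>?S. ffact (?\<kappa> s) (type_count u (I - Z) s))"
    using assms fin by (subst sum_type_count) (auto simp: Int_absorb1 power_mult_distrib)
  also have "\<dots> \<le> (\<epsilon> * k) ^ (\<Sum>s\<in>?S. type_count u Z s) * (\<Prod>s\<in>?S. ffact (?\<kappa> s) (type_count u I s) / fact (type_count u Z s))"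
    unfolding count_diff using assms(1) I \<epsilon> fin
    by (intro mult_left_mono prod_mono conjI ffact_nonneg ffact_diff_le type_count_mono) auto
  also have "\<dots> = type_arrangements k u I * (\<Prod>s\<in>?S. (\<epsilon> * k) ^ type_count u Z s / fact (type_count u Z s))"
    by (simp add: type_arrangements_def power_sum prod_dividef)
  finally show ?thesis .
qed

lemma sum_matchings_with_domain_le:
  fixes u :: "nat \<Rightarrow> 's" and \<epsilon> :: real
  assumes I: "I \<subseteq> {..<k}" and \<epsilon>: "0 \<le> \<epsilon>"
  shows "(\<Sum>m\<in>{m \<in> matchings k. fst ` m = I}. \<Prod>p\<in>m. of_bool (u (fst p) = u (snd p)) + \<epsilon>)
     \<le> type_arrangements k u I * exp (2 * real k * sqrt \<epsilon>) ^ card (u ` {..<k})"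
proof -
  let ?S = "u ` {..<k}" and ?g = "\<lambda>z. (\<epsilon> * k) ^ z / fact z"
  have finI: "finite I" using I finite_subset by blast
  have "(\<Sum>m\<in>{m \<in> matchings k. fst ` m = I}. \<Prod>p\<in>m. of_bool (u (fst p) = u (snd p)) + \<epsilon>)
      \<le> (\<Sum>Z\<in>Pow I. \<epsilon> ^ card Z * real (card (typed_maps u I Z {..<k})))"
    by (rule sum_matchings_le_sum_typed_maps[OF assms])
  also have "\<dots> \<le> (\<Sum>Z\<in>Pow I. type_arrangements k u I * (\<Prod>s\<in>?S. ?g (type_count u Z s)))"
    using I \<epsilon> by (intro sum_mono typed_maps_term_le) auto
  also have "\<dots> = type_arrangements k u I * (\<Prod>s\<in>?S. \<Sum>t\<le>type_count u I s. real (type_count u I s choose t) * ?g t)"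
    unfolding sum_distrib_left[symmetric] using I finI by (subst sum_Pow_prod_type_count) auto
  also have "\<dots> \<le> type_arrangements k u I * (\<Prod>s\<in>?S. exp (2 * real k * sqrt \<epsilon>))"
  proof (intro mult_left_mono prod_mono conjI sum_nonneg type_arrangements_nonneg)
    fix s
    have "type_count u I s \<le> k"
      using type_count_mono[OF _ I, of u s] type_count_le_card[of "{..<k}" u s] by simp
    then have "(\<Sum>t\<le>type_count u I s. real (type_count u I s choose t) * ?g t) \<le> exp (2 * sqrt (real k * (\<epsilon> * k)))"
      using \<epsilon> by (intro sum_choose_power_fact_le_exp) auto
    then show "(\<Sum>t\<le>type_count u I s. real (type_count u I s choose t) * ?g t) \<le> exp (2 * real k * sqrt \<epsilon>)"
      by (simp add: real_sqrt_mult mult_ac)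
  qed (use \<epsilon> in auto)
  finally show ?thesis by simp
qed

lemma sum_type_arrangements_le:
  fixes u :: "nat \<Rightarrow> 's"
  assumes "\<And>I. I \<subseteq> {..<k} \<Longrightarrow> type_choices k u I * type_arrangements k u I * w I \<le> B" and "0 \<le> B"
  shows "(\<Sum>I\<in>Pow {..<k}. w I * type_arrangements k u I) \<le> B * (real k + 1) ^ card (u ` {..<k})"
proof -
  let ?S = "u ` {..<k}" and ?\<kappa> = "type_count u {..<k}"
  have "(\<Sum>I\<in>Pow {..<k}. w I * type_arrangements k u I) \<le> (\<Sum>I\<in>Pow {..<k}. B * (1 / type_choices k u I))"
  proof (intro sum_mono)
    fix I assume "I \<in> Pow {..<k}"
    then show "w I * type_arrangements k u I \<le> B * (1 / type_choices k u I)"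
      using assms(1)[of I] type_choices_pos[of I k u] by (simp add: pos_le_divide_eq mult_ac)
  qed
  also have "\<dots> = B * (\<Sum>I\<in>Pow {..<k}. \<Prod>s\<in>?S. 1 / real (?\<kappa> s choose type_count u I s))"
    by (simp add: sum_distrib_left type_choices_def prod_dividef)
  also have "\<dots> = B * (\<Prod>s\<in>?S. \<Sum>t\<le>?\<kappa> s. real (?\<kappa> s choose t) * (1 / real (?\<kappa> s choose t)))"
    by (subst sum_Pow_prod_type_count) auto
  also have "\<dots> \<le> B * (\<Prod>s\<in>?S. real k + 1)"
  proof (intro mult_left_mono prod_mono conjI sum_nonneg)
    fix s
    have "(\<Sum>t\<le>?\<kappa> s. real (?\<kappa> s choose t) * (1 / real (?\<kappa> s choose t))) = real (?\<kappa> s) + 1" by simp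
    also have "\<dots> \<le> real k + 1"
      using type_count_le_card[of "{..<k}" u s] by simp
    finally show "(\<Sum>t\<le>?\<kappa> s. real (?\<kappa> s choose t) * (1 / real (?\<kappa> s choose t))) \<le> real k + 1" .
  qed (use assms(2) in auto)
  finally show ?thesis by simp
qed

lemma sum_matchings_snd:
  assumes "\<And>i j. e i j = (e j i :: real)"
  shows "(\<Sum>m\<in>matchings k. (\<Prod>p\<in>m. e (fst p) (snd p)) * w (snd ` m))
       = (\<Sum>m\<in>matchings k. (\<Prod>p\<in>m. e (fst p) (snd p)) * w (fst ` m))"
proof (rule sum.reindex_bij_witness[of _ "(`) prod.swap" "(`) prod.swap"])
  fix m assume "m \<in> matchings k"
  then show "prod.swap ` m \<in> matchings k" by (auto simp: matchings_def inj_on_def)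
  have "(\<Prod>p\<in>prod.swap ` m. e (fst p) (snd p)) = (\<Prod>p\<in>m. e (fst p) (snd p))"
    using assms by (subst prod.reindex) auto
  then show "(\<Prod>p\<in>prod.swap ` m. e (fst p) (snd p)) * w (fst ` prod.swap ` m) = (\<Prod>p\<in>m. e (fst p) (snd p)) * w (snd ` m)"
    by (simp add: image_image)
qed (auto simp: image_image matchings_def inj_on_def)

section \<open>The second moment of colorings with a given profile\<close>

definition overlap_ratio :: "nat \<Rightarrow> nat \<Rightarrow> nat \<Rightarrow> nat \<Rightarrow> real" where
  "overlap_ratio n u v t = ffact v t * 2 ^ (t choose 2)
     * sqrt (real n ^ (u - t) * real n ^ (v - t) / (indep_weight u * indep_weight v))"

lemma overlap_ratio_nonneg: "0 \<le> overlap_ratio n u v t"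
  by (simp add: overlap_ratio_def less_imp_le)

text \<open>The reciprocal of the expected number of families of disjoint independent sets
  with sizes \<open>u i\<close> for \<open>i \<in> I\<close>.\<close>

definition placement_cost :: "nat \<Rightarrow> (nat \<Rightarrow> nat) \<Rightarrow> nat set \<Rightarrow> real" where
  "placement_cost n u I = (\<Prod>i\<in>I. indep_weight (u i)) / ffact n (\<Sum>i\<in>I. u i)"

lemma placement_cost_nonneg: "0 \<le> placement_cost n u I"
  unfolding placement_cost_def by (intro divide_nonneg_nonneg prod_nonneg) (auto simp: less_imp_le)

lemma inverse_ffact_le_sqrt:
  assumes "T \<le> R" "R \<le> n" "T \<le> C" "C \<le> n"
  shows "1 / ffact n T \<le> sqrt (real n ^ (R - T) * real n ^ (C - T) / (ffact n R * ffact n C))"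
proof (rule real_le_rsqrt)
  have split: "ffact n R \<le> ffact n T * real n ^ (R - T)" if "T \<le> R" "R \<le> n" for R
  proof -
    have "ffact n R = ffact n T * ffact (n - T) (R - T)" using ffact_add[of T n "R - T"] that by simp
    also have "ffact (n - T) (R - T) \<le> real n ^ (R - T)"
      using ffact_le_power[of "n - T" "R - T"] power_mono[of "real (n - T)" "real n" "R - T"] by simp
    finally show ?thesis by (simp add: mult_left_mono)
  qed
  have "ffact n R * ffact n C \<le> (ffact n T * real n ^ (R - T)) * (ffact n T * real n ^ (C - T))"
    using split assms by (intro mult_mono) auto
  moreover have "0 < ffact n T" "0 < ffact n R" "0 < ffact n C" using assms by (auto intro!: ffact_pos)
  ultimately show "(1 / ffact n T)\<^sup>2 \<le> real n ^ (R - T) * real n ^ (C - T) / (ffact n R * ffact n C)"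
    by (simp add: field_simps power2_eq_square)
qed

lemma prod_overlap_ratio:
  assumes "finite m" "\<And>p. p \<in> m \<Longrightarrow> t p \<le> u (fst p) \<and> t p \<le> u (snd p)"
  shows "(\<Prod>p\<in>m. overlap_ratio n (u (fst p)) (u (snd p)) (t p))
     = (\<Prod>p\<in>m. ffact (u (snd p)) (t p) * 2 ^ (t p choose 2))
       * sqrt (real n ^ ((\<Sum>p\<in>m. u (fst p)) - (\<Sum>p\<in>m. t p)) * real n ^ ((\<Sum>p\<in>m. u (snd p)) - (\<Sum>p\<in>m. t p))
           / (\<Prod>p\<in>m. indep_weight (u (fst p)) * indep_weight (u (snd p))))"
proof -
  have sqrt_prod: "(\<Prod>p\<in>m. sqrt (f p)) = sqrt (\<Prod>p\<in>m. f p)" for f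
    using assms(1) by (induction m rule: finite_induct) (auto simp: real_sqrt_mult)
  have "(\<Sum>p\<in>m. u (fst p)) - (\<Sum>p\<in>m. t p) = (\<Sum>p\<in>m. u (fst p) - t p)"
    "(\<Sum>p\<in>m. u (snd p)) - (\<Sum>p\<in>m. t p) = (\<Sum>p\<in>m. u (snd p) - t p)"
    using assms(2) by (simp_all add: sum_subtractf_nat)
  then show ?thesis
    unfolding overlap_ratio_def prod.distrib sqrt_prod by (simp add: prod_dividef prod.distrib power_sum)
qed

text \<open>Compare an overlap pattern with the two patterns in which the row classes, respectively
  the column classes, are reproduced completely.\<close>

lemma matching_term_le:
  assumes m: "m \<in> matchings k" and sizes: "(\<Sum>j<k. u j) \<le> n" and t: "\<And>p. p \<in> m \<Longrightarrow> t p \<le> u (fst p)"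
  shows "(\<Prod>p\<in>m. ffact (u (snd p)) (t p) * 2 ^ (t p choose 2)) / ffact n (\<Sum>p\<in>m. t p)
     \<le> (\<Prod>p\<in>m. overlap_ratio n (u (fst p)) (u (snd p)) (t p))
       * ((placement_cost n u (fst ` m) + placement_cost n u (snd ` m)) / 2)"
    (is "?weight / _ \<le> ?ratio * ?mean")
proof (cases "\<forall>p\<in>m. t p \<le> u (snd p)")
  case False
  then obtain p where "p \<in> m" "u (snd p) < t p" by (auto simp: not_le)
  then have "?weight = 0"
    using finite_matching[OF m] by (intro prod_zero) (auto simp: ffact_eq_0 intro!: bexI[of _ p])
  moreover have "0 \<le> ?ratio * ?mean"
    using placement_cost_nonneg[of n u]
    by (intro mult_nonneg_nonneg prod_nonneg overlap_ratio_nonneg) (simp add: add_nonneg_nonneg)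
  ultimately show ?thesis by simp
next
  case True
  have inj: "inj_on fst m" "inj_on snd m" and sub: "fst ` m \<subseteq> {..<k}" "snd ` m \<subseteq> {..<k}"
    using m by (auto simp: matchings_def)
  let ?R = "\<Sum>i\<in>fst ` m. u i" and ?C = "\<Sum>i\<in>snd ` m. u i" and ?T = "\<Sum>p\<in>m. t p"
  have RC: "?R = (\<Sum>p\<in>m. u (fst p))" "?C = (\<Sum>p\<in>m. u (snd p))" using inj by (simp_all add: sum.reindex)
  have "?T \<le> ?R" "?T \<le> ?C" unfolding RC using t True by (auto intro!: sum_mono)
  moreover have "?R \<le> n" "?C \<le> n"
    using sum_mono2[OF _ sub(1), of u] sum_mono2[OF _ sub(2), of u] sizes by auto
  ultimately have le_sqrt: "1 / ffact n ?T \<le> sqrt (real n ^ (?R - ?T) * real n ^ (?C - ?T) / (ffact n ?R * ffact n ?C))"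
    by (intro inverse_ffact_le_sqrt)
  let ?D = "\<Prod>p\<in>m. indep_weight (u (fst p)) * indep_weight (u (snd p))"
  have D: "0 < ?D" by (intro prod_pos) auto
  have "?weight * (1 / ffact n ?T) \<le> ?weight * sqrt (real n ^ (?R - ?T) * real n ^ (?C - ?T) / (ffact n ?R * ffact n ?C))"
    using le_sqrt by (intro mult_left_mono prod_nonneg) auto
  also have "\<dots> = ?weight * sqrt (real n ^ (?R - ?T) * real n ^ (?C - ?T) / ?D) * sqrt (?D / (ffact n ?R * ffact n ?C))"
    using D by (simp add: real_sqrt_mult[symmetric])
  also have "?weight * sqrt (real n ^ (?R - ?T) * real n ^ (?C - ?T) / ?D) = ?ratio"
    using prod_overlap_ratio[OF finite_matching[OF m], of t u n] t True unfolding RC by simp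
  also have "?D / (ffact n ?R * ffact n ?C) = placement_cost n u (fst ` m) * placement_cost n u (snd ` m)"
    unfolding placement_cost_def using inj by (simp add: prod.reindex prod.distrib)
  also have "?ratio * sqrt (placement_cost n u (fst ` m) * placement_cost n u (snd ` m)) \<le> ?ratio * ?mean"
    by (intro mult_left_mono arith_geo_mean_sqrt prod_nonneg overlap_ratio_nonneg placement_cost_nonneg)
  finally show ?thesis by simp
qed

definition big_pairs :: "nat \<Rightarrow> nat \<Rightarrow> nat \<Rightarrow> (nat \<Rightarrow> nat) \<Rightarrow> (nat \<Rightarrow> nat) \<Rightarrow> (nat \<times> nat) set" where
  "big_pairs n k L c c' = {p \<in> {..<k} \<times> {..<k}. L \<le> card (class_overlap n c c' p)}"

lemma big_pairs_in_same_class: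
  assumes "p \<in> big_pairs n k L c c'" "q \<in> big_pairs n k L c c'"
    and "class_overlap n c c' p \<union> class_overlap n c c' q \<subseteq> A" "finite A" "card A < 2 * L"
  shows "p = q"
proof (rule ccontr)
  assume "p \<noteq> q"
  then have "card (class_overlap n c c' p) + card (class_overlap n c c' q)
      = card (class_overlap n c c' p \<union> class_overlap n c c' q)"
    using class_overlap_disjoint by (simp add: card_Un_disjoint)
  also have "\<dots> \<le> card A" using assms(3,4) by (intro card_mono)
  finally show False using assms(1,2,5) by (simp add: big_pairs_def)
qed

lemma big_pairs_matching:
  assumes c: "c \<in> sized_colorings n k u" "c' \<in> sized_colorings n k u" and u: "\<And>i. i < k \<Longrightarrow> u i < 2 * L"
  shows "big_pairs n k L c c' \<in> matchings k"
proof -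
  have class_small: "card (color_class n b i) < 2 * L" if "b \<in> sized_colorings n k u" "i < k" for b i
    using card_color_class[OF that] u[OF that(2)] by simp
  have "p = q"
    if "p \<in> big_pairs n k L c c'" "q \<in> big_pairs n k L c c'" "fst p = fst q \<or> snd p = snd q" for p q
    using that(3)
  proof
    assume "fst p = fst q"
    then have "class_overlap n c c' p \<union> class_overlap n c c' q \<subseteq> color_class n c (fst p)"
      by (auto simp: class_overlap_def)
    then show ?thesis
      using that(1)
      by (intro big_pairs_in_same_class[OF that(1,2) _ finite_color_class class_small[OF c(1)]]) (auto simp: big_pairs_def)
  next
    assume "snd p = snd q"
    then have "class_overlap n c c' p \<union> class_overlap n c c' q \<subseteq> color_class n c' (snd p)"
      by (auto simp: class_overlap_def)
    then show ?thesis
      using that(1)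
      by (intro big_pairs_in_same_class[OF that(1,2) _ finite_color_class class_small[OF c(2)]]) (auto simp: big_pairs_def)
  qed
  then have "inj_on fst (big_pairs n k L c c')" "inj_on snd (big_pairs n k L c c')"
    unfolding inj_on_def by blast+
  then show ?thesis by (auto simp: matchings_def big_pairs_def)
qed

definition big_overlap_colorings ::
  "nat \<Rightarrow> nat \<Rightarrow> (nat \<Rightarrow> nat) \<Rightarrow> nat \<Rightarrow> (nat \<Rightarrow> nat) \<Rightarrow> (nat \<times> nat) set \<Rightarrow> (nat \<times> nat \<Rightarrow> nat set) \<Rightarrow> (nat \<Rightarrow> nat) set" where
  "big_overlap_colorings n k u L c m h =
     {c' \<in> sized_colorings n k u. big_pairs n k L c c' = m \<and> (\<forall>p\<in>m. class_overlap n c c' p = h p)}"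

lemma big_overlap_colorings_color:
  assumes "c' \<in> big_overlap_colorings n k u L c m h" "p \<in> m" "v \<in> h p"
  shows "c v = fst p" "c' v = snd p" "v < n"
proof -
  have "v \<in> class_overlap n c c' p" using assms unfolding big_overlap_colorings_def by blast
  then show "c v = fst p" "c' v = snd p" "v < n" by (auto simp: class_overlap_def color_class_def)
qed

lemma card_extensions_big_overlaps_le:
  assumes m: "m \<in> matchings k" and c\<^sub>1: "c\<^sub>1 \<in> big_overlap_colorings n k u L c m h"
  shows "card (extensions n k u (\<Union>p\<in>m. h p) c\<^sub>1)
     \<le> card (sized_colorings n k u) * (\<Prod>p\<in>m. ffact (u (snd p)) (card (h p))) / ffact n (\<Sum>p\<in>m. card (h p))"
proof -
  note color = big_overlap_colorings_color[OF c\<^sub>1]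
  have disjoint: "disjoint_family_on h m"
    using c\<^sub>1
    by (intro disjoint_family_on_class_overlap[of _ _ n c c\<^sub>1]) (simp add: big_overlap_colorings_def)
  have sub: "h p \<subseteq> {..<n}" if "p \<in> m" for p using color(3)[OF that] by blast
  have fin: "finite (h p)" if "p \<in> m" for p using sub[OF that] finite_subset by blast
  have "snd p < k" if "p \<in> m" for p using that m by (auto simp: matchings_def)
  then have "card (extensions n k u ({} \<union> (\<Union>p\<in>m. h p)) c\<^sub>1) * ffact (n - card ({} :: nat set)) (\<Sum>p\<in>m. card (h p))
      \<le> card (extensions n k u {} c\<^sub>1) * (\<Prod>p\<in>m. ffact (u (snd p)) (card (h p)))"
    using finite_matching[OF m] sub disjoint color(2) by (intro card_extensions_UN_le) auto
  moreover have "(\<Sum>p\<in>m. card (h p)) \<le> n"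
    using card_UN_disjoint'[OF disjoint fin finite_matching[OF m]] card_mono[of "{..<n}" "\<Union>p\<in>m. h p"] sub
    by force
  then have "0 < ffact n (\<Sum>p\<in>m. card (h p))" by (rule ffact_pos)
  ultimately show ?thesis by (simp add: pos_le_divide_eq)
qed

lemma sum_small_overlaps_off_big_le:
  fixes M \<beta> :: real
  assumes c: "c \<in> sized_colorings n k u" and L: "0 < L" and M: "0 < M"
    and \<beta>: "0 \<le> \<beta>" "\<And>i j. i < k \<Longrightarrow> j < k \<Longrightarrow> pair_weight (u i) (u j) L (1 / M) \<le> \<beta>"
    and c\<^sub>1: "c\<^sub>1 \<in> big_overlap_colorings n k u L c m h"
  shows "(\<Sum>c'\<in>big_overlap_colorings n k u L c m h. \<Prod>p\<in>{..<k} \<times> {..<k} - m. 2 ^ (card (class_overlap n c c' p) choose 2))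
     \<le> card (extensions n k u (\<Union>p\<in>m. h p) c\<^sub>1) * exp (M + real k ^ 2 * \<beta>)"
proof -
  let ?C = "big_overlap_colorings n k u L c m h" and ?P = "{..<k} \<times> {..<k} - m" and ?D = "\<Union>p\<in>m. h p"
  note color = big_overlap_colorings_color
  have D: "?D \<subseteq> {..<n}" using color(3)[OF c\<^sub>1] by blast
  have "(\<Sum>c'\<in>?C. \<Prod>p\<in>?P. 2 ^ (card (class_overlap n c c' p) choose 2))
     \<le> card (extensions n k u ?D c\<^sub>1) * exp M * exp (\<Sum>p\<in>?P. pair_weight (u (fst p)) (u (snd p)) L (1 / M))"
  proof (rule sum_small_overlaps_le[OF c D _ L])
    show "?C \<subseteq> extensions n k u ?D c\<^sub>1"
    proof
      fix c' assume c': "c' \<in> ?C"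
      then have "c' v = c\<^sub>1 v" if "v \<in> ?D" for v using that color(2)[OF c'] color(2)[OF c\<^sub>1] by fastforce
      then show "c' \<in> extensions n k u ?D c\<^sub>1"
        using c' unfolding extensions_def big_overlap_colorings_def by blast
    qed
  next
    fix c' p assume c': "c' \<in> ?C" and p: "p \<in> ?P"
    show "card (class_overlap n c c' p) < L"
      using c' p by (auto simp: big_overlap_colorings_def big_pairs_def not_le)
    have "p = q" if "v \<in> class_overlap n c c' p" "q \<in> m" "v \<in> h q" for v q
      using that(1) color(1,2)[OF c' that(2,3)] by (simp add: class_overlap_def color_class_def prod_eq_iff)
    then show "class_overlap n c c' p \<inter> ?D = {}" using p by auto
  next
    fix t assume "t \<le> n - card ?D"
    then have "M ^ t \<le> exp M * ffact (n - card ?D) t"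
      using power_le_exp_fact[of M t] M fact_le_ffact[of t "n - card ?D"]
      by (meson exp_ge_zero less_imp_le mult_left_mono order_trans)
    then show "1 \<le> exp M * (1 / M) ^ t * ffact (n - card ?D) t"
      using M by (simp add: power_divide field_simps)
  qed (use M in auto)
  also have "(\<Sum>p\<in>?P. pair_weight (u (fst p)) (u (snd p)) L (1 / M)) \<le> real k ^ 2 * \<beta>"
  proof -
    have "(\<Sum>p\<in>?P. pair_weight (u (fst p)) (u (snd p)) L (1 / M)) \<le> real (card ?P) * \<beta>"
      using \<beta> by (intro sum_bounded_above) auto
    also have "card ?P \<le> k ^ 2"
      using card_mono[of "{..<k} \<times> {..<k}" ?P] by (simp add: power2_eq_square)
    then have "real (card ?P) * \<beta> \<le> real k ^ 2 * \<beta>"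
      using \<beta>(1) by (intro mult_right_mono) (auto simp flip: of_nat_power)
    finally show ?thesis .
  qed
  finally show ?thesis by (simp add: exp_add mult_left_mono mult.assoc)
qed

lemma sum_overlap_weight_big_overlaps_le:
  fixes M \<beta> :: real
  assumes c: "c \<in> sized_colorings n k u" and L: "0 < L" and M: "0 < M"
    and \<beta>: "0 \<le> \<beta>" "\<And>i j. i < k \<Longrightarrow> j < k \<Longrightarrow> pair_weight (u i) (u j) L (1 / M) \<le> \<beta>"
    and m: "m \<in> matchings k"
  shows "(\<Sum>c'\<in>big_overlap_colorings n k u L c m h. overlap_weight n k c c')
    \<le> card (sized_colorings n k u) * exp (M + real k ^ 2 * \<beta>)
      * ((\<Prod>p\<in>m. ffact (u (snd p)) (card (h p)) * 2 ^ (card (h p) choose 2)) / ffact n (\<Sum>p\<in>m. card (h p)))"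
    (is "sum _ ?C \<le> ?rhs")
proof (cases "?C = {}")
  case True
  have "0 \<le> ?rhs" by (intro mult_nonneg_nonneg divide_nonneg_nonneg prod_nonneg) auto
  then show ?thesis unfolding True by simp
next
  case False
  then obtain c\<^sub>1 where c\<^sub>1: "c\<^sub>1 \<in> ?C" by blast
  let ?P = "{..<k} \<times> {..<k} - m" and ?big = "\<Prod>p\<in>m. (2::real) ^ (card (h p) choose 2)"
  have "overlap_weight n k c c' = ?big * (\<Prod>p\<in>?P. 2 ^ (card (class_overlap n c c' p) choose 2))"
    if "c' \<in> ?C" for c'
  proof -
    have "overlap_weight n k c c' = (\<Prod>p\<in>?P. 2 ^ (card (class_overlap n c c' p) choose 2))
        * (\<Prod>p\<in>m. 2 ^ (card (class_overlap n c c' p) choose 2))"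
      unfolding overlap_weight_def using m by (intro prod.subset_diff) (auto simp: matchings_def)
    then show ?thesis using that by (simp add: big_overlap_colorings_def)
  qed
  then have "(\<Sum>c'\<in>?C. overlap_weight n k c c')
      = ?big * (\<Sum>c'\<in>?C. \<Prod>p\<in>?P. 2 ^ (card (class_overlap n c c' p) choose 2))"
    by (simp add: sum_distrib_left)
  also have "\<dots> \<le> ?big * (card (extensions n k u (\<Union>p\<in>m. h p) c\<^sub>1) * exp (M + real k ^ 2 * \<beta>))"
    by (intro mult_left_mono sum_small_overlaps_off_big_le[OF c L M \<beta> c\<^sub>1] prod_nonneg) auto
  also have "\<dots> \<le> ?big * ((card (sized_colorings n k u) * (\<Prod>p\<in>m. ffact (u (snd p)) (card (h p))) / ffact n (\<Sum>p\<in>m. card (h p)))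
      * exp (M + real k ^ 2 * \<beta>))"
    by (intro mult_left_mono mult_right_mono card_extensions_big_overlaps_le[OF m c\<^sub>1] prod_nonneg) auto
  also have "\<dots> = ?rhs" by (simp add: prod.distrib)
  finally show ?thesis .
qed

lemma sum_overlap_weight_big_overlaps_le_ratio:
  fixes M \<beta> :: real
  assumes sizes: "(\<Sum>j<k. u j) \<le> n" and c: "c \<in> sized_colorings n k u" and L: "0 < L" and M: "0 < M"
    and \<beta>: "0 \<le> \<beta>" "\<And>i j. i < k \<Longrightarrow> j < k \<Longrightarrow> pair_weight (u i) (u j) L (1 / M) \<le> \<beta>"
    and m: "m \<in> matchings k" and h: "\<And>p. p \<in> m \<Longrightarrow> h p \<subseteq> color_class n c (fst p)"
  shows "(\<Sum>c'\<in>big_overlap_colorings n k u L c m h. overlap_weight n k c c')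
    \<le> card (sized_colorings n k u) * exp (M + real k ^ 2 * \<beta>)
      * ((\<Prod>p\<in>m. overlap_ratio n (u (fst p)) (u (snd p)) (card (h p)))
          * ((placement_cost n u (fst ` m) + placement_cost n u (snd ` m)) / 2))"
proof -
  have "card (h p) \<le> u (fst p)" if "p \<in> m" for p
  proof -
    have "fst p < k" using that m by (auto simp: matchings_def)
    then show ?thesis using card_mono[OF finite_color_class h[OF that]] card_color_class[OF c] by simp
  qed
  note term_le = matching_term_le[OF m sizes this]
  have "(\<Sum>c'\<in>big_overlap_colorings n k u L c m h. overlap_weight n k c c')
    \<le> card (sized_colorings n k u) * exp (M + real k ^ 2 * \<beta>)
      * ((\<Prod>p\<in>m. ffact (u (snd p)) (card (h p)) * 2 ^ (card (h p) choose 2)) / ffact n (\<Sum>p\<in>m. card (h p)))"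
    by (rule sum_overlap_weight_big_overlaps_le[OF c L M \<beta> m])
  also have "\<dots> \<le> card (sized_colorings n k u) * exp (M + real k ^ 2 * \<beta>)
      * ((\<Prod>p\<in>m. overlap_ratio n (u (fst p)) (u (snd p)) (card (h p)))
          * ((placement_cost n u (fst ` m) + placement_cost n u (snd ` m)) / 2))"
    by (intro mult_left_mono term_le) auto
  finally show ?thesis .
qed

lemma sum_big_subsets:
  fixes g :: "nat \<Rightarrow> real"
  assumes "finite A"
  shows "(\<Sum>T\<in>{T. T \<subseteq> A \<and> L \<le> card T}. g (card T)) = (\<Sum>t\<in>{L..card A}. real (card A choose t) * g t)"
proof -
  have "{T. T \<subseteq> A \<and> L \<le> card T} = {T. T \<subseteq> A \<and> card T \<in> {L..card A}}"
    using assms by (auto intro: card_mono)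
  then show ?thesis using sum_subsets_by_card[OF assms, of "{L..card A}" g] by simp
qed

lemma sum_overlap_weight_le_sum_matchings:
  fixes M \<beta> :: real
  assumes sizes: "(\<Sum>j<k. u j) \<le> n" and L: "0 < L" and uL: "\<And>i. i < k \<Longrightarrow> u i < 2 * L" and M: "0 < M"
    and \<beta>: "0 \<le> \<beta>" "\<And>i j. i < k \<Longrightarrow> j < k \<Longrightarrow> pair_weight (u i) (u j) L (1 / M) \<le> \<beta>"
    and c: "c \<in> sized_colorings n k u"
  shows "(\<Sum>c'\<in>sized_colorings n k u. overlap_weight n k c c')
     \<le> card (sized_colorings n k u) * exp (M + real k ^ 2 * \<beta>) * (\<Sum>m\<in>matchings k.
         (\<Prod>p\<in>m. \<Sum>t\<in>{L..u (fst p)}. real (u (fst p) choose t) * overlap_ratio n (u (fst p)) (u (snd p)) t)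
         * ((placement_cost n u (fst ` m) + placement_cost n u (snd ` m)) / 2))"
proof -
  let ?C = "sized_colorings n k u" and ?big = "\<lambda>c'. big_pairs n k L c c'"
  let ?N = "card ?C * exp (M + real k ^ 2 * \<beta>)"
  let ?mean = "\<lambda>m. (placement_cost n u (fst ` m) + placement_cost n u (snd ` m)) / 2"
  let ?ratio = "\<lambda>p. overlap_ratio n (u (fst p)) (u (snd p))"
  define F where "F p = {T. T \<subseteq> color_class n c (fst p) \<and> L \<le> card T}" for p :: "nat \<times> nat"
  define \<Phi> where "\<Phi> c' = (?big c', \<lambda>p\<in>?big c'. class_overlap n c c' p)" for c'
  have finF: "finite (F p)" for p
    by (rule finite_subset[of _ "Pow (color_class n c (fst p))"]) (auto simp: F_def)
  have card_fst: "card (color_class n c (fst p)) = u (fst p)" if "m \<in> matchings k" "p \<in> m" for m p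
    using that by (intro card_color_class[OF c]) (auto simp: matchings_def)
  have \<Phi>: "\<Phi> c' \<in> Sigma (matchings k) (\<lambda>m. PiE m F)" if "c' \<in> ?C" for c'
    using big_pairs_matching[OF c that uL] by (auto simp: \<Phi>_def F_def big_pairs_def class_overlap_def)
  have fibre: "(\<Sum>c'\<in>{c' \<in> ?C. \<Phi> c' = (m, h)}. overlap_weight n k c c')
     \<le> ?N * ((\<Prod>p\<in>m. ?ratio p (card (h p))) * ?mean m)" if m: "m \<in> matchings k" and h: "h \<in> PiE m F" for m h
  proof -
    have "(\<Sum>c'\<in>{c' \<in> ?C. \<Phi> c' = (m, h)}. overlap_weight n k c c')
      \<le> (\<Sum>c'\<in>big_overlap_colorings n k u L c m h. overlap_weight n k c c')"
      by (intro sum_mono2) (auto simp: \<Phi>_def big_overlap_colorings_def intro: overlap_weight_nonneg)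
    also have "\<dots> \<le> ?N * ((\<Prod>p\<in>m. ?ratio p (card (h p))) * ?mean m)"
      using PiE_mem[OF h]
      by (intro sum_overlap_weight_big_overlaps_le_ratio[OF sizes c L M \<beta> m]) (auto simp: F_def)
    finally show ?thesis .
  qed
  have "(\<Sum>c'\<in>?C. overlap_weight n k c c')
      = (\<Sum>y\<in>Sigma (matchings k) (\<lambda>m. PiE m F). \<Sum>c'\<in>{c' \<in> ?C. \<Phi> c' = y}. overlap_weight n k c c')"
    using finite_matching finF by (intro sum.group[symmetric] finite_SigmaI finite_PiE image_subsetI \<Phi>) auto
  also have "\<dots> = (\<Sum>m\<in>matchings k. \<Sum>h\<in>PiE m F. \<Sum>c'\<in>{c' \<in> ?C. \<Phi> c' = (m, h)}. overlap_weight n k c c')"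
    using finite_matching finF by (subst sum.Sigma) (auto intro!: finite_PiE sum.cong)
  also have "\<dots> \<le> (\<Sum>m\<in>matchings k. \<Sum>h\<in>PiE m F. ?N * ((\<Prod>p\<in>m. ?ratio p (card (h p))) * ?mean m))"
    by (intro sum_mono fibre)
  also have "\<dots> = ?N * (\<Sum>m\<in>matchings k. (\<Prod>p\<in>m. \<Sum>T\<in>F p. ?ratio p (card T)) * ?mean m)"
    unfolding sum_distrib_left using finite_matching finF
    by (intro sum.cong refl) (simp add: prod_sum_PiE sum_distrib_left[symmetric] sum_distrib_right)
  also have "(\<Sum>m\<in>matchings k. (\<Prod>p\<in>m. \<Sum>T\<in>F p. ?ratio p (card T)) * ?mean m)
      = (\<Sum>m\<in>matchings k. (\<Prod>p\<in>m. \<Sum>t\<in>{L..u (fst p)}. real (u (fst p) choose t) * ?ratio p t) * ?mean m)"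
    using card_fst
    by (intro sum.cong prod.cong arg_cong2[where f = "(*)"] refl) (simp add: F_def sum_big_subsets)
  finally show ?thesis .
qed

theorem colorable_prob_second_moment_profile:
  fixes M \<beta> \<epsilon> B :: real
  assumes sizes: "(\<Sum>j<k. u j) \<le> n" and L: "0 < L" and uL: "\<And>i. i < k \<Longrightarrow> u i < 2 * L" and M: "0 < M"
    and \<beta>: "0 \<le> \<beta>" "\<And>i j. i < k \<Longrightarrow> j < k \<Longrightarrow> pair_weight (u i) (u j) L (1 / M) \<le> \<beta>"
    and \<epsilon>: "0 \<le> \<epsilon>" "\<And>i j. i < k \<Longrightarrow> j < k \<Longrightarrow>
      (\<Sum>t\<in>{L..u i}. real (u i choose t) * overlap_ratio n (u i) (u j) t) \<le> of_bool (u i = u j) + \<epsilon>"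
    and B: "0 \<le> B" "\<And>I. I \<subseteq> {..<k} \<Longrightarrow> type_choices k u I * type_arrangements k u I * placement_cost n u I \<le> B"
  shows "(colorable_prob (n - (\<Sum>j<k. u j)) f)\<^sup>2
     \<le> exp (M + real k ^ 2 * \<beta>) * (exp (2 * real k * sqrt \<epsilon>) * (real k + 1)) ^ card (u ` {..<k}) * B
         * colorable_prob n (f + k)"
proof (rule colorable_prob_second_moment[OF sizes])
  fix c assume c: "c \<in> sized_colorings n k u"
  let ?N = "card (sized_colorings n k u) * exp (M + real k ^ 2 * \<beta>)" and ?types = "card (u ` {..<k})"
  let ?w = "placement_cost n u" and ?e = "\<lambda>i j. of_bool (u i = u j) + \<epsilon>"
  have mean_nonneg: "0 \<le> (?w I + ?w I') / 2" for I I'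
    using placement_cost_nonneg[of n u] by (simp add: add_nonneg_nonneg)
  have ratio_le: "(\<Sum>t\<in>{L..u (fst p)}. real (u (fst p) choose t) * overlap_ratio n (u (fst p)) (u (snd p)) t)
      \<le> ?e (fst p) (snd p)"
    if "m \<in> matchings k" "p \<in> m" for m p
    using that by (intro \<epsilon>(2)) (auto simp: matchings_def)
  have "(\<Sum>c'\<in>sized_colorings n k u. overlap_weight n k c c') \<le> ?N * (\<Sum>m\<in>matchings k.
      (\<Prod>p\<in>m. \<Sum>t\<in>{L..u (fst p)}. real (u (fst p) choose t) * overlap_ratio n (u (fst p)) (u (snd p)) t)
      * ((?w (fst ` m) + ?w (snd ` m)) / 2))"
    by (rule sum_overlap_weight_le_sum_matchings[OF sizes L uL M \<beta> c])
  also have "\<dots> \<le> ?N * (\<Sum>m\<in>matchings k. (\<Prod>p\<in>m. ?e (fst p) (snd p)) * ((?w (fst ` m) + ?w (snd ` m)) / 2))"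
    by (intro mult_left_mono sum_mono mult_right_mono prod_mono conjI ratio_le mean_nonneg sum_nonneg mult_nonneg_nonneg
        overlap_ratio_nonneg) auto
  also have "\<dots> = ?N * (\<Sum>m\<in>matchings k. (\<Prod>p\<in>m. ?e (fst p) (snd p)) * ?w (fst ` m))"
    using sum_matchings_snd[of ?e ?w k]
    by (simp add: distrib_left sum.distrib sum_divide_distrib[symmetric] add_divide_distrib eq_commute)
  also have "(\<Sum>m\<in>matchings k. (\<Prod>p\<in>m. ?e (fst p) (snd p)) * ?w (fst ` m))
      = (\<Sum>I\<in>Pow {..<k}. \<Sum>m\<in>{m \<in> matchings k. fst ` m = I}. (\<Prod>p\<in>m. ?e (fst p) (snd p)) * ?w (fst ` m))"
    by (intro sum.group[symmetric]) (auto simp: matchings_def)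
  also have "\<dots> = (\<Sum>I\<in>Pow {..<k}. ?w I * (\<Sum>m\<in>{m \<in> matchings k. fst ` m = I}. \<Prod>p\<in>m. ?e (fst p) (snd p)))"
    unfolding sum_distrib_left by (intro sum.cong refl) auto
  also have "?N * \<dots> \<le> ?N * (\<Sum>I\<in>Pow {..<k}. ?w I * (type_arrangements k u I * exp (2 * real k * sqrt \<epsilon>) ^ ?types))"
    using \<epsilon>(1) by (intro mult_left_mono sum_mono sum_matchings_with_domain_le placement_cost_nonneg) auto
  also have "\<dots> = ?N * exp (2 * real k * sqrt \<epsilon>) ^ ?types * (\<Sum>I\<in>Pow {..<k}. ?w I * type_arrangements k u I)"
    unfolding sum_distrib_left by (intro sum.cong refl) simp
  also have "\<dots> \<le> ?N * exp (2 * real k * sqrt \<epsilon>) ^ ?types * (B * (real k + 1) ^ ?types)"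
    by (intro mult_left_mono sum_type_arrangements_le B) auto
  finally show "(\<Sum>c'\<in>sized_colorings n k u. overlap_weight n k c c')
      \<le> exp (M + real k ^ 2 * \<beta>) * (exp (2 * real k * sqrt \<epsilon>) * (real k + 1)) ^ ?types * B * card (sized_colorings n k u)"
    by (simp add: power_mult_distrib mult_ac)
qed

section \<open>The first moment bound\<close>

lemma sum_colorings_split_last:
  fixes H :: "'a set \<Rightarrow> ('a \<Rightarrow> nat) \<Rightarrow> real"
  assumes "finite V"
  shows "(\<Sum>f\<in>V \<rightarrow>\<^sub>E {..<Suc k}. H {v \<in> V. f v = k} (restrict f (V - {v \<in> V. f v = k})))
       = (\<Sum>T\<in>Pow V. \<Sum>f\<in>(V - T) \<rightarrow>\<^sub>E {..<k}. H T f)"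
proof -
  have "(\<Sum>T\<in>Pow V. \<Sum>f\<in>(V - T) \<rightarrow>\<^sub>E {..<k}. H T f)
      = (\<Sum>(T, f)\<in>(SIGMA T:Pow V. (V - T) \<rightarrow>\<^sub>E {..<k}). H T f)"
    using assms by (subst sum.Sigma) (auto intro!: finite_PiE)
  also have "\<dots> = (\<Sum>f\<in>V \<rightarrow>\<^sub>E {..<Suc k}. H {v \<in> V. f v = k} (restrict f (V - {v \<in> V. f v = k})))"
  proof (rule sum.reindex_bij_witness[of _ "\<lambda>f. ({v \<in> V. f v = k}, restrict f (V - {v \<in> V. f v = k}))"
        "\<lambda>(T, f). \<lambda>v\<in>V. if v \<in> T then k else f v"])
    fix f assume f: "f \<in> V \<rightarrow>\<^sub>E {..<Suc k}"
    show "(case ({v \<in> V. f v = k}, restrict f (V - {v \<in> V. f v = k})) of (T, f) \<Rightarrow> \<lambda>v\<in>V. if v \<in> T then k else f v) = f"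
      using f by (intro ext) (auto simp: PiE_def extensional_def)
    show "({v \<in> V. f v = k}, restrict f (V - {v \<in> V. f v = k})) \<in> (SIGMA T:Pow V. (V - T) \<rightarrow>\<^sub>E {..<k})"
      using f by (auto simp: PiE_def Pi_def less_Suc_eq)
  next
    fix y assume "y \<in> (SIGMA T:Pow V. (V - T) \<rightarrow>\<^sub>E {..<k})"
    then obtain T f where y: "y = (T, f)" "T \<subseteq> V" "f \<in> (V - T) \<rightarrow>\<^sub>E {..<k}" by blast
    have fk: "f v < k" if "v \<in> V - T" for v using y(3) that by (auto simp: PiE_def Pi_def)
    define f' where "f' = (\<lambda>v\<in>V. if v \<in> T then k else f v)"
    have last: "{v \<in> V. f' v = k} = T" using y(2) fk by (force simp: f'_def)
    have "restrict f' (V - T) = f"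
      using y(3) by (intro ext) (auto simp: f'_def PiE_def extensional_def)
    then show "({v \<in> V. (case y of (T, f) \<Rightarrow> \<lambda>v\<in>V. if v \<in> T then k else f v) v = k},
        restrict (case y of (T, f) \<Rightarrow> \<lambda>v\<in>V. if v \<in> T then k else f v)
          (V - {v \<in> V. (case y of (T, f) \<Rightarrow> \<lambda>v\<in>V. if v \<in> T then k else f v) v = k})) = y"
      "H {v \<in> V. (case y of (T, f) \<Rightarrow> \<lambda>v\<in>V. if v \<in> T then k else f v) v = k}
        (restrict (case y of (T, f) \<Rightarrow> \<lambda>v\<in>V. if v \<in> T then k else f v)
          (V - {v \<in> V. (case y of (T, f) \<Rightarrow> \<lambda>v\<in>V.
            if v \<in> T then k else f v) v = k})) = (case y of (T, f) \<Rightarrow> H T f)"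
      unfolding y(1) prod.case f'_def[symmetric] last by simp_all
    show "(case y of (T, f) \<Rightarrow> \<lambda>v\<in>V. if v \<in> T then k else f v) \<in> V \<rightarrow>\<^sub>E {..<Suc k}"
      unfolding y(1) prod.case using fk by (auto simp: less_SucI)
  qed
  finally show ?thesis by (rule sym)
qed

lemma choose_mult_fact_power:
  fixes \<rho> :: real
  assumes "0 < \<rho>" "t \<le> n"
  shows "real (n choose t) * (fact (n - t) / \<rho> ^ (n - t)) = fact n / \<rho> ^ n * (\<rho> ^ t / fact t)"
proof -
  have "\<rho> ^ n = \<rho> ^ (n - t) * \<rho> ^ t" using assms(2) by (simp add: power_add[symmetric])
  then show ?thesis using assms by (simp add: binomial_fact)
qed

lemma sum_colorings_le:
  fixes g :: "nat \<Rightarrow> real"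
  assumes g: "\<And>i. 0 \<le> g i" and \<rho>: "0 < \<rho>" and Y: "\<And>N. (\<Sum>i\<le>N. g i * \<rho> ^ i / fact i) \<le> Y" and "finite V"
  shows "(\<Sum>f\<in>V \<rightarrow>\<^sub>E {..<k}. \<Prod>j<k. g (card {v \<in> V. f v = j})) \<le> fact (card V) / \<rho> ^ card V * Y ^ k"
  using \<open>finite V\<close>
proof (induction k arbitrary: V)
  case 0
  show ?case
  proof (cases "V = {}")
    case False
    then have "V \<rightarrow>\<^sub>E {..<0::nat} = {}" by (auto simp: PiE_eq_empty_iff)
    then show ?thesis using \<rho> by simp
  qed simp
next
  case (Suc k)
  let ?n = "card V"
  define H where "H T f = g (card T) * (\<Prod>j<k. g (card {v \<in> V - T. f v = j}))" for T and f :: "'a \<Rightarrow> nat"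
  have Y_nonneg: "0 \<le> Y" using Y[of 0] g[of 0] by simp
  have last_class: "(\<Prod>j<Suc k. g (card {v \<in> V. f v = j})) = H {v \<in> V. f v = k} (restrict f (V - {v \<in> V. f v = k}))" for f
  proof -
    have "{v \<in> V - {v \<in> V. f v = k}. restrict f (V - {v \<in> V. f v = k}) v = j} = {v \<in> V. f v = j}"
      if "j < k" for j
      using that by auto
    then show ?thesis by (simp add: H_def mult.commute cong: prod.cong_simp)
  qed
  have rest: "(\<Sum>f\<in>(V - T) \<rightarrow>\<^sub>E {..<k}. H T f) \<le> g (card T) * (fact (?n - card T) / \<rho> ^ (?n - card T) * Y ^ k)"
    if "T \<in> Pow V" for T
  proof -
    have card: "card (V - T) = ?n - card T" using that Suc.prems by (simp add: card_Diff_subset finite_subset)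
    have "(\<Sum>f\<in>(V - T) \<rightarrow>\<^sub>E {..<k}. H T f)
       = g (card T) * (\<Sum>f\<in>(V - T) \<rightarrow>\<^sub>E {..<k}. \<Prod>j<k. g (card {v \<in> V - T. f v = j}))"
      by (simp only: H_def sum_distrib_left)
    also have "\<dots> \<le> g (card T) * (fact (card (V - T)) / \<rho> ^ card (V - T) * Y ^ k)"
      using Suc.prems by (intro mult_left_mono Suc.IH g) auto
    finally show ?thesis by (simp only: card)
  qed
  have choose: "real (?n choose t) * (g t * (fact (?n - t) / \<rho> ^ (?n - t) * Y ^ k))
      = fact ?n / \<rho> ^ ?n * Y ^ k * (g t * \<rho> ^ t / fact t)" if "t \<le> ?n" for t
    using arg_cong[OF choose_mult_fact_power[OF \<rho> that], of "\<lambda>z. z * (g t * Y ^ k)"] by (simp add: mult_ac)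
  have "(\<Sum>f\<in>V \<rightarrow>\<^sub>E {..<Suc k}. \<Prod>j<Suc k. g (card {v \<in> V. f v = j})) = (\<Sum>T\<in>Pow V. \<Sum>f\<in>(V - T) \<rightarrow>\<^sub>E {..<k}. H T f)"
    unfolding last_class by (rule sum_colorings_split_last[OF Suc.prems])
  also have "\<dots> \<le> (\<Sum>T\<in>Pow V. g (card T) * (fact (?n - card T) / \<rho> ^ (?n - card T) * Y ^ k))"
    by (intro sum_mono rest)
  also have "\<dots> = (\<Sum>t\<le>?n. real (?n choose t) * (g t * (fact (?n - t) / \<rho> ^ (?n - t) * Y ^ k)))"
    by (rule sum_Pow_by_card[OF Suc.prems])
  also have "\<dots> = fact ?n / \<rho> ^ ?n * Y ^ k * (\<Sum>t\<le>?n. g t * \<rho> ^ t / fact t)"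
    unfolding sum_distrib_left by (intro sum.cong refl choose) simp
  also have "\<dots> \<le> fact ?n / \<rho> ^ ?n * Y ^ k * Y"
    using Y Y_nonneg \<rho> by (intro mult_left_mono) auto
  finally show ?case by (simp add: mult.assoc mult.commute[of Y])
qed

definition indep_sets :: "nat \<Rightarrow> nat \<Rightarrow> nat set set \<Rightarrow> nat set set" where
  "indep_sets n a E = {T \<in> {T. T \<subseteq> {..<n} \<and> card T = a}. E \<inter> edges_in T = {}}"

lemma finite_indep_sets [simp]: "finite (indep_sets n a E)"
  by (rule finite_subset[of _ "Pow {..<n}"]) (auto simp: indep_sets_def)

lemma subset_avg_card_indep_sets:
  "subset_avg (edges_in {..<n}) (\<lambda>E. real (card (indep_sets n a E))) \<le> indep_mean n a"
proof -
  let ?Z = "edges_in {..<n}" and ?A = "{T. T \<subseteq> {..<n} \<and> card T = a}"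
  have "subset_avg ?Z (\<lambda>E. real (card (indep_sets n a E))) = (\<Sum>T\<in>?A. subset_avg ?Z (\<lambda>E. of_bool (E \<inter> edges_in T = {})))"
    unfolding indep_sets_def by (rule subset_avg_card) (rule finite_subset[of _ "Pow {..<n}"], auto)
  also have "\<dots> = (\<Sum>T\<in>?A. 1 / 2 ^ (a choose 2))"
  proof (intro sum.cong refl)
    fix T assume "T \<in> ?A"
    then have "T \<subseteq> {..<n}" "card T = a" "finite T" using finite_subset by auto
    then show "subset_avg ?Z (\<lambda>E. of_bool (E \<inter> edges_in T = {})) = 1 / 2 ^ (a choose 2)"
      by (subst subset_avg_avoid) (auto simp: card_edges_in edges_in_mono)
  qed
  also have "\<dots> = real (n choose a) / 2 ^ (a choose 2)" using n_subsets[of "{..<n}" a] by simp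
  also have "\<dots> \<le> real n ^ a / fact a / 2 ^ (a choose 2)"
    by (intro divide_right_mono binomial_le_power_div_fact) simp
  finally show ?thesis by (simp add: indep_mean_def indep_weight_def)
qed

definition bounded_colorings :: "nat \<Rightarrow> nat \<Rightarrow> nat \<Rightarrow> nat \<Rightarrow> nat set set \<Rightarrow> (nat \<Rightarrow> nat) set" where
  "bounded_colorings n a b k E = {f \<in> {..<n} \<rightarrow>\<^sub>E {..<k}.
     (\<forall>j\<in>{..<k}. color_class n f j \<noteq> {} \<and> card (color_class n f j) \<le> a \<and> E \<inter> edges_in (color_class n f j) = {}) \<and>
     card {j \<in> {..<k}. card (color_class n f j) = a} \<le> b}"

lemma finite_bounded_colorings [simp]: "finite (bounded_colorings n a b k E)"
  by (rule finite_subset[of _ "{..<n} \<rightarrow>\<^sub>E {..<k}"]) (auto simp: bounded_colorings_def intro: finite_PiE)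

lemma color_class_permute:
  "\<pi> permutes {..<k} \<Longrightarrow> color_class n (restrict (\<pi> \<circ> f) {..<n}) (\<pi> j) = color_class n f j"
  using permutes_inj[of \<pi> "{..<k}"] by (auto simp: color_class_def inj_eq)

lemma bounded_colorings_permute:
  assumes f: "f \<in> bounded_colorings n a b k E" and \<pi>: "\<pi> permutes {..<k}"
  shows "restrict (\<pi> \<circ> f) {..<n} \<in> bounded_colorings n a b k E"
proof -
  let ?g = "restrict (\<pi> \<circ> f) {..<n}"
  have "bij_betw \<pi> {i \<in> {..<k}. card (color_class n f i) = a} {j \<in> {..<k}. card (color_class n ?g j) = a}"
    by (rule bij_betw_Collect[OF permutes_imp_bij[OF \<pi>]]) (simp only: color_class_permute[OF \<pi>])
  then have "card {j \<in> {..<k}. card (color_class n ?g j) = a} \<le> b"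
    using f bij_betw_same_card by (fastforce simp: bounded_colorings_def)
  moreover have "\<forall>j\<in>\<pi> ` {..<k}. color_class n ?g j \<noteq> {} \<and> card (color_class n ?g j) \<le> a
      \<and> E \<inter> edges_in (color_class n ?g j) = {}"
    using f unfolding ball_simps color_class_permute[OF \<pi>] by (simp add: bounded_colorings_def)
  moreover have "?g \<in> {..<n} \<rightarrow>\<^sub>E {..<k}"
    using f permutes_in_image[OF \<pi>] by (auto simp: bounded_colorings_def)
  ultimately show ?thesis unfolding permutes_image[OF \<pi>] by (simp add: bounded_colorings_def)
qed

lemma fact_le_card_bounded_colorings:
  assumes f: "f \<in> bounded_colorings n a b k E"
  shows "fact k \<le> card (bounded_colorings n a b k E)"
proof -
  let ?P = "{\<pi>. \<pi> permutes {..<k}}" and ?\<phi> = "\<lambda>\<pi>. restrict (\<pi> \<circ> f) {..<n}"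
  have "inj_on ?\<phi> ?P"
  proof (rule inj_onI, rule ext)
    fix \<pi> \<sigma> j assume perm: "\<pi> \<in> ?P" "\<sigma> \<in> ?P" and eq: "?\<phi> \<pi> = ?\<phi> \<sigma>"
    show "\<pi> j = \<sigma> j"
    proof (cases "j < k")
      case True
      then have "color_class n f j \<noteq> {}" using f by (simp add: bounded_colorings_def)
      then obtain v where "v < n" "f v = j" by (auto simp: color_class_def)
      then show ?thesis using fun_cong[OF eq, of v] by simp
    next
      case False
      then show ?thesis using perm by (simp add: permutes_not_in)
    qed
  qed
  then have "card ?P \<le> card (bounded_colorings n a b k E)"
    using bounded_colorings_permute[OF f] by (intro card_inj_on_le) auto
  then show ?thesis using card_permutations[of "{..<k}" k] by simp
qed

lemma colorable_imp_onto_coloring: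
  assumes "colorable V k E" "finite V"
  obtains k' f where "k' \<le> k" "proper_coloring V k' E f" "f ` V = {..<k'}"
proof -
  obtain f where f: "proper_coloring V k E f" using assms(1) unfolding colorable_def by blast
  define k' where "k' = card (f ` V)"
  obtain \<beta> where bij: "bij_betw \<beta> (f ` V) {..<k'}"
    using ex_bij_betw_finite_nat[of "f ` V"] assms(2) by (auto simp: k'_def lessThan_atLeast0)
  show thesis
  proof (rule that)
    have "f ` V \<subseteq> {..<k}" using proper_coloring_less[OF f] by auto
    then show "k' \<le> k" unfolding k'_def using card_mono[of "{..<k}" "f ` V"] by simp
    show onto: "(\<beta> \<circ> f) ` V = {..<k'}" using bij by (simp add: bij_betw_def image_comp)
    have "\<beta> (f u) \<noteq> \<beta> (f v)" if "u \<in> V" "v \<in> V" "u \<noteq> v" "{u, v} \<in> E" for u v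
      using proper_coloring_neq[OF f that] bij that(1,2) by (auto simp: bij_betw_def inj_on_def)
    then show "proper_coloring V k' E (\<beta> \<circ> f)"
      using onto by (auto simp: proper_coloring_def)
  qed
qed

lemma proper_coloring_class_indep:
  assumes "proper_coloring {..<n} k E f"
  shows "E \<inter> edges_in (color_class n f j) = {}"
proof -
  have False if e: "e \<in> E" "e \<in> edges_in (color_class n f j)" for e
  proof -
    from e(2) obtain u v where "u \<in> color_class n f j" "v \<in> color_class n f j" "u \<noteq> v" "e = {u, v}"
      by (rule edges_inE)
    then show False using proper_coloring_neq[OF assms, of u v] e(1) by (simp add: color_class_def)
  qed
  then show ?thesis by blast
qed

lemma colorable_imp_bounded_coloring:
  assumes "colorable {..<n} k E" "card (indep_sets n a E) \<le> b" "indep_sets n (Suc a) E = {}"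
  obtains k' f where "k' \<le> k" "f \<in> bounded_colorings n a b k' E"
proof -
  obtain k' f\<^sub>0 where k': "k' \<le> k" and f\<^sub>0: "proper_coloring {..<n} k' E f\<^sub>0" "f\<^sub>0 ` {..<n} = {..<k'}"
    using colorable_imp_onto_coloring[OF assms(1)] by auto
  define f where "f = restrict f\<^sub>0 {..<n}"
  have classes: "color_class n f j = color_class n f\<^sub>0 j" for j by (auto simp: f_def color_class_def)
  have indep: "E \<inter> edges_in (color_class n f j) = {}" for j
    unfolding classes by (rule proper_coloring_class_indep[OF f\<^sub>0(1)])
  have nonempty: "color_class n f j \<noteq> {}" if "j < k'" for j
  proof -
    have "j \<in> f\<^sub>0 ` {..<n}" using that f\<^sub>0(2) by simp
    then show ?thesis unfolding classes by (auto simp: color_class_def)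
  qed
  have small: "card (color_class n f j) \<le> a" for j
  proof (rule ccontr)
    assume "\<not> card (color_class n f j) \<le> a"
    then obtain T where T: "T \<subseteq> color_class n f j" "card T = Suc a"
      using obtain_subset_with_card_n[of "Suc a" "color_class n f j"] by auto
    then have "T \<in> indep_sets n (Suc a) E"
      using indep[of j] edges_in_mono[OF T(1)] color_class_subset[of n f j] by (auto simp: indep_sets_def)
    then show False using assms(3) by simp
  qed
  have "inj_on (color_class n f) {j \<in> {..<k'}. card (color_class n f j) = a}"
    using nonempty by (intro inj_onI) (auto simp: color_class_def)
  moreover have "color_class n f ` {j \<in> {..<k'}. card (color_class n f j) = a} \<subseteq> indep_sets n a E"
    using indep color_class_subset[of n f] by (auto simp: indep_sets_def)
  ultimately have "card {j \<in> {..<k'}. card (color_class n f j) = a} \<le> card (indep_sets n a E)"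
    by (intro card_inj_on_le) auto
  then have "f \<in> bounded_colorings n a b k' E"
    using f\<^sub>0 indep nonempty small assms(2) by (auto simp: bounded_colorings_def f_def)
  then show thesis using k' that by blast
qed

definition class_sum :: "nat \<Rightarrow> real \<Rightarrow> real \<Rightarrow> real" where
  "class_sum a y \<rho> = (\<Sum>i=1..<a. \<rho> ^ i / indep_weight i) + y * \<rho> ^ a / indep_weight a"

lemma class_sum_nonneg: "0 \<le> y \<Longrightarrow> 0 \<le> \<rho> \<Longrightarrow> 0 \<le> class_sum a y \<rho>"
  unfolding class_sum_def
  by (intro add_nonneg_nonneg sum_nonneg divide_nonneg_nonneg) (auto simp: less_imp_le)

text \<open>Since there are few independent sets of the maximal size \<open>a\<close>, the classes of this size can be
  penalized by a factor \<open>y\<close>.\<close>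

definition class_weight :: "nat \<Rightarrow> real \<Rightarrow> nat \<Rightarrow> real" where
  "class_weight a y i = (if 1 \<le> i \<and> i \<le> a then (if i = a then y else 1) / 2 ^ (i choose 2) else 0)"

lemma class_weight_nonneg: "0 \<le> y \<Longrightarrow> 0 \<le> class_weight a y i"
  by (simp add: class_weight_def)

lemma sum_class_weight_le:
  assumes "0 \<le> y" "0 \<le> \<rho>" "1 \<le> a"
  shows "(\<Sum>i\<le>N. class_weight a y i * \<rho> ^ i / fact i) \<le> class_sum a y \<rho>"
proof -
  let ?h = "\<lambda>i. class_weight a y i * \<rho> ^ i / fact i"
  have "(\<Sum>i\<le>N. ?h i) = (\<Sum>i\<in>{..N} \<inter> {1..a}. ?h i)"
    by (intro sum.mono_neutral_right) (auto simp: class_weight_def)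
  also have "\<dots> \<le> (\<Sum>i\<in>{1..a}. ?h i)"
    using assms class_weight_nonneg by (intro sum_mono2) auto
  also have "{1..a} = insert a {1..<a}" using assms(3) by auto
  also have "(\<Sum>i\<in>insert a {1..<a}. ?h i) = class_sum a y \<rho>"
    using assms(3) by (simp add: class_sum_def class_weight_def indep_weight_def mult.commute add.commute)
  finally show ?thesis .
qed

lemma subset_avg_bounded_coloring_le:
  assumes y: "0 < y" "y \<le> 1" and f: "f \<in> {..<n} \<rightarrow>\<^sub>E {..<k}"
  shows "subset_avg (edges_in {..<n}) (\<lambda>E. of_bool (f \<in> bounded_colorings n a b k E))
     \<le> 1 / y ^ b * (\<Prod>j<k. class_weight a y (card (color_class n f j)))" (is "?lhs \<le> ?rhs")
proof (cases "(\<forall>j<k. 1 \<le> card (color_class n f j) \<and> card (color_class n f j) \<le> a)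
    \<and> card {j \<in> {..<k}. card (color_class n f j) = a} \<le> b")
  case False
  then have "f \<notin> bounded_colorings n a b k E" for E
    by (auto simp: bounded_colorings_def Suc_le_eq card_gt_0_iff)
  moreover have "0 \<le> ?rhs" using y by (intro mult_nonneg_nonneg prod_nonneg class_weight_nonneg) auto
  ultimately show ?thesis by simp
next
  case True
  let ?m = "card {j \<in> {..<k}. card (color_class n f j) = a}"
  let ?p = "\<Prod>j<k. 1 / (2::real) ^ (card (color_class n f j) choose 2)"
  have "?lhs \<le> subset_avg (edges_in {..<n}) (\<lambda>E. of_bool (E \<inter> class_edges n k f = {}))"
    by (intro subset_avg_mono) (auto simp: bounded_colorings_def class_edges_def)
  also have "\<dots> = 1 / 2 ^ card (class_edges n k f)"
    by (rule subset_avg_avoid) (simp_all add: class_edges_subset)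
  also have "\<dots> = ?p" by (simp add: card_class_edges power_sum prod_dividef)
  also have "\<dots> \<le> 1 / y ^ b * y ^ ?m * ?p"
  proof -
    have "y ^ b \<le> y ^ ?m" using y True by (intro power_decreasing) auto
    then have "1 \<le> 1 / y ^ b * y ^ ?m" using y by (simp add: field_simps)
    then have "1 * ?p \<le> 1 / y ^ b * y ^ ?m * ?p" by (intro mult_right_mono prod_nonneg) auto
    then show ?thesis by simp
  qed
  also have "y ^ ?m = (\<Prod>j<k. if card (color_class n f j) = a then y else 1)"
    by (simp add: prod.If_cases Int_def)
  also have "1 / y ^ b * (\<Prod>j<k. if card (color_class n f j) = a then y else 1) * ?p = ?rhs"
    unfolding mult.assoc prod.distrib[symmetric] using True
    by (intro arg_cong2[where f = "(*)"] prod.cong refl) (auto simp: class_weight_def)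
  finally show ?thesis .
qed

lemma subset_avg_card_bounded_colorings:
  assumes y: "0 < y" "y \<le> 1" and \<rho>: "0 < \<rho>" and a: "1 \<le> a"
  shows "subset_avg (edges_in {..<n}) (\<lambda>E. real (card (bounded_colorings n a b k E)))
     \<le> fact n / (y ^ b * \<rho> ^ n) * class_sum a y \<rho> ^ k"
proof -
  let ?Z = "edges_in {..<n}" and ?P = "{..<n} \<rightarrow>\<^sub>E {..<k}" and ?g = "class_weight a y"
  have members: "bounded_colorings n a b k E = {f \<in> ?P. f \<in> bounded_colorings n a b k E}" for E
    by (auto simp: bounded_colorings_def)
  have "subset_avg ?Z (\<lambda>E. real (card {f \<in> ?P. f \<in> bounded_colorings n a b k E}))
      = (\<Sum>f\<in>?P. subset_avg ?Z (\<lambda>E. of_bool (f \<in> bounded_colorings n a b k E)))"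
    by (intro subset_avg_card finite_PiE) auto
  also have "\<dots> \<le> (\<Sum>f\<in>?P. 1 / y ^ b * (\<Prod>j<k. ?g (card {v \<in> {..<n}. f v = j})))"
    using subset_avg_bounded_coloring_le[OF y] unfolding color_class_def by (intro sum_mono)
  also have "\<dots> = 1 / y ^ b * (\<Sum>f\<in>?P. \<Prod>j<k. ?g (card {v \<in> {..<n}. f v = j}))" by (simp only: sum_distrib_left)
  also have "\<dots> \<le> 1 / y ^ b * (fact (card {..<n}) / \<rho> ^ card {..<n} * class_sum a y \<rho> ^ k)"
    using y \<rho> a by (intro mult_left_mono sum_colorings_le class_weight_nonneg sum_class_weight_le) auto
  finally show ?thesis unfolding members[symmetric] by simp
qed

lemma of_bool_colorable_le:
  "of_bool (colorable {..<n} k E)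
     \<le> real (card (indep_sets n a E)) * (1 / (real b + 1)) + real (card (indep_sets n (Suc a) E))
     + (\<Sum>k'\<le>k. real (card (bounded_colorings n a b k' E)) * (1 / fact k'))" (is "_ \<le> ?many + ?large + ?bounded")
proof (cases "colorable {..<n} k E")
  case True
  have nonneg: "0 \<le> ?many" "0 \<le> ?large" "0 \<le> ?bounded" by (auto intro!: sum_nonneg)
  consider (many) "b < card (indep_sets n a E)" | (large) "indep_sets n (Suc a) E \<noteq> {}"
    | (bounded) "card (indep_sets n a E) \<le> b" "indep_sets n (Suc a) E = {}" by linarith
  then have "1 \<le> ?many + ?large + ?bounded"
  proof cases
    case many
    then have "1 \<le> ?many" by simp
    then show ?thesis using nonneg by linarith
  next
    case large
    then have "1 \<le> card (indep_sets n (Suc a) E)" by (simp add: Suc_le_eq card_gt_0_iff)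
    then show ?thesis using nonneg by linarith
  next
    case bounded
    then obtain k' f where k': "k' \<le> k" "f \<in> bounded_colorings n a b k' E"
      using colorable_imp_bounded_coloring[OF True] by blast
    have "fact k' \<le> real (card (bounded_colorings n a b k' E))"
      using of_nat_mono[OF fact_le_card_bounded_colorings[OF k'(2)], where 'a = real] by simp
    then have "1 \<le> real (card (bounded_colorings n a b k' E)) * (1 / fact k')" by simp
    also have "\<dots> \<le> ?bounded" by (rule member_le_sum) (use k' in auto)
    finally show ?thesis using nonneg by linarith
  qed
  then show ?thesis using True by simp
next
  case False
  then show ?thesis by (auto intro!: add_nonneg_nonneg sum_nonneg)
qed

lemma sum_power_fact_le_exp_scaled:
  fixes Y \<zeta> :: real
  assumes "0 \<le> Y" "0 < \<zeta>" "\<zeta> \<le> 1"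
  shows "(\<Sum>j\<le>k. Y ^ j / fact j) \<le> exp (\<zeta> * Y) / \<zeta> ^ k"
proof -
  have "(\<Sum>j\<le>k. Y ^ j / fact j) * \<zeta> ^ k = (\<Sum>j\<le>k. \<zeta> ^ k * Y ^ j / fact j)"
    unfolding sum_distrib_right by (intro sum.cong refl) simp
  also have "\<dots> \<le> (\<Sum>j\<le>k. (\<zeta> * Y) ^ j / fact j)"
    using assms unfolding power_mult_distrib
    by (intro sum_mono divide_right_mono mult_right_mono power_decreasing) auto
  also have "\<dots> \<le> exp (\<zeta> * Y)" using assms by (intro sum_power_fact_le_exp) simp
  finally show ?thesis using assms by (simp add: pos_le_divide_eq)
qed

lemma colorable_prob_first_moment:
  assumes y: "0 < y" "y \<le> 1" and \<rho>: "0 < \<rho>" and a: "1 \<le> a" and \<zeta>: "0 < \<zeta>" "\<zeta> \<le> 1"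
  shows "colorable_prob n k \<le> indep_mean n a / (real b + 1) + indep_mean n (Suc a)
     + fact n / (y ^ b * \<rho> ^ n * \<zeta> ^ k) * exp (\<zeta> * class_sum a y \<rho>)"
proof -
  let ?Z = "edges_in {..<n}" and ?Y = "class_sum a y \<rho>" and ?c = "fact n / (y ^ b * \<rho> ^ n)"
  have Y: "0 \<le> ?Y" using y \<rho> by (intro class_sum_nonneg) auto
  have "colorable_prob n k \<le> subset_avg ?Z (\<lambda>E. real (card (indep_sets n a E)) * (1 / (real b + 1))
      + real (card (indep_sets n (Suc a) E))
      + (\<Sum>k'\<le>k. real (card (bounded_colorings n a b k' E)) * (1 / fact k')))"
    unfolding colorable_prob_def by (intro subset_avg_mono of_bool_colorable_le)
  also have "\<dots> = subset_avg ?Z (\<lambda>E. real (card (indep_sets n a E))) * (1 / (real b + 1))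
      + subset_avg ?Z (\<lambda>E. real (card (indep_sets n (Suc a) E)))
      + (\<Sum>k'\<le>k. subset_avg ?Z (\<lambda>E. real (card (bounded_colorings n a b k' E))) * (1 / fact k'))"
    by (simp only: subset_avg_add subset_avg_sum subset_avg_cmult_right)
  also have "\<dots> \<le> indep_mean n a * (1 / (real b + 1)) + indep_mean n (Suc a) + (\<Sum>k'\<le>k. ?c * ?Y ^ k' * (1 / fact k'))"
    by (intro add_mono mult_right_mono sum_mono subset_avg_card_indep_sets subset_avg_card_bounded_colorings y \<rho> a) auto
  also have "(\<Sum>k'\<le>k. ?c * ?Y ^ k' * (1 / fact k')) = ?c * (\<Sum>k'\<le>k. ?Y ^ k' / fact k')"
    by (simp add: sum_distrib_left)
  also have "\<dots> \<le> ?c * (exp (\<zeta> * ?Y) / \<zeta> ^ k)"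
    using y \<rho> by (intro mult_left_mono sum_power_fact_le_exp_scaled Y \<zeta>) auto
  finally show ?thesis by (simp add: mult_ac)
qed

section \<open>Partial colorings with a given profile\<close>

lemma ln_le_quotient:
  fixes t :: real
  assumes "0 < t" "t \<le> 1"
  shows "ln t \<le> 2 * (t - 1) / (t + 1)"
proof -
  let ?f = "\<lambda>t::real. ln t - 2 * (t - 1) / (t + 1)"
  have "?f t \<le> ?f 1"
  proof (rule DERIV_nonneg_imp_nondecreasing[OF assms(2)])
    fix s assume "t \<le> s" "s \<le> 1"
    then have s: "0 < s" using assms by simp
    have "(?f has_real_derivative (1 / s - (2 * (s + 1) - 2 * (s - 1)) / (s + 1)\<^sup>2)) (at s)"
      using s by (auto intro!: derivative_eq_intros simp: power2_eq_square)
    moreover have "1 / s - (2 * (s + 1) - 2 * (s - 1)) / (s + 1)\<^sup>2 = (s - 1)\<^sup>2 / (s * (s + 1)\<^sup>2)"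
    proof -
      have "s \<noteq> 0" "s + 1 \<noteq> 0" using s by auto
      then show ?thesis by (simp add: divide_simps) (simp add: power2_eq_square algebra_simps)
    qed
    moreover have "0 \<le> (s - 1)\<^sup>2 / (s * (s + 1)\<^sup>2)" using s by simp
    ultimately show "\<exists>y. (?f has_real_derivative y) (at s) \<and> 0 \<le> y" by metis
  qed
  then show ?thesis by simp
qed

text \<open>There are \<open>x j\<close> classes of size \<open>a - j\<close>, together covering all \<open>n\<close> vertices, with mean
  deficit \<open>d\<close>; \<open>\<Lambda>\<close> is the Lagrange multiplier of the number of covered vertices, and \<open>c\<close> is
  a slack that later pays for the choice of the covered classes.\<close>

locale balanced_profile =
  fixes S :: "nat set" and x :: "nat \<Rightarrow> real" and a n :: nat and J \<Lambda> d c :: real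
  assumes finite_S: "finite S" and S_bounds: "\<And>j. j \<in> S \<Longrightarrow> 1 \<le> real j \<and> real j \<le> J"
    and J_bounds: "1 \<le> J" "J < a"
    and n_eq: "real n = (\<Sum>j\<in>S. (real a - j) * x j)" and n_pos: "0 < n"
    and mean_deficit: "(\<Sum>j\<in>S. x j * (j - d)) = 0"
    and \<Lambda>_nonneg: "0 \<le> \<Lambda>" and d_bounds: "1 \<le> d" "d \<le> a" and c_nonneg: "0 \<le> c"
    and slack: "\<Lambda> * (d - 1) / (real a - 1) + 2 * c / (a - J) \<le> 7 / 10" "2 * c / (a - J) \<le> 1 / 200"
    and gibbs: "(\<Sum>j\<in>S. (real a - j) * x j * exp (2 * (\<Lambda> * (j - d) / (real a - j)))) \<le> 9 / 5 * n"
begin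

definition covered :: "(nat \<Rightarrow> real) \<Rightarrow> real" where
  "covered q = (\<Sum>j\<in>S. (real a - j) * q j)"

definition tilt :: "(nat \<Rightarrow> real) \<Rightarrow> real" where
  "tilt q = (\<Sum>j\<in>S. q j * (d - j))"

definition boundary :: "(nat \<Rightarrow> real) \<Rightarrow> real" where
  "boundary q = (\<Sum>j\<in>S. min (q j) (x j - q j))"

definition subprofile :: "(nat \<Rightarrow> real) \<Rightarrow> bool" where
  "subprofile q \<longleftrightarrow> (\<forall>j\<in>S. 0 \<le> q j \<and> q j \<le> x j)"

lemma class_size_bounds: "j \<in> S \<Longrightarrow> 0 < real a - j \<and> a - J \<le> real a - j"
  using S_bounds[of j] J_bounds by linarith

lemma covered_nonneg: "subprofile q \<Longrightarrow> 0 \<le> covered q"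
  unfolding covered_def subprofile_def using class_size_bounds
  by (intro sum_nonneg mult_nonneg_nonneg) (auto simp: less_imp_le)

lemma subprofile_compl: "subprofile q \<Longrightarrow> subprofile (\<lambda>j. x j - q j)"
  by (simp add: subprofile_def)

lemma covered_compl: "covered (\<lambda>j. x j - q j) = n - covered q"
  by (simp add: covered_def n_eq right_diff_distrib sum_subtractf)

lemma covered_le: "subprofile q \<Longrightarrow> covered q \<le> n"
  using covered_nonneg[OF subprofile_compl, of q] covered_compl[of q] by simp

lemma tilt_compl: "tilt (\<lambda>j. x j - q j) = - tilt q"
proof -
  have "tilt (\<lambda>j. x j - q j) + tilt q = - (\<Sum>j\<in>S. x j * (j - d))"
    by (simp add: tilt_def sum.distrib[symmetric] sum_negf[symmetric] algebra_simps)
  then show ?thesis using mean_deficit by simp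
qed

lemma boundary_compl: "boundary (\<lambda>j. x j - q j) = boundary q"
  by (simp add: boundary_def min.commute)

lemma boundary_le_covered:
  assumes "subprofile q"
  shows "2 * c * boundary q \<le> covered q * (2 * c / (a - J))"
proof -
  have "2 * c * min (q j) (x j - q j) \<le> (real a - j) * q j * (2 * c / (a - J))" if j: "j \<in> S" for j
  proof -
    have "2 * c * min (q j) (x j - q j) \<le> 2 * c * q j" using c_nonneg by (intro mult_left_mono) auto
    also have "\<dots> = (a - J) * q j * (2 * c / (a - J))" using J_bounds(2) by simp
    also have "\<dots> \<le> (real a - j) * q j * (2 * c / (a - J))"
      using class_size_bounds[OF j] assms j J_bounds(2) c_nonneg
      by (intro mult_right_mono) (auto simp: subprofile_def)
    finally show ?thesis .
  qed
  then show ?thesis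
    unfolding boundary_def covered_def sum_distrib_left sum_distrib_right by (intro sum_mono) auto
qed

lemma tilt_le_covered:
  assumes "subprofile q"
  shows "\<Lambda> * tilt q \<le> covered q * (\<Lambda> * (d - 1) / (real a - 1))"
proof -
  have "\<Lambda> * (q j * (d - j)) \<le> (real a - j) * q j * (\<Lambda> * (d - 1) / (real a - 1))" if j: "j \<in> S" for j
  proof -
    have "0 \<le> (real j - 1) * (a - d)" using S_bounds[OF j] d_bounds by (intro mult_nonneg_nonneg) auto
    then have "(d - j) * (real a - 1) \<le> (d - 1) * (real a - j)" by (simp add: algebra_simps)
    then have "(\<Lambda> * q j) * ((d - j) * (real a - 1)) \<le> (\<Lambda> * q j) * ((d - 1) * (real a - j))"
      using \<Lambda>_nonneg assms j by (intro mult_left_mono) (auto simp: subprofile_def)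
    then show ?thesis using J_bounds by (simp add: field_simps)
  qed
  then show ?thesis unfolding tilt_def covered_def sum_distrib_left sum_distrib_right by (intro sum_mono)
qed

lemma entropy_few_covered:
  assumes q: "subprofile q" and few: "55 / 100 * real n \<le> n - covered q"
  shows "(n - covered q) * ln ((n - covered q) / n) + \<Lambda> * tilt q + 2 * c * boundary q \<le> 0"
proof -
  let ?N = "covered q"
  define \<nu> where "\<nu> = (n - ?N) / n"
  have N: "0 \<le> ?N" "?N \<le> n" using covered_nonneg[OF q] covered_le[OF q] by auto
  have \<nu>: "55 / 100 \<le> \<nu>" "\<nu> \<le> 1" "n - ?N = n * \<nu>" "n * (1 - \<nu>) = ?N"
    using few n_pos N by (auto simp: \<nu>_def field_simps)
  have "(n - ?N) * ln \<nu> \<le> (n - ?N) * (2 * (\<nu> - 1) / (\<nu> + 1))"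
    using \<nu> N by (intro mult_left_mono ln_le_quotient) auto
  also have "\<dots> = - (2 * \<nu> / (\<nu> + 1)) * (n * (1 - \<nu>))"
    unfolding \<nu>(3) using \<nu>(1) by (simp add: field_simps)
  also have "\<dots> \<le> - (7 / 10) * ?N"
    unfolding \<nu>(4) using \<nu>(1) by (intro mult_right_mono N(1)) (simp add: field_simps)
  finally have entropy: "(n - ?N) * ln \<nu> \<le> - (7 / 10) * ?N" .
  have "\<Lambda> * tilt q + 2 * c * boundary q \<le> ?N * (\<Lambda> * (d - 1) / (real a - 1) + 2 * c / (a - J))"
    using tilt_le_covered[OF q] boundary_le_covered[OF q] unfolding distrib_left by linarith
  also have "\<dots> \<le> ?N * (7 / 10)" using slack(1) N(1) by (intro mult_left_mono)
  finally show ?thesis using entropy by (simp add: \<nu>_def)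
qed

text \<open>The Gibbs variational inequality with the weights \<open>exp (2 g)\<close>.\<close>

lemma minus_tilt_le:
  assumes p: "subprofile p" and R: "0 < covered p"
  shows "- (\<Lambda> * tilt p) \<le> covered p / 2 * ln (9 / 5 * n / covered p)"
proof -
  define g where "g j = \<Lambda> * (j - d) / (real a - j)" for j :: nat
  define \<tau> where "\<tau> = 9 / 5 * n / covered p"
  have \<tau>: "0 < \<tau>" using R n_pos by (simp add: \<tau>_def)
  have g_le: "2 * g j \<le> exp (2 * g j) / \<tau> + (ln \<tau> - 1)" for j
  proof -
    have "ln (exp (2 * g j) / \<tau>) \<le> exp (2 * g j) / \<tau> - 1" using \<tau> by (intro ln_le_minus_one) auto
    then show ?thesis using \<tau> by (simp add: ln_div)
  qed
  have "((real a - j) * p j) * (2 * g j) \<le> ((real a - j) * x j * exp (2 * g j)) / \<tau> + ((real a - j) * p j) * (ln \<tau> - 1)"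
    if j: "j \<in> S" for j
  proof -
    have p_j: "0 \<le> p j" "p j \<le> x j" and size: "0 < real a - j"
      using p j class_size_bounds[OF j] by (auto simp: subprofile_def)
    have "((real a - j) * p j) * (2 * g j) \<le> ((real a - j) * p j) * (exp (2 * g j) / \<tau> + (ln \<tau> - 1))"
      using size p_j g_le by (intro mult_left_mono) auto
    also have "\<dots> = ((real a - j) * p j) * (exp (2 * g j) / \<tau>) + ((real a - j) * p j) * (ln \<tau> - 1)"
      by (simp only: distrib_left)
    also have "((real a - j) * p j) * (exp (2 * g j) / \<tau>) \<le> ((real a - j) * x j) * (exp (2 * g j) / \<tau>)"
      using size p_j \<tau> by (intro mult_right_mono mult_left_mono) auto
    finally show ?thesis by simp
  qed
  then have "(\<Sum>j\<in>S. ((real a - j) * p j) * (2 * g j))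
      \<le> (\<Sum>j\<in>S. (real a - j) * x j * exp (2 * g j)) / \<tau> + covered p * (ln \<tau> - 1)"
    unfolding covered_def sum_divide_distrib sum_distrib_right sum.distrib[symmetric] by (intro sum_mono)
  also have "\<dots> \<le> (9 / 5 * n) / \<tau> + covered p * (ln \<tau> - 1)"
    using gibbs \<tau> unfolding g_def by (intro add_right_mono divide_right_mono) auto
  also have "(9 / 5 * n) / \<tau> = covered p" using n_pos R by (simp add: \<tau>_def)
  also have "(\<Sum>j\<in>S. ((real a - j) * p j) * (2 * g j)) = 2 * - (\<Lambda> * tilt p)"
    unfolding tilt_def sum_distrib_left sum_negf[symmetric]
  proof (intro sum.cong refl)
    fix j assume "j \<in> S"
    then have "(real a - j) * g j = \<Lambda> * (j - d)" using class_size_bounds by (force simp: g_def)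
    then have "((real a - j) * p j) * (2 * g j) = 2 * p j * (\<Lambda> * (j - d))" by (metis mult.assoc mult.commute)
    then show "((real a - j) * p j) * (2 * g j) = 2 * - (\<Lambda> * (p j * (d - j)))" by (simp add: algebra_simps)
  qed
  finally show ?thesis by (simp add: \<tau>_def algebra_simps)
qed

lemma covered_eq_0D:
  assumes "subprofile q" "covered q = 0" "j \<in> S"
  shows "q j = 0"
proof -
  have "(real a - j) * q j = 0"
    using assms sum_nonneg_eq_0_iff[OF finite_S, of "\<lambda>j. (real a - j) * q j"] class_size_bounds
    by (simp add: covered_def subprofile_def less_imp_le)
  then show ?thesis using class_size_bounds[OF assms(3)] by simp
qed

lemma entropy_many_covered:
  assumes q: "subprofile q" and many: "n - covered q < 55 / 100 * n"
  shows "(n - covered q) * ln ((n - covered q) / n) + \<Lambda> * tilt q + 2 * c * boundary q \<le> 0"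
proof -
  define p where "p = (\<lambda>j. x j - q j)"
  define R where "R = covered p"
  have p: "subprofile p" using subprofile_compl[OF q] by (simp add: p_def)
  have R: "R = n - covered q" "tilt q = - tilt p" "boundary q = boundary p"
    unfolding R_def p_def by (simp_all add: covered_compl tilt_compl boundary_compl)
  have "2 * c * boundary p \<le> R * (2 * c / (a - J))" unfolding R_def by (rule boundary_le_covered[OF p])
  also have "\<dots> \<le> R * (1 / 200)"
    using slack(2) covered_nonneg[OF p] unfolding R_def by (intro mult_left_mono)
  finally have boundary: "2 * c * boundary p \<le> R / 200" by simp
  show ?thesis
  proof (cases "R = 0")
    case True
    then have "tilt p = 0" using covered_eq_0D[OF p] by (simp add: tilt_def R_def)
    then show ?thesis using True boundary R by simp
  next
    case False
    then have R_pos: "0 < R" "R < 55 / 100 * n" using covered_nonneg[OF p] many R by (auto simp: R_def)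
    have "ln (9 / 5 * (R / n)) \<le> 9 / 5 * (R / n) - 1" using R_pos n_pos by (intro ln_le_minus_one) auto
    also have "\<dots> \<le> - (1 / 100)" using R_pos n_pos by (simp add: field_simps)
    finally have ln_le: "ln (9 / 5 * (R / n)) \<le> - (1 / 100)" .
    have ln_combine: "2 * ln (R / n) + ln (9 / 5 * n / R) = ln (9 / 5 * (R / n))"
    proof -
      have "ln (9 / 5 * n / R) = ln (9 / 5) + ln n - ln R"
        using R_pos n_pos by (simp add: ln_div ln_mult del: times_divide_eq_left)
      moreover have "ln (9 / 5 * (R / n)) = ln (9 / 5) + ln R - ln n"
        using R_pos n_pos by (subst ln_mult) (auto simp: ln_div)
      ultimately show ?thesis using R_pos n_pos by (simp add: ln_div)
    qed
    have "R * ln (R / n) + R / 2 * ln (9 / 5 * n / R) = R / 2 * ln (9 / 5 * (R / n))"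
      unfolding ln_combine[symmetric] by (simp add: algebra_simps)
    also have "\<dots> \<le> R / 2 * (- (1 / 100))" using ln_le R_pos by (intro mult_left_mono) auto
    finally have "R * ln (R / n) + \<Lambda> * tilt q \<le> - R / 200"
      using minus_tilt_le[OF p] R_pos(1) unfolding R(2) R_def[symmetric] by simp
    then show ?thesis using boundary unfolding R(1)[symmetric] R(3) by linarith
  qed
qed

lemma entropy_balance:
  assumes "subprofile q"
  shows "(n - covered q) * ln ((n - covered q) / n) + \<Lambda> * tilt q + 2 * c * boundary q \<le> 0"
  using entropy_few_covered[OF assms] entropy_many_covered[OF assms] by linarith

end

lemma power_div_exp: "(real k / exp 1) ^ k = exp (real k * ln k - k)" for k :: nat
proof (cases "k = 0")
  case False
  then have "exp (real k * ln k) = real k ^ k" by (simp only: exp_of_nat_mult) simp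
  moreover have "exp (real k) = exp 1 ^ k" by (simp add: exp_of_nat_mult[symmetric])
  ultimately show ?thesis by (simp only: exp_diff power_divide)
qed simp

lemma power_div_exp_le_fact: "(real q / exp 1) ^ q \<le> fact q"
proof -
  have "real q ^ q \<le> exp 1 ^ q * fact q"
    using power_le_exp_fact[of "real q" q] by (simp add: exp_of_nat_mult[symmetric])
  then show ?thesis by (simp add: power_divide field_simps)
qed

lemma fact_le_power_div_exp: "fact q \<le> exp 1 * (real q + 1) * (real q / exp 1) ^ q"
proof (cases "q = 0")
  case True
  then show ?thesis by simp
next
  case False
  then have "1 \<le> q" by simp
  then have "fact q \<le> exp 1 * real q * (real q / exp 1) ^ q"
  proof (induction q rule: dec_induct)
    case base
    then show ?case by simp
  next
    case (step q)
    have "real q / (real q + 1) \<le> exp (- (1 / (real q + 1)))"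
      using exp_ge_add_one_self[of "- (1 / (real q + 1))"] by (simp add: field_simps)
    then have "(real q / (real q + 1)) ^ Suc q \<le> exp (- (1 / (real q + 1))) ^ Suc q"
      by (intro power_mono) auto
    also have "\<dots> = exp (- 1)" by (simp add: exp_of_nat_mult[symmetric] field_simps del: power_Suc)
    finally have ratio: "real q ^ Suc q * exp 1 \<le> (real q + 1) ^ Suc q"
      by (simp add: power_divide exp_minus field_simps del: power_Suc)
    have "fact (Suc q) = (real q + 1) * fact q" by simp
    also have "\<dots> \<le> (real q + 1) * (exp 1 * real q * (real q / exp 1) ^ q)"
      using step by (intro mult_left_mono) auto
    also have "\<dots> = (real q + 1) * (real q ^ Suc q * exp 1) / exp 1 ^ q" by (simp add: power_divide)
    also have "\<dots> \<le> (real q + 1) * (real q + 1) ^ Suc q / exp 1 ^ q"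
      using ratio by (intro divide_right_mono mult_left_mono) auto
    also have "\<dots> = exp 1 * real (Suc q) * (real (Suc q) / exp 1) ^ Suc q"
      by (simp add: power_divide add.commute)
    finally show ?case .
  qed
  also have "\<dots> \<le> exp 1 * (real q + 1) * (real q / exp 1) ^ q" by (intro mult_right_mono mult_left_mono) auto
  finally show ?thesis .
qed

lemma choose_le_exp:
  assumes "q \<le> \<kappa>" "real \<kappa> \<le> x" "0 \<le> c"
  shows "real (\<kappa> choose q) \<le> exp (exp (- c) * x + c * min (real q) (x - q))"
proof -
  have bound: "real (\<kappa> choose i) \<le> exp (exp (- c) * x + c * i)" if "i \<le> \<kappa>" for i
  proof -
    have "real (\<kappa> choose i) * exp (- c) ^ i \<le> (\<Sum>i\<le>\<kappa>. real (\<kappa> choose i) * exp (- c) ^ i * 1 ^ (\<kappa> - i))"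
      using member_le_sum[of i "{..\<kappa>}" "\<lambda>i. real (\<kappa> choose i) * exp (- c) ^ i * 1 ^ (\<kappa> - i)"] that by simp
    also have "\<dots> = (exp (- c) + 1) ^ \<kappa>" by (simp only: binomial_ring)
    also have "\<dots> \<le> exp (exp (- c)) ^ \<kappa>"
      using exp_ge_add_one_self[of "exp (- c)"]
      by (intro power_mono) (auto simp: add.commute add_nonneg_nonneg)
    also have "\<dots> = exp (exp (- c) * \<kappa>)" by (simp add: exp_of_nat_mult[symmetric] mult.commute)
    also have "\<dots> \<le> exp (exp (- c) * x)" using assms(2) by simp
    finally have "real (\<kappa> choose i) * exp (- (c * i)) \<le> exp (exp (- c) * x)"
      by (simp add: exp_of_nat_mult[symmetric] mult.commute)
    then have "real (\<kappa> choose i) * exp (- (c * i)) * exp (c * i) \<le> exp (exp (- c) * x) * exp (c * i)"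
      by (intro mult_right_mono) auto
    then show ?thesis unfolding mult.assoc exp_add[symmetric] by simp
  qed
  have "real (\<kappa> choose q) = real (\<kappa> choose (\<kappa> - q))" by (rule arg_cong[OF binomial_symmetric[OF assms(1)]])
  also have "\<dots> \<le> exp (exp (- c) * x + c * real (\<kappa> - q))" by (rule bound) simp
  also have "\<dots> \<le> exp (exp (- c) * x + c * (x - q))" using assms by (auto intro!: mult_left_mono)
  finally show ?thesis using bound[OF assms(1)] by (simp add: min_def)
qed

lemma choose_ffact_le:
  assumes "q \<le> \<kappa>" "real \<kappa> \<le> x" "0 \<le> c"
  shows "real (\<kappa> choose q) * ffact \<kappa> q
     \<le> exp (2 * exp (- c) * x) * exp (2 * c * min (real q) (x - q)) * (exp 1 * (x + 1)) * (x / exp 1) ^ q"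
proof -
  let ?E = "exp (exp (- c) * x + c * min (real q) (x - q))"
  have x: "0 \<le> x" "real q \<le> x" using assms by linarith+
  have "real (\<kappa> choose q) * ffact \<kappa> q = (real (\<kappa> choose q) * real (\<kappa> choose q)) * fact q"
    using assms(1) by (simp add: ffact_eq_binomial)
  also have "\<dots> \<le> (?E * ?E) * (exp 1 * (real q + 1) * (real q / exp 1) ^ q)"
    using choose_le_exp[OF assms] fact_le_power_div_exp[of q] by (intro mult_mono mult_nonneg_nonneg) auto
  also have "\<dots> \<le> (?E * ?E) * (exp 1 * (x + 1) * (x / exp 1) ^ q)"
    using x by (intro mult_left_mono mult_mono power_mono divide_right_mono) auto
  also have "?E * ?E = exp (2 * exp (- c) * x) * exp (2 * c * min (real q) (x - q))"
    by (simp add: exp_add[symmetric])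
  finally show ?thesis by (simp only: mult.assoc)
qed

locale critical_profile = balanced_profile +
  fixes \<rho> \<zeta> :: real
  assumes \<rho>_pos: "0 < \<rho>" and \<zeta>_pos: "0 < \<zeta>"
    and profile_weight: "\<And>j. j \<in> S \<Longrightarrow> x j * indep_weight (a - j) = \<zeta> * \<rho> ^ (a - j)"
    and \<Lambda>_eq: "\<Lambda> = 1 + ln (\<rho> / n)" and \<zeta>_eq: "1 - ln \<zeta> = (a - d) * \<Lambda>"
begin

lemma real_covered:
  "real (\<Sum>j\<in>S. (a - j) * q j) = covered (\<lambda>j. real (q j))"
proof -
  have "real ((a - j) * q j) = (real a - j) * real (q j)" if "j \<in> S" for j
    using class_size_bounds[OF that] by (simp add: of_nat_diff)
  then show ?thesis unfolding covered_def of_nat_sum by (intro sum.cong refl)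
qed

lemma exponent_balance:
  fixes q :: "nat \<Rightarrow> nat"
  assumes q: "subprofile (\<lambda>j. real (q j))" and R: "real R = n - covered (\<lambda>j. real (q j))"
  shows "2 * c * boundary (\<lambda>j. real (q j)) + (\<Sum>j\<in>S. real (q j)) * (ln \<zeta> - 1)
      + covered (\<lambda>j. real (q j)) * ln \<rho> + (real R * ln R - R) \<le> real n * ln n - n"
proof -
  let ?N = "covered (\<lambda>j. real (q j))" and ?Q = "\<Sum>j\<in>S. real (q j)"
  have R_ln: "real R * ln (real R / n) = real R * ln R - real R * ln n"
    using n_pos by (cases "R = 0") (simp_all add: ln_div algebra_simps)
  have tilt_eq: "tilt (\<lambda>j. real (q j)) = ?N - (a - d) * ?Q"
    by (simp add: tilt_def covered_def sum_distrib_left sum_subtractf[symmetric] algebra_simps)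
  have "\<Lambda> * tilt (\<lambda>j. real (q j)) = \<Lambda> * ?N - (1 - ln \<zeta>) * ?Q"
    unfolding tilt_eq \<zeta>_eq by (simp add: algebra_simps)
  also have "\<Lambda> * ?N = ?N + ?N * ln \<rho> - ?N * ln n" using \<rho>_pos n_pos by (simp add: \<Lambda>_eq ln_div algebra_simps)
  finally have "real R * ln R - real R * ln n + (?N + ?N * ln \<rho> - ?N * ln n - (1 - ln \<zeta>) * ?Q)
      + 2 * c * boundary (\<lambda>j. real (q j)) \<le> 0"
    using entropy_balance[OF q] unfolding R[symmetric] R_ln by simp
  moreover have "real R * ln n + ?N * ln n = n * ln n" by (simp add: R algebra_simps)
  ultimately show ?thesis by (simp add: R algebra_simps)
qed

lemma class_weights_le_ffact:
  fixes q :: "nat \<Rightarrow> nat"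
  assumes q: "subprofile (\<lambda>j. real (q j))"
  shows "exp (2 * c * boundary (\<lambda>j. real (q j))) * (\<zeta> / exp 1) ^ (\<Sum>j\<in>S. q j) * \<rho> ^ (\<Sum>j\<in>S. (a - j) * q j)
     \<le> ffact n (\<Sum>j\<in>S. (a - j) * q j) * (exp 1 * (real n + 1))"
proof -
  define N where "N = (\<Sum>j\<in>S. (a - j) * q j)"
  define Q where "Q = (\<Sum>j\<in>S. q j)"
  define R where "R = n - N"
  let ?m = "boundary (\<lambda>j. real (q j))"
  have N: "real N = covered (\<lambda>j. real (q j))" unfolding N_def by (rule real_covered)
  then have "N \<le> n" using covered_le[OF q] by simp
  then have R: "real R = n - real N" by (simp add: R_def of_nat_diff)
  have Q: "real Q = (\<Sum>j\<in>S. real (q j))" by (simp add: Q_def)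
  have "(\<zeta> / exp 1) ^ Q = exp (real Q * (ln \<zeta> - 1))" using \<zeta>_pos by (simp add: exp_of_nat_mult exp_diff)
  moreover have "\<rho> ^ N = exp (N * ln \<rho>)" using \<rho>_pos by (simp add: exp_of_nat_mult)
  ultimately have "exp (2 * c * ?m) * (\<zeta> / exp 1) ^ Q * \<rho> ^ N * (real R / exp 1) ^ R
     = exp (2 * c * ?m + real Q * (ln \<zeta> - 1) + real N * ln \<rho> + (real R * ln R - R))"
    by (simp only: power_div_exp exp_add)
  also have "\<dots> \<le> (real n / exp 1) ^ n"
    using exponent_balance[OF q] R unfolding power_div_exp N Q by simp
  also have "\<dots> \<le> fact n" by (rule power_div_exp_le_fact)
  also have "fact n = ffact n N * fact R" using \<open>N \<le> n\<close> by (simp add: ffact_eq_fact_div R_def)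
  also have "\<dots> \<le> ffact n N * (exp 1 * (real R + 1) * (real R / exp 1) ^ R)"
    by (intro mult_left_mono fact_le_power_div_exp) auto
  finally have "exp (2 * c * ?m) * (\<zeta> / exp 1) ^ Q * \<rho> ^ N * (real R / exp 1) ^ R
      \<le> (ffact n N * (exp 1 * (real R + 1))) * (real R / exp 1) ^ R" by (simp only: mult.assoc)
  moreover have "0 < (real R / exp 1) ^ R" by (cases "R = 0") auto
  ultimately have "exp (2 * c * ?m) * (\<zeta> / exp 1) ^ Q * \<rho> ^ N \<le> ffact n N * (exp 1 * (real R + 1))"
    by (simp only: mult_le_cancel_right_pos)
  also have "\<dots> \<le> ffact n N * (exp 1 * (real n + 1))" by (intro mult_left_mono) (auto simp: R)
  finally show ?thesis by (simp only: N_def Q_def)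
qed

definition profile_cost :: real where
  "profile_cost = exp (2 * exp (- c) * (\<Sum>j\<in>S. x j)) * (\<Prod>j\<in>S. exp 1 * (x j + 1)) * (exp 1 * (real n + 1))"

lemma prod_class_choices_le:
  fixes \<kappa> q :: "nat \<Rightarrow> nat"
  assumes \<kappa>: "\<And>j. j \<in> S \<Longrightarrow> real (\<kappa> j) \<le> x j" and q: "\<And>j. j \<in> S \<Longrightarrow> q j \<le> \<kappa> j"
  shows "(\<Prod>j\<in>S. real (\<kappa> j choose q j) * ffact (\<kappa> j) (q j) * indep_weight (a - j) ^ q j)
     \<le> profile_cost * ffact n (\<Sum>j\<in>S. (a - j) * q j)"
proof -
  let ?choice = "\<lambda>j. exp (2 * exp (- c) * x j) * (exp 1 * (x j + 1))"
  let ?weight = "\<lambda>j. exp (2 * c * min (real (q j)) (x j - q j)) * (\<zeta> / exp 1) ^ q j * \<rho> ^ ((a - j) * q j)"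
  have subprofile: "subprofile (\<lambda>j. real (q j))" using \<kappa> q by (force simp: subprofile_def)
  have x_nonneg: "0 \<le> x j" if "j \<in> S" for j using \<kappa>[OF that] by linarith
  have factor_le: "real (\<kappa> j choose q j) * ffact (\<kappa> j) (q j) * indep_weight (a - j) ^ q j \<le> ?choice j * ?weight j"
    if j: "j \<in> S" for j
  proof -
    have "real (\<kappa> j choose q j) * ffact (\<kappa> j) (q j) * indep_weight (a - j) ^ q j
       \<le> exp (2 * exp (- c) * x j) * exp (2 * c * min (real (q j)) (x j - q j)) * (exp 1 * (x j + 1)) * (x j / exp 1) ^ q j
         * indep_weight (a - j) ^ q j"
      by (intro mult_right_mono choose_ffact_le q \<kappa> c_nonneg j) (auto simp: less_imp_le)
    also have "\<dots> = exp (2 * exp (- c) * x j) * exp (2 * c * min (real (q j)) (x j - q j)) * (exp 1 * (x j + 1))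
        * ((x j / exp 1) ^ q j * indep_weight (a - j) ^ q j)" by (simp only: mult.assoc)
    also have "(x j / exp 1) ^ q j * indep_weight (a - j) ^ q j = (\<zeta> / exp 1) ^ q j * \<rho> ^ ((a - j) * q j)"
    proof -
      have "(x j / exp 1) * indep_weight (a - j) = (\<zeta> / exp 1) * \<rho> ^ (a - j)"
        using profile_weight[OF j] by simp
      then show ?thesis by (simp only: power_mult_distrib[symmetric] power_mult)
    qed
    finally show ?thesis by (simp only: mult_ac)
  qed
  have "(\<Prod>j\<in>S. real (\<kappa> j choose q j) * ffact (\<kappa> j) (q j) * indep_weight (a - j) ^ q j) \<le> (\<Prod>j\<in>S. ?choice j * ?weight j)"
    using factor_le by (intro prod_mono conjI) (auto intro!: mult_nonneg_nonneg simp: less_imp_le)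
  also have "\<dots> = (\<Prod>j\<in>S. ?choice j)
      * (exp (2 * c * boundary (\<lambda>j. real (q j))) * (\<zeta> / exp 1) ^ (\<Sum>j\<in>S. q j) * \<rho> ^ (\<Sum>j\<in>S. (a - j) * q j))"
    by (simp only: prod.distrib boundary_def sum_distrib_left exp_sum[OF finite_S] power_sum)
  also have "\<dots> \<le> (\<Prod>j\<in>S. ?choice j) * (ffact n (\<Sum>j\<in>S. (a - j) * q j) * (exp 1 * (real n + 1)))"
    using class_weights_le_ffact[OF subprofile] x_nonneg by (intro mult_left_mono prod_nonneg) auto
  also have "(\<Prod>j\<in>S. ?choice j) = exp (2 * exp (- c) * (\<Sum>j\<in>S. x j)) * (\<Prod>j\<in>S. exp 1 * (x j + 1))"
    by (simp only: prod.distrib sum_distrib_left exp_sum[OF finite_S])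
  finally show ?thesis by (simp add: profile_cost_def mult_ac)
qed

end

section \<open>Class sizes close to each other\<close>

lemma exists_type_counts:
  assumes "finite (S :: 's set)"
  obtains k :: nat and u :: "nat \<Rightarrow> 's" where "\<And>i. i < k \<Longrightarrow> u i \<in> S" "\<And>s. s \<in> S \<Longrightarrow> type_count u {..<k} s = \<kappa> s"
proof -
  have "\<exists>k (u :: nat \<Rightarrow> 's). (\<forall>i<k. u i \<in> S) \<and> (\<forall>s\<in>S. type_count u {..<k} s = \<kappa> s)"
    using assms
  proof (induction S rule: finite_induct)
    case empty
    show ?case by (intro exI[of _ "0::nat"]) auto
  next
    case (insert s S)
    then obtain k and u :: "nat \<Rightarrow> 's" where u: "\<forall>i<k. u i \<in> S" "\<forall>s\<in>S. type_count u {..<k} s = \<kappa> s" by blast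
    define u' where "u' i = (if i < k then u i else s)" for i
    have not_s: "u i \<noteq> s" if "i < k" for i using u(1) that insert.hyps by blast
    have "type_count u' {..<k + \<kappa> s} r = \<kappa> r" if "r \<in> insert s S" for r
    proof (cases "r = s")
      case True
      have "{i \<in> {..<k + \<kappa> s}. u' i = s} = {k..<k + \<kappa> s}"
        using not_s by (auto simp: u'_def split: if_splits)
      then show ?thesis using True by (simp add: type_count_def)
    next
      case False
      then have "{i \<in> {..<k + \<kappa> s}. u' i = r} = {i \<in> {..<k}. u i = r}" by (auto simp: u'_def split: if_splits)
      then show ?thesis using u(2) that False by (simp add: type_count_def)
    qed
    moreover have "\<forall>i<k + \<kappa> s. u' i \<in> insert s S" using u(1) by (simp add: u'_def)
    ultimately show ?case by blast
  qed
  then show thesis using that by blast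
qed

lemma pair_term_le:
  assumes uv: "u \<le> a" "v \<le> a" and M: "0 < M" "2 powr (a / 2) \<le> real a ^ 10 * M"
    and a: "real a ^ 12 * 2 powr (- real a / 4) \<le> 1" and t: "2 \<le> t" "2 * (t + 1) \<le> a"
  shows "pair_term u v (1 / M) t \<le> 2 * real a ^ 4 / M\<^sup>2"
proof -
  define s where "s = t - 2"
  have s: "t = s + 2" using t(1) by (simp add: s_def)
  have "real u ^ t \<le> real a ^ t" "real v ^ t \<le> real a ^ t" using uv by (simp_all add: power_mono)
  then have "real (u choose t) \<le> real a ^ t" "ffact v t \<le> real a ^ t"
    using binomial_le_power[of u t] ffact_le_power[of v t] by linarith+
  then have "pair_term u v (1 / M) t \<le> (real a ^ t * real a ^ t) * 2 ^ (t choose 2) * (1 / M) ^ t"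
    unfolding pair_term_def using M by (intro mult_right_mono mult_mono) auto
  also have "\<dots> = (2 * real a ^ 4 / M\<^sup>2) * (real a ^ 2 * (1 / M) * 2 powr ((real t + 1) / 2)) ^ s"
  proof -
    have "(2::real) ^ (t choose 2) = 2 powr (1 + (real t + 1) / 2 * s)"
      unfolding two_power_choose_2 s by (simp add: field_simps)
    also have "\<dots> = 2 * (2 powr ((real t + 1) / 2)) ^ s" unfolding two_powr_power powr_add by simp
    finally have "(2::real) ^ (t choose 2) = 2 * (2 powr ((real t + 1) / 2)) ^ s" .
    moreover have "real a ^ t * real a ^ t = real a ^ 4 * (real a ^ 2) ^ s"
      unfolding s by (simp add: power_add power2_eq_square power4_eq_xxxx power_mult_distrib)
    moreover have "(1 / M) ^ t = (1 / M) ^ s * (1 / M\<^sup>2)"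
      unfolding s by (simp add: power_add power_divide power2_eq_square)
    ultimately show ?thesis by (simp only: power_mult_distrib) (simp add: power_one_over mult_ac)
  qed
  also have "\<dots> \<le> (2 * real a ^ 4 / M\<^sup>2) * 1"
  proof (intro mult_left_mono power_le_one)
    have "1 / M \<le> real a ^ 10 * 2 powr (- real a / 2)"
      using M by (simp add: powr_minus_divide field_simps)
    moreover have "2 powr ((real t + 1) / 2) \<le> 2 powr (real a / 4)"
      using t by (intro powr_mono) auto
    ultimately have "real a ^ 2 * (1 / M) * 2 powr ((real t + 1) / 2)
       \<le> real a ^ 2 * (real a ^ 10 * 2 powr (- real a / 2)) * 2 powr (real a / 4)"
      using M by (intro mult_mono) auto
    also have "\<dots> = real a ^ 12 * (2 powr (- real a / 2) * 2 powr (real a / 4))"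
      by (simp add: power_add[symmetric] mult_ac)
    also have "2 powr (- real a / 2) * 2 powr (real a / 4) = 2 powr (- real a / 4)"
      by (simp add: powr_add[symmetric])
    finally show "real a ^ 2 * (1 / M) * 2 powr ((real t + 1) / 2) \<le> 1" using a by linarith
  qed (use M in auto)
  finally show ?thesis by simp
qed

lemma pair_weight_le:
  assumes "u \<le> a" "v \<le> a" "2 * L \<le> a" "0 < M" "2 powr (a / 2) \<le> real a ^ 10 * M"
    and "real a ^ 12 * 2 powr (- real a / 4) \<le> 1"
  shows "pair_weight u v L (1 / M) \<le> real a ^ 5 / M\<^sup>2"
proof -
  have "pair_weight u v L (1 / M) \<le> (\<Sum>t=2..<L. 2 * real a ^ 4 / M\<^sup>2)"
    unfolding pair_weight_def using assms by (intro sum_mono pair_term_le) auto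
  also have "\<dots> = real (card {2..<L}) * (2 * real a ^ 4 / M\<^sup>2)" by simp
  also have "\<dots> \<le> (real a / 2) * (2 * real a ^ 4 / M\<^sup>2)"
    using assms(3) by (intro mult_right_mono) auto
  also have "\<dots> = real a ^ 5 / M\<^sup>2" by (simp add: power_add[symmetric] eval_nat_numeral)
  finally show ?thesis .
qed

definition overlap_root :: "nat \<Rightarrow> nat \<Rightarrow> nat \<Rightarrow> real" where
  "overlap_root n w t = real (w choose t) * sqrt (indep_weight t * real n ^ (w - t) / indep_weight w)"

lemma overlap_root_nonneg: "0 \<le> overlap_root n w t"
  by (simp add: overlap_root_def less_imp_le)

lemma overlap_root_same [simp]: "overlap_root n w w = 1"
  by (simp add: overlap_root_def)

lemma overlap_ratio_eq:
  assumes "t \<le> v"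
  shows "real (u choose t) * overlap_ratio n u v t = overlap_root n u t * overlap_root n v t"
proof -
  have "sqrt (indep_weight t * indep_weight t) = indep_weight t"
    by (simp add: abs_of_pos[OF indep_weight_pos])
  then have "sqrt (indep_weight t * real n ^ (u - t) / indep_weight u)
      * sqrt (indep_weight t * real n ^ (v - t) / indep_weight v)
      = indep_weight t * sqrt (real n ^ (u - t) * real n ^ (v - t) / (indep_weight u * indep_weight v))"
    by (simp add: real_sqrt_mult real_sqrt_divide)
  then show ?thesis using assms
    by (simp add: overlap_root_def overlap_ratio_def indep_weight_def ffact_eq_binomial)
qed

lemma indep_weight_ratio_le:
  assumes "t \<le> w"
  shows "indep_weight t / indep_weight w \<le> (2 powr (- (real w + t - 1) / 2)) ^ (w - t)"
proof -
  have "indep_weight t / indep_weight w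
      = (fact t / fact w) * (2 powr (real t * (real t - 1) / 2) / 2 powr (real w * (real w - 1) / 2))"
    by (simp add: indep_weight_def two_power_choose_2)
  also have "\<dots> \<le> 1 * (2 powr (real t * (real t - 1) / 2) / 2 powr (real w * (real w - 1) / 2))"
    using assms by (intro mult_right_mono) (auto simp: fact_mono)
  also have "\<dots> = 2 powr (real t * (real t - 1) / 2 - real w * (real w - 1) / 2)" by (simp add: powr_diff)
  also have "real t * (real t - 1) / 2 - real w * (real w - 1) / 2 = (- (real w + t - 1) / 2) * (w - t)"
    using assms by (simp add: of_nat_diff field_simps)
  finally show ?thesis unfolding two_powr_power .
qed

lemma overlap_root_le:
  assumes w: "a - J \<le> w" "w < a" "a \<le> 2 * t" "t < w" and J: "J \<le> a"
    and n: "real n \<le> 2 * a * 2 powr (a / 2)"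
    and X: "2 * real a ^ 3 * 2 powr ((real J + 1) / 2 - real a / 4) \<le> 1"
  shows "overlap_root n w t \<le> sqrt (2 * real a ^ 3 * 2 powr ((real J + 1) / 2 - real a / 4))"
proof (rule real_le_rsqrt)
  let ?X = "2 * real a ^ 3 * 2 powr ((real J + 1) / 2 - real a / 4)"
  define s where "s = w - t"
  have s: "1 \<le> s" "w = t + s" using w by (auto simp: s_def)
  have "real (w choose t) = real (w choose s)" using binomial_symmetric[of t w] w by (simp add: s_def)
  also have "\<dots> \<le> real w ^ s" by (rule binomial_le_power)
  also have "\<dots> \<le> real a ^ s" using w by (intro power_mono) auto
  finally have choose_le: "real (w choose t) \<le> real a ^ s" .
  have "(overlap_root n w t)\<^sup>2 = (real (w choose t))\<^sup>2 * (indep_weight t / indep_weight w) * real n ^ s"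
    by (simp add: overlap_root_def power_mult_distrib s_def less_imp_le)
  also have "\<dots> \<le> (real a ^ s)\<^sup>2 * (2 powr (- (real w + t - 1) / 2)) ^ s * (2 * a * 2 powr (real a / 2)) ^ s"
    using choose_le indep_weight_ratio_le[of t w] n w
    by (intro mult_mono power_mono mult_nonneg_nonneg) (auto simp: less_imp_le s_def)
  also have "\<dots> = ((real a)\<^sup>2 * 2 powr (- (real w + t - 1) / 2) * (2 * a * 2 powr (real a / 2))) ^ s"
    by (simp add: power_mult_distrib power_mult[symmetric] mult.commute)
  also have "\<dots> \<le> ?X ^ s"
  proof (intro power_mono)
    have "(real a)\<^sup>2 * 2 powr (- (real w + t - 1) / 2) * (2 * a * 2 powr (real a / 2))
        = 2 * real a ^ 3 * 2 powr (- (real w + t - 1) / 2 + real a / 2)"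
      by (simp add: powr_add power2_eq_square power3_eq_cube)
    also have "\<dots> \<le> ?X"
    proof (intro mult_left_mono powr_mono)
      have "real a - real J \<le> real w" "real a / 2 \<le> real t" using w J by linarith+
      then have "0 \<le> ((real w + t) - (3 / 2 * real a - J)) / 2" by simp
      then show "- (real w + t - 1) / 2 + real a / 2 \<le> (real J + 1) / 2 - real a / 4"
        by (simp add: field_simps)
    qed auto
    finally show "(real a)\<^sup>2 * 2 powr (- (real w + t - 1) / 2) * (2 * a * 2 powr (real a / 2)) \<le> ?X" .
  qed auto
  also have "\<dots> \<le> ?X" using power_decreasing[OF s(1), of ?X] X by simp
  finally show "(overlap_root n w t)\<^sup>2 \<le> ?X" .
qed

lemma overlap_root_mult_le:
  fixes r :: real
  assumes u: "overlap_root n u t \<le> of_bool (t = u) + r" and v: "overlap_root n v t \<le> of_bool (t = v) + r"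
    and r: "0 \<le> r" "r \<le> 1"
  shows "overlap_root n u t * overlap_root n v t \<le> of_bool (u = v \<and> t = u) + r"
proof -
  consider (both) "t = u" "t = v" | (left) "t \<noteq> u" | (right) "t \<noteq> v" by blast
  then show ?thesis
  proof cases
    case both
    then show ?thesis using r by simp
  next
    case left
    have "overlap_root n v t \<le> 1" using v r by (cases "t = v") auto
    then have "overlap_root n u t * overlap_root n v t \<le> r * 1"
      using u left r overlap_root_nonneg by (intro mult_mono) auto
    then show ?thesis using r by auto
  next
    case right
    have "overlap_root n u t \<le> 1" using u r by (cases "t = u") auto
    then have "overlap_root n u t * overlap_root n v t \<le> 1 * r"
      using v right r overlap_root_nonneg by (intro mult_mono) auto
    then show ?thesis using r by auto
  qed
qed

lemma sum_overlap_ratio_le: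
  assumes uv: "a - J \<le> u" "u < a" "a - J \<le> v" "v < a" and L: "a = 2 * L" and J: "J \<le> a"
    and n: "real n \<le> 2 * a * 2 powr (a / 2)"
    and X: "2 * real a ^ 3 * 2 powr ((real J + 1) / 2 - real a / 4) \<le> 1"
  shows "(\<Sum>t\<in>{L..u}. real (u choose t) * overlap_ratio n u v t)
     \<le> of_bool (u = v) + a * sqrt (2 * real a ^ 3 * 2 powr ((real J + 1) / 2 - real a / 4))"
proof -
  define r where "r = sqrt (2 * real a ^ 3 * 2 powr ((real J + 1) / 2 - real a / 4))"
  have r: "0 \<le> r" "r \<le> 1" using X by (auto simp: r_def)
  have root_le: "overlap_root n w t \<le> of_bool (t = w) + r" if "a - J \<le> w" "w < a" "L \<le> t" "t \<le> w" for w t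
    using overlap_root_le[of a J w t n] that L J n X r(1) by (cases "t = w") (auto simp: r_def)
  have term_le: "real (u choose t) * overlap_ratio n u v t \<le> of_bool (u = v \<and> t = u) + r"
    if t: "t \<in> {L..u}" for t
  proof (cases "t \<le> v")
    case False
    then show ?thesis using r by (simp add: overlap_ratio_def ffact_eq_0)
  next
    case True
    then have "overlap_root n u t * overlap_root n v t \<le> of_bool (u = v \<and> t = u) + r"
      using uv t r by (intro overlap_root_mult_le root_le) auto
    then show ?thesis using overlap_ratio_eq[OF True] by simp
  qed
  have "(\<Sum>t\<in>{L..u}. real (u choose t) * overlap_ratio n u v t) \<le> (\<Sum>t\<in>{L..u}. of_bool (u = v \<and> t = u) + r)"
    by (intro sum_mono term_le)
  also have "\<dots> = (\<Sum>t\<in>{L..u}. of_bool (u = v \<and> t = u)) + real (card {L..u}) * r"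
    by (simp only: sum.distrib sum_constant)
  also have "(\<Sum>t\<in>{L..u}. of_bool (u = v \<and> t = u)) \<le> (of_bool (u = v) :: real)"
    by (cases "u = v") (auto simp: of_bool_def sum.If_cases)
  also have "real (card {L..u}) * r \<le> real a * r"
    using uv L r by (intro mult_right_mono) (auto simp: of_nat_diff)
  finally show ?thesis by (simp add: r_def)
qed

section \<open>The optimal profile\<close>

lemma ln2_bounds: "693 / 1000 \<le> ln (2::real)" "ln (2::real) \<le> 7 / 10"
proof -
  have "ln (2::real) \<in> {307/443<..<4615/6658}"
    using ln_approx_bounds[of 2 3] by (simp add: eval_nat_numeral)
  then show "693 / 1000 \<le> ln (2::real)" "ln (2::real) \<le> 7 / 10" by simp_all
qed

lemma sqrt2_bounds: "14142 / 10000 \<le> sqrt 2" "sqrt 2 \<le> 14143 / 10000"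
proof -
  show "14142 / 10000 \<le> sqrt 2" by (rule real_le_rsqrt) (simp add: power2_eq_square)
  show "sqrt 2 \<le> 14143 / 10000" by (rule real_le_lsqrt) (simp_all add: power2_eq_square)
qed

lemma exp_1_ge: "27166 / 10000 \<le> exp (1::real)"
  using sum_power_fact_le_exp[of 1 5] by (simp add: eval_nat_numeral)

lemma sum_half_powers_le: "(\<Sum>j=1..m. (1 / 2) ^ j) \<le> (1::real)"
proof -
  have "(\<Sum>j=1..m. (1 / 2) ^ j) = (1::real) - (1 / 2) ^ m" by (induction m) auto
  then show ?thesis by simp
qed

definition gauss_weight :: "real \<Rightarrow> nat \<Rightarrow> real" where
  "gauss_weight b j = 2 powr (b * j - (real j)\<^sup>2 / 2)"

lemma gauss_weight_pos: "0 < gauss_weight b j"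
  by (simp add: gauss_weight_def)

lemma gauss_weight_le_geometric:
  assumes "b \<le> 3"
  shows "gauss_weight b j \<le> 256 * (1 / 2) ^ j"
proof -
  have "b * j \<le> 3 * real j" using assms by (intro mult_right_mono) auto
  moreover have "0 \<le> (real j - 4)\<^sup>2" by simp
  ultimately have "b * j - (real j)\<^sup>2 / 2 \<le> 8 - real j" by (simp add: power2_eq_square algebra_simps)
  then have "gauss_weight b j \<le> 2 powr (8 - real j)" unfolding gauss_weight_def by (intro powr_mono) auto
  also have "\<dots> = 256 * (1 / 2) ^ j" by (simp add: powr_diff powr_realpow power_divide)
  finally show ?thesis .
qed

lemma gauss_weight_tail_le:
  assumes b: "b \<le> 3" and j: "8 \<le> m" "m \<le> j"
  shows "gauss_weight b j \<le> 2 powr (- (real m * (real m / 2 - 4))) * (1 / 2) ^ j"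
proof -
  have "real m * (real m / 2 - 4) \<le> real j * (real j / 2 - 4)" using j by (intro mult_mono) auto
  moreover have "b * j \<le> 3 * real j" using b by (intro mult_right_mono) auto
  ultimately have "b * j - (real j)\<^sup>2 / 2 \<le> - (real m * (real m / 2 - 4)) - j"
    by (simp add: power2_eq_square algebra_simps)
  then have "gauss_weight b j \<le> 2 powr (- (real m * (real m / 2 - 4)) - j)"
    unfolding gauss_weight_def by (intro powr_mono) auto
  then show ?thesis by (simp add: powr_diff powr_realpow power_divide)
qed

lemma gauss_weight_0_le:
  assumes "2 \<le> j"
  shows "(real j - 2) * gauss_weight 0 j \<le> 1 / 2 * (1 / 2) ^ j"
proof (cases "j = 2")
  case False
  have "j - 3 + 1 \<le> 2 ^ (j - 3)" using less_exp[of "j - 3"] by (simp add: Suc_le_eq)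
  then have "real (j - 3 + 1) \<le> real (2 ^ (j - 3))" by (rule of_nat_mono)
  then have "real j - 2 \<le> 2 ^ (j - 3)" using assms False by (simp add: of_nat_diff)
  also have "(2::real) ^ (j - 3) = 2 powr (real j - 3)"
    using assms False by (simp add: powr_realpow[symmetric] of_nat_diff)
  finally have "(real j - 2) * gauss_weight 0 j \<le> 2 powr (real j - 3) * gauss_weight 0 j"
    using gauss_weight_pos[of 0 j] by (intro mult_right_mono) auto
  also have "\<dots> = 2 powr (real j - 3 - (real j)\<^sup>2 / 2)" by (simp add: gauss_weight_def powr_add[symmetric])
  also have "\<dots> \<le> 2 powr (- 1 - real j)"
  proof (intro powr_mono)
    have "0 \<le> (real j - 2)\<^sup>2" by simp
    then show "real j - 3 - (real j)\<^sup>2 / 2 \<le> - 1 - real j" by (simp add: power2_eq_square algebra_simps)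
  qed simp
  also have "\<dots> = 1 / 2 * (1 / 2) ^ j" by (simp add: powr_diff powr_realpow power_divide powr_minus_divide)
  finally show ?thesis .
qed simp

lemma gauss_weight_Suc: "gauss_weight b (Suc l) * 2 powr (Suc l) = 2 powr (b + 1 / 2) * gauss_weight b l"
  unfolding gauss_weight_def powr_add[symmetric]
  by (intro arg_cong[where f = "\<lambda>z. 2 powr z"]) (simp add: power2_eq_square field_simps)

lemma two_powr_le_sum_gauss_weight:
  assumes "0 \<le> b" "2 \<le> m"
  shows "95 / 100 * 2 powr b \<le> (\<Sum>l=1..m. gauss_weight b l)"
proof -
  have "(2::real) powr (- 2) \<le> 2 powr (b - 2)" using assms by (intro powr_mono) auto
  moreover have "7 / 10 \<le> 1 / sqrt 2" using sqrt2_bounds by (simp add: field_simps)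
  ultimately have "95 / 100 \<le> 1 / sqrt 2 + 2 powr (b - 2)" by (simp add: powr_minus_divide)
  then have "95 / 100 * 2 powr b \<le> (1 / sqrt 2 + 2 powr (b - 2)) * 2 powr b" by (intro mult_right_mono) auto
  also have "\<dots> = gauss_weight b 1 + gauss_weight b 2"
  proof -
    have "gauss_weight b 1 = 1 / sqrt 2 * 2 powr b" by (simp add: gauss_weight_def powr_diff powr_half_sqrt)
    moreover have "gauss_weight b 2 = 2 powr (b - 2) * 2 powr b"
      by (simp add: gauss_weight_def powr_add[symmetric] mult.commute)
    ultimately show ?thesis by (simp add: distrib_right)
  qed
  also have "\<dots> = (\<Sum>l\<in>{1, 2}. gauss_weight b l)" by simp
  also have "\<dots> \<le> (\<Sum>l=1..m. gauss_weight b l)"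
    using assms(2) gauss_weight_pos by (intro sum_mono2) (auto intro: less_imp_le)
  finally show ?thesis .
qed

lemma sum_gauss_weight_two_powr_le:
  assumes b: "0 \<le> b" "b \<le> 3" and m: "2 \<le> m"
  shows "(\<Sum>j=1..m. gauss_weight b j * 2 powr j) \<le> 1283 / 100 * (998 / 1000 * (\<Sum>l=1..m. gauss_weight b l))"
proof -
  define W where "W = (\<Sum>l=1..m. gauss_weight b l)"
  have W_ge: "95 / 100 * 2 powr b \<le> W" unfolding W_def by (rule two_powr_le_sum_gauss_weight[OF b(1) m])
  then have W_nonneg: "0 \<le> W" using powr_ge_zero[of 2 b] by linarith
  have "(\<Sum>j=1..m. gauss_weight b j * 2 powr j) = (\<Sum>l<m. gauss_weight b (Suc l) * 2 powr (Suc l))"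
    by (rule sum.reindex_bij_witness[of _ Suc "\<lambda>j. j - 1"]) auto
  also have "\<dots> = 2 powr (b + 1 / 2) * (\<Sum>l<m. gauss_weight b l)" unfolding gauss_weight_Suc sum_distrib_left ..
  also have "(\<Sum>l<m. gauss_weight b l) \<le> (\<Sum>l\<in>insert 0 {1..m}. gauss_weight b l)"
    using gauss_weight_pos by (intro sum_mono2) (auto intro: less_imp_le)
  also have "\<dots> = 1 + W" by (simp add: W_def gauss_weight_def)
  also have "2 powr (b + 1 / 2) * (1 + W) = sqrt 2 * (2 powr b * (1 + W))"
    by (simp add: powr_add powr_half_sqrt)
  also have "\<dots> \<le> 14143 / 10000 * (W * (100 / 95) + 8 * W)"
  proof (intro mult_mono sqrt2_bounds)
    have "2 powr b \<le> 8" using powr_mono[of b 3 "2::real"] b by simp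
    then show "2 powr b * (1 + W) \<le> W * (100 / 95) + 8 * W"
      using W_ge mult_right_mono[OF _ W_nonneg] by (fastforce simp: distrib_left)
  qed (use W_nonneg in auto)
  also have "\<dots> \<le> 1283 / 100 * (998 / 1000 * W)" using W_nonneg by simp
  finally show ?thesis by (simp add: W_def mult_left_mono)
qed

text \<open>The class size \<open>a\<close> is the parameter; \<open>n0\<close> is chosen such that the expected number of
  independent sets of size \<open>a\<close> is about \<open>n0 / (100 a\<^sup>2)\<close>. The color classes have sizes
  \<open>a - j\<close> for \<open>1 \<le> j \<le> J\<close>, and \<open>profile b j\<close> is the number of classes of size \<open>a - j\<close>; these
  numbers maximize the expected number of colorings for a given number of classes, and \<open>b\<close> is
  fixed by the requirement that the expected number of colorings is about \<open>1\<close>.\<close>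

locale large_class_size =
  fixes J a :: nat
  assumes a_eq: "a = 2 * J ^ 4" and J_ge_16: "16 \<le> J"
    and linear_le_exponential: "300 * real a \<le> 2 powr (real a - 1)"
    and ln_200_le: "ln (200 * real a) + 20 \<le> 48 / 10000 * real a"
    and ln_le: "4100 * ln (real a) \<le> real a"
    and power_100_le: "real a ^ 100 * 2 powr (- real a / 8) \<le> 1"
    and ln_ge_30: "30 \<le> ln (real a)"
    and tail_le: "real a * 2 powr (- (real J * (real J / 2 - 4))) \<le> 1"
begin

abbreviation "A \<equiv> real a"

definition "half_power = 2 powr (A / 2)"

lemma J_square_le: "512 * (real J)\<^sup>2 \<le> A"
proof -
  have "(16::real)\<^sup>2 \<le> (real J)\<^sup>2" using J_ge_16 by (intro power_mono) auto
  then have "256 * (real J)\<^sup>2 \<le> (real J)\<^sup>2 * (real J)\<^sup>2" by (intro mult_right_mono) auto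
  then show ?thesis by (simp add: a_eq power_add[symmetric])
qed

lemma A_large: "131072 \<le> A"
proof -
  have "(16::real)\<^sup>2 \<le> (real J)\<^sup>2" using J_ge_16 by (intro power_mono) auto
  then show ?thesis using J_square_le by simp
qed

lemma A_pos: "0 < A"
  using A_large by linarith

lemma A_ln2_bounds: "693 / 1000 * A \<le> A * ln 2" "A * ln 2 \<le> 7 / 10 * A"
proof -
  have "A * (693 / 1000) \<le> A * ln 2" using ln2_bounds by (intro mult_left_mono) auto
  then show "693 / 1000 * A \<le> A * ln 2" by (simp only: mult.commute)
  have "A * ln 2 \<le> A * (7 / 10)" using ln2_bounds by (intro mult_left_mono) auto
  then show "A * ln 2 \<le> 7 / 10 * A" by (simp only: mult.commute)
qed

lemma J_le: "real J \<le> A / 8192" "J < a"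
proof -
  have "16 * real J \<le> (real J)\<^sup>2" using J_ge_16 by (simp add: power2_eq_square)
  then show "real J \<le> A / 8192" using J_square_le by simp
  then show "J < a" using A_large by linarith
qed

lemma half_power_large: "4096 \<le> half_power"
proof -
  have "(2::real) powr 12 \<le> half_power" unfolding half_power_def using A_large by (intro powr_mono) auto
  then show ?thesis by simp
qed

lemma indep_weight_a: "indep_weight a = fact a * half_power ^ (a - 1)"
proof -
  have "real (a - 1) = A - 1" using A_large by (simp add: of_nat_diff)
  then show ?thesis
    unfolding indep_weight_def two_power_choose_2 half_power_def two_powr_power by (simp add: field_simps)
qed

lemma power_a: "z ^ a = z * z ^ (a - 1)" for z :: real
  using A_large by (cases a) auto

definition n0 :: nat where
  "n0 = (LEAST n. indep_weight a / (100 * A\<^sup>2) \<le> real n ^ (a - 1))"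

lemma n0_power_ge: "indep_weight a / (100 * A\<^sup>2) \<le> real n0 ^ (a - 1)"
  and n0_le: "real n0 \<le> A * half_power + 1"
proof -
  define m where "m = nat \<lceil>A * half_power\<rceil>"
  have nonneg: "0 \<le> A * half_power" using half_power_large by simp
  then have m: "A * half_power \<le> real m" "real m \<le> A * half_power + 1" unfolding m_def by linarith+
  have "fact a \<le> A ^ a" using ffact_le_power[of a a] by (simp add: ffact_eq_fact_div)
  then have "indep_weight a / (100 * A\<^sup>2) \<le> A ^ a * half_power ^ (a - 1) / (100 * A\<^sup>2)"
    unfolding indep_weight_a using half_power_large by (intro divide_right_mono mult_right_mono) auto
  also have "\<dots> = (A * half_power) ^ (a - 1) * (A / (100 * A\<^sup>2))" by (simp add: power_a power_mult_distrib)
  also have "\<dots> \<le> (A * half_power) ^ (a - 1) * 1"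
    by (intro mult_left_mono zero_le_power nonneg) (use A_large in \<open>simp add: power2_eq_square field_simps\<close>)
  also have "\<dots> \<le> real m ^ (a - 1)" using m nonneg by (auto intro!: power_mono)
  finally have admissible: "indep_weight a / (100 * A\<^sup>2) \<le> real m ^ (a - 1)" .
  then show "indep_weight a / (100 * A\<^sup>2) \<le> real n0 ^ (a - 1)" unfolding n0_def by (rule LeastI)
  have "n0 \<le> m" unfolding n0_def by (rule Least_le) (rule admissible)
  then show "real n0 \<le> A * half_power + 1" using m by linarith
qed

lemma n0_le_double: "real n0 \<le> 2 * A * half_power"
proof -
  have "1 * 1 \<le> A * half_power" using A_large half_power_large by (intro mult_mono) auto
  then show ?thesis using n0_le by simp
qed

lemma power_sixth_le_fact: "(A / 6) ^ (a - 1) \<le> fact a / (100 * A\<^sup>2)"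
proof -
  have e: "exp (1::real) \<le> 3" by (rule exp_le)
  have "2 powr (A - 1) = 2 ^ (a - 1)" using A_large by (simp add: powr_realpow[symmetric] of_nat_diff)
  then have "300 * A \<le> 2 ^ (a - 1)" using linear_le_exponential by simp
  then have "(A / 6) ^ (a - 1) * (300 * A) \<le> (A / 6) ^ (a - 1) * 2 ^ (a - 1)" by (intro mult_left_mono) auto
  also have "\<dots> = (A / 3) ^ (a - 1)" by (simp add: power_mult_distrib[symmetric])
  also have "\<dots> \<le> (A / exp 1) ^ (a - 1)" using e by (intro power_mono divide_left_mono) auto
  finally have "(A / 6) ^ (a - 1) * (300 * A) \<le> (A / exp 1) ^ (a - 1)" .
  then have "(A / 6) ^ (a - 1) * (300 * A) * (A / 3) \<le> (A / exp 1) ^ (a - 1) * (A / exp 1)"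
    using e by (intro mult_mono divide_left_mono) auto
  also have "\<dots> = (A / exp 1) ^ a" using power_a[of "A / exp 1"] by (simp only: mult.commute)
  also have "\<dots> \<le> fact a" by (rule power_div_exp_le_fact)
  finally have "(A / 6) ^ (a - 1) * (100 * A\<^sup>2) \<le> fact a" by (simp add: power2_eq_square mult_ac)
  then show ?thesis using A_pos by (simp add: pos_le_divide_eq)
qed

lemma n0_ge: "A * half_power / 6 \<le> real n0"
proof -
  have "(A / 6) ^ (a - 1) * half_power ^ (a - 1) \<le> fact a / (100 * A\<^sup>2) * half_power ^ (a - 1)"
    using half_power_large by (intro mult_right_mono power_sixth_le_fact) auto
  also have "\<dots> = indep_weight a / (100 * A\<^sup>2)" by (simp add: indep_weight_a)
  also have "\<dots> \<le> real n0 ^ (a - 1)" by (rule n0_power_ge)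
  finally have "(A * half_power / 6) ^ (a - 1) \<le> real n0 ^ (a - 1)"
    by (simp add: power_mult_distrib power_divide)
  moreover have "0 < a - 1" using A_large by linarith
  ultimately show ?thesis using half_power_large by (subst (asm) power_mono_iff) auto
qed

lemma n0_large: "600 * A \<le> real n0"
  and half_power_le_n0: "half_power \<le> real n0"
proof -
  have "A * 4096 \<le> A * half_power" using half_power_large by (intro mult_left_mono) auto
  then show "600 * A \<le> real n0" using n0_ge by simp
  have "131072 * half_power \<le> A * half_power" using A_large half_power_large by (intro mult_right_mono) auto
  then show "half_power \<le> real n0" using n0_ge half_power_large by linarith
qed

lemma n0_pos: "0 < real n0"
  using n0_large A_pos by linarith

lemma indep_mean_n0_pos: "0 < indep_mean n0 a"
  using n0_pos by (intro indep_mean_pos) simp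

lemma indep_mean_n0_ge: "real n0 / (100 * A\<^sup>2) \<le> indep_mean n0 a"
proof -
  have "real n0 * (indep_weight a / (100 * A\<^sup>2)) \<le> real n0 * real n0 ^ (a - 1)"
    by (intro mult_left_mono n0_power_ge) auto
  then have "real n0 / (100 * A\<^sup>2) * indep_weight a \<le> real n0 ^ a" by (simp add: power_a)
  then show ?thesis unfolding indep_mean_def by (simp add: pos_le_divide_eq)
qed

lemma n0_pred_power_ge: "real n0 ^ (a - 1) * (1 / 2) \<le> real (n0 - 1) ^ (a - 1)"
proof -
  have "1 - real (a - 1) * (1 / real n0) \<le> (1 - 1 / real n0) ^ (a - 1)"
    using Bernoulli_inequality[of "- (1 / real n0)" "a - 1"] n0_large A_large by (simp add: field_simps)
  moreover have "real (a - 1) * (1 / real n0) \<le> 1 / 2"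
    using n0_large A_large by (simp add: field_simps of_nat_diff)
  ultimately have "1 / 2 \<le> (1 - 1 / real n0) ^ (a - 1)" by linarith
  then have "real n0 ^ (a - 1) * (1 / 2) \<le> real n0 ^ (a - 1) * (1 - 1 / real n0) ^ (a - 1)"
    by (intro mult_left_mono) auto
  also have "\<dots> = (real n0 - 1) ^ (a - 1)"
    unfolding power_mult_distrib[symmetric] using n0_pos by (simp add: right_diff_distrib)
  also have "real n0 - 1 = real (n0 - 1)" using n0_pos by (simp add: of_nat_diff)
  finally show ?thesis .
qed

lemma indep_mean_n0_le: "indep_mean n0 a \<le> real n0 / (50 * A\<^sup>2)"
proof -
  have "n0 - 1 < n0" using n0_pos by simp
  then have "real (n0 - 1) ^ (a - 1) < indep_weight a / (100 * A\<^sup>2)"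
    using not_less_Least[of "n0 - 1" "\<lambda>n. indep_weight a / (100 * A\<^sup>2) \<le> real n ^ (a - 1)"]
    unfolding n0_def by auto
  then have "real n0 ^ (a - 1) \<le> 2 * (indep_weight a / (100 * A\<^sup>2))" using n0_pred_power_ge by linarith
  then have "real n0 * real n0 ^ (a - 1) \<le> real n0 * (2 * (indep_weight a / (100 * A\<^sup>2)))"
    by (intro mult_left_mono) auto
  then have "real n0 ^ a \<le> real n0 / (50 * A\<^sup>2) * indep_weight a" by (simp add: power_a field_simps)
  then show ?thesis unfolding indep_mean_def by (simp add: pos_divide_le_eq)
qed

definition "tilt_weight b j = gauss_weight b j * (ffact a j / A ^ j)"
definition "tilt_mass b = (\<Sum>j=1..J. tilt_weight b j)"
definition "tilt_moment b = (\<Sum>j=1..J. real j * tilt_weight b j)"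
definition "deficit b = tilt_moment b / tilt_mass b"
definition "class_scale b = real n0 / (A * tilt_mass b - tilt_moment b)"
definition "profile b j = class_scale b * tilt_weight b j"
definition "colors b = class_scale b * tilt_mass b"

definition "\<rho> b = A * 2 powr (A - 1 / 2 - b)"
definition "\<zeta> b = class_scale b * indep_weight a / \<rho> b ^ a"
definition "\<Lambda> b = 1 + ln (\<rho> b / n0)"

lemma ffact_ratio_le: "ffact a j / A ^ j \<le> 1"
  using ffact_le_power[of a j] A_pos by (simp add: divide_le_eq)

lemma ffact_ratio_ge: "998 / 1000 \<le> ffact a j / A ^ j" if "j \<le> J"
proof -
  have q: "0 \<le> real J / A" "real J / A \<le> 1" using J_le A_large by auto
  have "real j * real J \<le> (real J)\<^sup>2" using that by (simp add: power2_eq_square mult_right_mono)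
  then have "512 * (real j * real J) \<le> A" using J_square_le by linarith
  then have "998 / 1000 \<le> 1 - real j * (real J / A)" using A_large by (simp add: field_simps)
  also have "\<dots> \<le> (1 - real J / A) ^ j"
    using Bernoulli_inequality[of "- (real J / A)" j] q by simp
  also have "\<dots> = (\<Prod>i<j. 1 - real J / A)" by simp
  also have "\<dots> \<le> (\<Prod>i<j. (A - real i) / A)"
    using q that A_large by (intro prod_mono) (auto simp: diff_divide_distrib intro!: divide_right_mono)
  also have "\<dots> = ffact a j / A ^ j" by (simp add: ffact_def prod_dividef)
  finally show ?thesis .
qed

lemma tilt_weight_pos: "0 < tilt_weight b j" if "j \<le> a"
  unfolding tilt_weight_def using that A_pos
  by (intro mult_pos_pos divide_pos_pos ffact_pos gauss_weight_pos) auto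

lemma tilt_weight_nonneg: "0 \<le> tilt_weight b j"
  unfolding tilt_weight_def using gauss_weight_pos[of b j]
  by (intro mult_nonneg_nonneg divide_nonneg_nonneg) auto

lemma tilt_weight_le: "tilt_weight b j \<le> gauss_weight b j"
  unfolding tilt_weight_def
  using mult_left_mono[OF ffact_ratio_le, of "gauss_weight b j"] gauss_weight_pos[of b j] by simp

lemma tilt_weight_ge: "998 / 1000 * gauss_weight b j \<le> tilt_weight b j" if "j \<le> J"
  unfolding tilt_weight_def using ffact_ratio_ge[OF that] gauss_weight_pos[of b j]
  by (subst mult.commute) (intro mult_left_mono; simp)

lemma tilt_weight_0 [simp]: "tilt_weight b 0 = 1"
  by (simp add: tilt_weight_def gauss_weight_def)

lemma tilt_weight_1: "tilt_weight b 1 = 2 powr (b - 1 / 2)"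
  using A_pos by (simp add: tilt_weight_def gauss_weight_def ffact_def)

lemma tilt_mass_pos: "0 < tilt_mass b"
  unfolding tilt_mass_def using J_ge_16 J_le(2) by (intro sum_pos tilt_weight_pos) auto

lemma tilt_mass_bounds:
  assumes "0 \<le> b" "b \<le> 3"
  shows "7 / 10 \<le> tilt_mass b" "tilt_mass b \<le> 256"
proof -
  have "7 / 10 \<le> 2 powr (- 1 / 2 :: real)"
    using sqrt2_bounds by (simp add: powr_minus_divide powr_half_sqrt field_simps)
  also have "\<dots> \<le> 2 powr (b - 1 / 2)" using assms by (intro powr_mono) auto
  also have "\<dots> = tilt_weight b 1" by (simp only: tilt_weight_1)
  also have "\<dots> \<le> tilt_mass b"
    unfolding tilt_mass_def using J_ge_16 by (intro member_le_sum tilt_weight_nonneg) auto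
  finally show "7 / 10 \<le> tilt_mass b" .
  have "tilt_mass b \<le> (\<Sum>j=1..J. 256 * (1 / 2) ^ j)" unfolding tilt_mass_def
    by (intro sum_mono order_trans[OF tilt_weight_le gauss_weight_le_geometric] assms)
  also have "\<dots> = 256 * (\<Sum>j=1..J. (1 / 2) ^ j)" by (simp only: sum_distrib_left)
  also have "\<dots> \<le> 256" using sum_half_powers_le[of J] by simp
  finally show "tilt_mass b \<le> 256" .
qed

lemma tilt_moment_diff: "tilt_moment b - d * tilt_mass b = (\<Sum>j=1..J. (real j - d) * tilt_weight b j)"
  by (simp add: tilt_moment_def tilt_mass_def sum_distrib_left sum_subtractf[symmetric] left_diff_distrib)

lemma deficit_bounds: "1 \<le> deficit b" "deficit b \<le> J"
proof -
  have "0 \<le> tilt_moment b - 1 * tilt_mass b"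
    unfolding tilt_moment_diff by (intro sum_nonneg mult_nonneg_nonneg tilt_weight_nonneg) auto
  then show "1 \<le> deficit b" unfolding deficit_def using tilt_mass_pos[of b] by (simp add: field_simps)
  have "tilt_moment b - J * tilt_mass b \<le> 0"
    unfolding tilt_moment_diff by (intro sum_nonpos mult_nonpos_nonneg tilt_weight_nonneg) auto
  then show "deficit b \<le> J" unfolding deficit_def using tilt_mass_pos[of b] by (simp add: field_simps)
qed

lemma deficit_small: "deficit b \<le> A / 8192"
  using deficit_bounds(2)[of b] J_le(1) by linarith

lemma class_scale_denominator: "A * tilt_mass b - tilt_moment b = tilt_mass b * (A - deficit b)"
  unfolding deficit_def using tilt_mass_pos[of b] by (simp add: right_diff_distrib mult.commute)

lemma class_scale_denominator_pos: "0 < A * tilt_mass b - tilt_moment b"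
  unfolding class_scale_denominator using tilt_mass_pos[of b] deficit_small[of b] A_large
  by (intro mult_pos_pos) linarith+

lemma class_scale_pos: "0 < class_scale b"
  unfolding class_scale_def using class_scale_denominator_pos n0_pos by (intro divide_pos_pos) auto

lemma class_scale_bounds:
  assumes "0 \<le> b" "b \<le> 3"
  shows "real n0 / (256 * A) \<le> class_scale b" "class_scale b \<le> 2 * real n0 / A"
proof -
  have "tilt_mass b * (A - deficit b) \<le> 256 * A"
    using tilt_mass_bounds[OF assms] deficit_bounds(1)[of b] deficit_small[of b] A_large
    by (intro mult_mono) auto
  then show "real n0 / (256 * A) \<le> class_scale b" unfolding class_scale_def class_scale_denominator
    using class_scale_denominator_pos[of b] A_pos
    by (intro divide_left_mono) (auto simp: class_scale_denominator)
  have "A / 2 \<le> 7 / 10 * (A - deficit b)" using deficit_small[of b] A_large by simp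
  also have "\<dots> \<le> tilt_mass b * (A - deficit b)"
    using tilt_mass_bounds[OF assms] deficit_small[of b] A_large by (intro mult_right_mono) auto
  finally have "A / 2 \<le> A * tilt_mass b - tilt_moment b" by (simp add: class_scale_denominator)
  then have "class_scale b \<le> real n0 / (A / 2)"
    unfolding class_scale_def using A_pos class_scale_denominator_pos[of b] by (intro divide_left_mono) auto
  then show "class_scale b \<le> 2 * real n0 / A" by (simp add: mult.commute)
qed

lemma profile_nonneg: "0 \<le> profile b j"
  unfolding profile_def using class_scale_pos[of b] tilt_weight_nonneg[of b j] by simp

lemma sum_profile: "(\<Sum>j=1..J. profile b j) = colors b"
  by (simp add: profile_def colors_def tilt_mass_def sum_distrib_left)

lemma colors_pos: "0 < colors b"
  unfolding colors_def using class_scale_pos tilt_mass_pos by simp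

lemma colors_mult: "colors b * (A - deficit b) = real n0"
  unfolding colors_def class_scale_def mult.assoc class_scale_denominator[symmetric]
  using class_scale_denominator_pos[of b] by simp

lemma colors_le: "colors b \<le> 2 * real n0 / A"
proof -
  have "colors b * (A / 2) \<le> colors b * (A - deficit b)"
    using deficit_small[of b] A_large colors_pos[of b] by (intro mult_left_mono) auto
  then show ?thesis using colors_mult[of b] A_pos by (simp add: field_simps)
qed

lemma profile_mean_deficit: "(\<Sum>j=1..J. profile b j * (real j - deficit b)) = 0"
proof -
  have "(\<Sum>j=1..J. profile b j * (real j - deficit b)) = class_scale b * (tilt_moment b - deficit b * tilt_mass b)"
    unfolding tilt_moment_diff sum_distrib_left profile_def by (simp add: mult_ac)
  then show ?thesis using tilt_mass_pos[of b] by (simp add: deficit_def)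
qed

lemma profile_covers: "real n0 = (\<Sum>j=1..J. (A - real j) * profile b j)"
proof -
  have "(\<Sum>j=1..J. (A - real j) * profile b j)
      = (\<Sum>j=1..J. (A - deficit b) * profile b j) - (\<Sum>j=1..J. profile b j * (real j - deficit b))"
    by (simp add: sum_subtractf[symmetric] algebra_simps)
  also have "\<dots> = (A - deficit b) * colors b"
    by (simp only: profile_mean_deficit sum_profile sum_distrib_left[symmetric] diff_0_right)
  finally show ?thesis using colors_mult[of b] by (simp add: mult.commute)
qed

lemma \<rho>_pos: "0 < \<rho> b"
  using A_pos by (simp add: \<rho>_def)

lemma \<zeta>_pos: "0 < \<zeta> b"
  unfolding \<zeta>_def using class_scale_pos[of b] \<rho>_pos[of b] by simp

lemma indep_weight_a_split:
  assumes "j \<le> a"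
  shows "indep_weight a = indep_weight (a - j) * (ffact a j * 2 powr (real j * (2 * A - j - 1) / 2))"
proof -
  have "fact a = fact (a - j) * ffact a j" using assms by (simp add: ffact_eq_fact_div)
  moreover have "(2::real) ^ (a choose 2) = 2 ^ ((a - j) choose 2) * 2 powr (real j * (2 * A - j - 1) / 2)"
    unfolding two_power_choose_2 powr_add[symmetric] of_nat_diff[OF assms]
    by (intro arg_cong[where f = "\<lambda>z. 2 powr z"]) (simp add: field_simps)
  ultimately show ?thesis by (simp add: indep_weight_def)
qed

lemma profile_weight: "profile b j * indep_weight (a - j) = \<zeta> b * \<rho> b ^ (a - j)" if "j \<le> a"
proof -
  have "\<rho> b ^ a = \<rho> b ^ (a - j) * \<rho> b ^ j" using that by (simp add: power_add[symmetric])
  moreover have "\<rho> b ^ j = A ^ j * 2 powr ((A - 1 / 2 - b) * j)"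
    unfolding \<rho>_def power_mult_distrib two_powr_power ..
  moreover have "2 powr (real j * (2 * A - j - 1) / 2) = 2 powr ((A - 1 / 2 - b) * j) * gauss_weight b j"
    unfolding gauss_weight_def powr_add[symmetric]
    by (intro arg_cong[where f = "\<lambda>z. 2 powr z"]) (simp add: field_simps power2_eq_square)
  ultimately show ?thesis
    unfolding \<zeta>_def indep_weight_a_split[OF that] profile_def tilt_weight_def using \<rho>_pos[of b] A_pos
    by (simp add: field_simps)
qed

lemma ln_half_power: "ln half_power = A * ln 2 / 2"
  by (simp add: half_power_def ln_powr)

lemma ln_n0_bounds: "ln A + A * ln 2 / 2 - 21 / 10 \<le> ln n0" "ln n0 \<le> ln 2 + ln A + A * ln 2 / 2"
proof -
  have pos: "0 < half_power" using half_power_large by linarith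
  have "ln (6::real) \<le> ln (2 * 2 * 2)" by (subst ln_le_cancel_iff) auto
  also have "\<dots> = 3 * ln 2" by (simp only: ln_mult) simp
  finally have "ln (6::real) \<le> 21 / 10" using ln2_bounds by linarith
  moreover have "ln (A * half_power / 6) \<le> ln n0"
    using n0_ge n0_pos A_pos pos by (subst ln_le_cancel_iff) auto
  moreover have "ln (A * half_power / 6) = ln A + ln half_power - ln 6"
    using A_pos pos by (simp add: ln_mult ln_div)
  ultimately show "ln A + A * ln 2 / 2 - 21 / 10 \<le> ln n0" unfolding ln_half_power by linarith
  have "ln n0 \<le> ln (2 * A * half_power)" using n0_le_double n0_pos by (subst ln_le_cancel_iff) auto
  also have "\<dots> = ln 2 + ln A + ln half_power" using A_pos pos by (simp add: ln_mult)
  finally show "ln n0 \<le> ln 2 + ln A + A * ln 2 / 2" unfolding ln_half_power .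
qed

lemma \<Lambda>_bounds:
  assumes "0 \<le> b" "b \<le> 3"
  shows "A * ln 2 / 2 - 4 \<le> \<Lambda> b" "\<Lambda> b \<le> A * ln 2 / 2 + 3"
proof -
  have "ln (\<rho> b / n0) = ln A + (A - 1 / 2 - b) * ln 2 - ln n0"
    using n0_pos A_pos by (simp add: \<rho>_def ln_div ln_mult ln_powr)
  then have "\<Lambda> b = 1 + ln A + A * ln 2 - ln 2 / 2 - b * ln 2 - ln n0"
    unfolding \<Lambda>_def by (simp add: algebra_simps)
  moreover have "b * ln 2 \<le> 3 * ln 2" "0 \<le> b * ln 2" using assms by (auto intro: mult_right_mono)
  ultimately show "A * ln 2 / 2 - 4 \<le> \<Lambda> b" "\<Lambda> b \<le> A * ln 2 / 2 + 3"
    using ln_n0_bounds ln2_bounds by linarith+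
qed

lemma ln_class_scale_bounds:
  assumes "0 \<le> b" "b \<le> 3"
  shows "0 \<le> ln (class_scale b / indep_mean n0 a)" "ln (class_scale b / indep_mean n0 a) \<le> ln (200 * A)"
proof -
  have "indep_mean n0 a \<le> real n0 / (50 * A\<^sup>2)" by (rule indep_mean_n0_le)
  also have "\<dots> \<le> real n0 / (256 * A)"
    using A_large n0_pos by (intro divide_left_mono) (auto simp: power2_eq_square)
  also have "\<dots> \<le> class_scale b" by (rule class_scale_bounds[OF assms])
  finally have "1 \<le> class_scale b / indep_mean n0 a" using indep_mean_n0_pos by (simp add: pos_le_divide_eq)
  then show "0 \<le> ln (class_scale b / indep_mean n0 a)" by simp
  have "class_scale b / indep_mean n0 a \<le> (2 * real n0 / A) / (real n0 / (100 * A\<^sup>2))"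
    using class_scale_bounds[OF assms] indep_mean_n0_ge class_scale_pos[of b] n0_pos A_pos
    by (intro frac_le) auto
  also have "\<dots> = 200 * A" using n0_pos A_pos by (simp add: power2_eq_square)
  finally show "ln (class_scale b / indep_mean n0 a) \<le> ln (200 * A)"
    using class_scale_pos[of b] indep_mean_n0_pos A_pos by (subst ln_le_cancel_iff) auto
qed

lemma deficit_0_le: "deficit 0 \<le> 2"
proof -
  have "tilt_moment 0 - 2 * tilt_mass 0 = (\<Sum>j\<in>insert 1 {2..J}. (real j - 2) * tilt_weight 0 j)"
    unfolding tilt_moment_diff using J_ge_16 by (intro sum.cong) auto
  also have "\<dots> = - tilt_weight 0 1 + (\<Sum>j=2..J. (real j - 2) * tilt_weight 0 j)" by simp
  also have "(\<Sum>j=2..J. (real j - 2) * tilt_weight 0 j) \<le> (\<Sum>j=2..J. 1 / 2 * (1 / 2) ^ j)"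
  proof (intro sum_mono)
    fix j assume "j \<in> {2..J}"
    then have "(real j - 2) * tilt_weight 0 j \<le> (real j - 2) * gauss_weight 0 j"
      by (intro mult_left_mono tilt_weight_le) auto
    also have "\<dots> \<le> 1 / 2 * (1 / 2) ^ j" using \<open>j \<in> {2..J}\<close> by (intro gauss_weight_0_le) simp
    finally show "(real j - 2) * tilt_weight 0 j \<le> 1 / 2 * (1 / 2) ^ j" .
  qed
  also have "(\<Sum>j=2..J. 1 / 2 * (1 / 2) ^ j) \<le> (\<Sum>j=1..J. 1 / 2 * (1 / 2 :: real) ^ j)"
    by (intro sum_mono2) auto
  also have "\<dots> = 1 / 2 * (\<Sum>j=1..J. (1 / 2) ^ j)" by (simp only: sum_distrib_left)
  also have "\<dots> \<le> 1 / 2" using sum_half_powers_le[of J] by simp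
  also have "- tilt_weight 0 1 + 1 / 2 \<le> 0"
    unfolding tilt_weight_1 using sqrt2_bounds by (simp add: powr_minus_divide powr_half_sqrt field_simps)
  finally have "tilt_moment 0 \<le> 2 * tilt_mass 0" by simp
  then show ?thesis unfolding deficit_def using tilt_mass_pos[of 0] by (simp add: divide_le_eq)
qed

lemma deficit_3_ge: "29 / 10 \<le> deficit 3"
proof -
  let ?f = "\<lambda>j. (real j - 29 / 10) * tilt_weight 3 j"
  have "gauss_weight 3 1 = 4 * sqrt 2" "gauss_weight 3 2 = 16" "gauss_weight 3 3 = 16 * sqrt 2"
    "gauss_weight 3 4 = 16" "gauss_weight 3 5 = 4 * sqrt 2"
    using powr_add[of 2 2 "1 / 2 :: real"] powr_add[of 2 4 "1 / 2 :: real"]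
    by (simp_all add: gauss_weight_def powr_half_sqrt)
  then have "tilt_weight 3 1 \<le> 4 * sqrt 2" "tilt_weight 3 2 \<le> 16"
    "998 / 1000 * (16 * sqrt 2) \<le> tilt_weight 3 3" "998 / 1000 * 16 \<le> tilt_weight 3 4"
    "998 / 1000 * (4 * sqrt 2) \<le> tilt_weight 3 5"
    using tilt_weight_le[of 3 1] tilt_weight_le[of 3 2]
      tilt_weight_ge[of 3 3] tilt_weight_ge[of 4 3] tilt_weight_ge[of 5 3] J_ge_16 by simp_all
  then have "0 \<le> (\<Sum>j\<in>{1, 2, 3, 4, 5}. ?f j)" using sqrt2_bounds by simp
  also have "\<dots> \<le> (\<Sum>j\<in>{1, 2, 3, 4, 5}. ?f j) + (\<Sum>j=6..J. ?f j)"
    by (subst le_add_same_cancel1) (intro sum_nonneg mult_nonneg_nonneg tilt_weight_nonneg; simp)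
  also have "\<dots> = (\<Sum>j\<in>{1, 2, 3, 4, 5} \<union> {6..J}. ?f j)"
    by (intro sum.union_disjoint[symmetric]) auto
  also have "\<dots> = tilt_moment 3 - 29 / 10 * tilt_mass 3"
    unfolding tilt_moment_diff using J_ge_16 by (intro sum.cong) auto
  finally show ?thesis unfolding deficit_def using tilt_mass_pos[of 3] by (simp add: le_divide_eq)
qed

definition "tilt_excess b = \<Lambda> b * deficit b - (A - 1) - ln (class_scale b / indep_mean n0 a)"

lemma tilt_excess_0_le: "tilt_excess 0 \<le> 0"
proof -
  have "\<Lambda> 0 * deficit 0 \<le> (A * ln 2 / 2 + 3) * 2"
    using \<Lambda>_bounds[of 0] deficit_0_le deficit_bounds(1)[of 0] ln2_bounds A_large by (intro mult_mono) auto
  also have "\<dots> = A * ln 2 + 6" by simp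
  also have "A * ln 2 \<le> 7 / 10 * A" by (rule A_ln2_bounds)
  finally show ?thesis unfolding tilt_excess_def using ln_class_scale_bounds(1)[of 0] A_large by simp
qed

lemma tilt_excess_3_ge: "0 \<le> tilt_excess 3"
proof -
  have "A * (693 / 2000) - 4 \<le> \<Lambda> 3" using \<Lambda>_bounds(1)[of 3] A_ln2_bounds(1) by simp
  then have "(A * (693 / 2000) - 4) * (29 / 10) \<le> \<Lambda> 3 * deficit 3"
    using deficit_3_ge A_large by (intro mult_mono) auto
  then show ?thesis unfolding tilt_excess_def using ln_class_scale_bounds(2)[of 3] ln_200_le by simp
qed

lemma continuous_on_tilt_excess: "continuous_on UNIV tilt_excess"
proof -
  have nonzero: "tilt_mass b \<noteq> 0" "A * tilt_mass b - tilt_moment b \<noteq> 0" "\<rho> b / n0 \<noteq> 0"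
    "class_scale b / indep_mean n0 a \<noteq> 0" for b
    using tilt_mass_pos[of b] class_scale_denominator_pos[of b] \<rho>_pos[of b] class_scale_pos[of b] n0_pos indep_mean_n0_pos
    by auto
  have weight: "continuous_on UNIV (\<lambda>b. tilt_weight b j)" for j
    unfolding tilt_weight_def gauss_weight_def by (intro continuous_intros) auto
  have mass: "continuous_on UNIV tilt_mass" unfolding tilt_mass_def by (intro continuous_intros weight)
  have moment: "continuous_on UNIV tilt_moment" unfolding tilt_moment_def by (intro continuous_intros weight)
  have deficit: "continuous_on UNIV deficit"
    unfolding deficit_def by (intro continuous_intros mass moment ballI nonzero)
  have scale: "continuous_on UNIV class_scale"
    unfolding class_scale_def by (intro continuous_intros mass moment ballI nonzero)
  have "continuous_on UNIV \<rho>" unfolding \<rho>_def by (intro continuous_intros) auto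
  then have \<Lambda>: "continuous_on UNIV \<Lambda>"
    unfolding \<Lambda>_def using n0_pos
    by (intro continuous_on_add continuous_on_const continuous_on_ln continuous_on_divide ballI nonzero) auto
  show ?thesis
    unfolding tilt_excess_def using indep_mean_n0_pos
    by (intro continuous_on_diff continuous_on_mult continuous_on_ln continuous_on_divide continuous_on_const
        \<Lambda> deficit scale ballI nonzero) auto
qed

lemma exists_tilt:
  obtains b where "0 \<le> b" "b \<le> 3" "tilt_excess b = 0"
proof -
  have "\<exists>b\<ge>0. b \<le> 3 \<and> tilt_excess b = 0"
    by (rule IVT'[where f = tilt_excess, OF tilt_excess_0_le tilt_excess_3_ge])
      (auto intro: continuous_on_subset[OF continuous_on_tilt_excess])
  then show thesis using that by blast
qed

lemma half_power_ge_power: "A ^ 100 \<le> half_power"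
proof -
  have "A ^ 100 \<le> 2 powr (A / 8)" using power_100_le by (simp add: powr_minus_divide field_simps)
  also have "\<dots> \<le> half_power" unfolding half_power_def by (intro powr_mono) auto
  finally show ?thesis .
qed

lemma power_mult_powr_le: "A ^ i * 2 powr (- A / 8) \<le> 1 / A ^ (100 - i)" if "i \<le> 100"
proof -
  have "A ^ 100 = A ^ i * A ^ (100 - i)" using that by (simp add: power_add[symmetric])
  then show ?thesis using power_100_le A_pos by (simp add: field_simps)
qed

lemma power_mult_powr_quarter_le: "A ^ i * 2 powr (- A / 4) \<le> 1 / A ^ (100 - i)" if "i \<le> 100"
proof -
  have "2 powr (- A / 4) \<le> 2 powr (- A / 8)" by (intro powr_mono) auto
  then have "A ^ i * 2 powr (- A / 4) \<le> A ^ i * 2 powr (- A / 8)" by (intro mult_left_mono) auto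
  then show ?thesis using power_mult_powr_le[OF that] by linarith
qed

lemma inverse_power_le: "1 / A ^ j \<le> 1 / A ^ i" if "i \<le> j"
  using that A_large by (intro divide_left_mono power_increasing) auto

lemma power_le_n0: "A ^ i \<le> real n0 / A ^ (100 - i)" if "i \<le> 100"
proof -
  have "A ^ i * A ^ (100 - i) \<le> real n0"
    using that order_trans[OF half_power_ge_power half_power_le_n0]
    by (simp only: power_add[symmetric] le_add_diff_inverse)
  then show ?thesis using A_pos by (simp add: pos_le_divide_eq)
qed

lemma n0_div_power_le: "real n0 / A ^ j \<le> real n0 / A ^ i" if "i \<le> j"
  using that A_large by (intro divide_left_mono power_increasing) auto

lemma n0_div_power_le_div_100: "real n0 / A ^ j \<le> real n0 / A ^ i / 100" if "i < j"
proof -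
  have "real n0 / A ^ j \<le> real n0 / A ^ Suc i" using that by (intro n0_div_power_le) simp
  also have "\<dots> = real n0 / A ^ i / A" by simp
  also have "\<dots> \<le> real n0 / A ^ i / 100" using A_large by (intro divide_left_mono) auto
  finally show ?thesis .
qed

lemma ln_n0_Suc_le: "ln (real n0 + 1) \<le> A"
proof -
  have pos: "0 < half_power" using half_power_large by linarith
  have "1 * 1 \<le> A * half_power" using A_large half_power_large by (intro mult_mono) auto
  then have "ln (real n0 + 1) \<le> ln (3 * A * half_power)" using n0_le_double by (subst ln_le_cancel_iff) auto
  also have "\<dots> = ln 3 + ln A + A * ln 2 / 2" using A_pos pos by (simp add: ln_mult ln_half_power)
  also have "ln (3::real) \<le> 2" using ln_le_minus_one[of "3::real"] by simp
  finally show ?thesis using ln_le A_ln2_bounds(2) A_large by linarith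
qed

lemma power_le_sqrt_n0: "A ^ i \<le> sqrt n0" if "i \<le> 50"
proof -
  have "A ^ i \<le> A ^ 50" using that A_large by (intro power_increasing) auto
  also have "A ^ 50 \<le> sqrt n0"
    using order_trans[OF half_power_ge_power half_power_le_n0]
    by (intro real_le_rsqrt) (simp only: power_mult[symmetric], simp)
  finally show ?thesis .
qed

lemma sqrt_n0_le: "sqrt n0 \<le> real n0 / A ^ i" if "i \<le> 50"
proof -
  have "sqrt n0 * A ^ i \<le> sqrt n0 * sqrt n0" using power_le_sqrt_n0[OF that] by (intro mult_left_mono) auto
  then show ?thesis using A_pos by (simp add: pos_le_divide_eq)
qed

end

locale tilted = large_class_size +
  fixes b :: real
  assumes b_bounds: "0 \<le> b" "b \<le> 3" and balanced: "tilt_excess b = 0"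
begin

lemma \<Lambda>_deficit: "\<Lambda> b * deficit b = A - 1 + ln (class_scale b / indep_mean n0 a)"
  using balanced by (simp add: tilt_excess_def)

lemma \<Lambda>_pos: "0 < \<Lambda> b"
  using \<Lambda>_bounds(1)[OF b_bounds] A_ln2_bounds A_large by linarith

lemma ln_\<zeta>: "1 - ln (\<zeta> b) = (A - deficit b) * \<Lambda> b"
proof -
  have "ln (\<zeta> b) = ln (class_scale b) + ln (indep_weight a) - A * ln (\<rho> b)"
    unfolding \<zeta>_def using class_scale_pos[of b] \<rho>_pos[of b] by (simp add: ln_div ln_mult ln_realpow)
  moreover have "ln (indep_mean n0 a) = A * ln n0 - ln (indep_weight a)"
    unfolding indep_mean_def using n0_pos by (simp add: ln_div ln_realpow)
  moreover have "ln (class_scale b / indep_mean n0 a) = ln (class_scale b) - ln (indep_mean n0 a)"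
    using class_scale_pos[of b] indep_mean_n0_pos by (simp add: ln_div)
  moreover have "A * \<Lambda> b = A + A * ln (\<rho> b) - A * ln n0"
    unfolding \<Lambda>_def using \<rho>_pos[of b] n0_pos by (simp add: ln_div algebra_simps)
  ultimately show ?thesis using \<Lambda>_deficit by (simp add: algebra_simps)
qed

lemma slack_large_classes: "2 * (10 * ln A) / (A - J) \<le> 1 / 200"
  and slack_tilt: "\<Lambda> b * (deficit b - 1) / (A - 1) + 2 * (10 * ln A) / (A - J) \<le> 7 / 10"
proof -
  have "2 * (10 * ln A) \<le> 1 / 200 * (A - J)" using ln_le J_le(1) A_large by simp
  then show slack: "2 * (10 * ln A) / (A - J) \<le> 1 / 200" using J_le A_large by (simp add: pos_divide_le_eq)
  have "\<Lambda> b * (deficit b - 1) = A - 1 + ln (class_scale b / indep_mean n0 a) - \<Lambda> b"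
    using \<Lambda>_deficit by (simp add: algebra_simps)
  also have "\<dots> \<le> A - 1 + ln (200 * A) - (A * ln 2 / 2 - 4)"
    using ln_class_scale_bounds(2)[OF b_bounds] \<Lambda>_bounds(1)[OF b_bounds] by linarith
  also have "\<dots> \<le> 69 / 100 * (A - 1)" using ln_200_le A_ln2_bounds(1) A_large by argo
  finally have "\<Lambda> b * (deficit b - 1) / (A - 1) \<le> 69 / 100" using A_large by (simp add: pos_divide_le_eq)
  then show "\<Lambda> b * (deficit b - 1) / (A - 1) + 2 * (10 * ln A) / (A - J) \<le> 7 / 10" using slack by linarith
qed

lemma deficit_ln2_ge: "2 - 3 / 10000 \<le> deficit b * ln 2"
proof -
  define L where "L = A * ln 2"
  have L: "693 / 1000 * A \<le> L" "\<Lambda> b \<le> L / 2 + 3" "(A - 1) * ln 2 = L - ln 2"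
    using A_ln2_bounds(1) \<Lambda>_bounds(2)[OF b_bounds] by (simp_all add: L_def left_diff_distrib)
  have "A - 1 \<le> \<Lambda> b * deficit b" using \<Lambda>_deficit ln_class_scale_bounds(1)[OF b_bounds] by simp
  also have "\<dots> \<le> (L / 2 + 3) * deficit b" using L(2) deficit_bounds(1)[of b] by (intro mult_right_mono) auto
  finally have "(A - 1) * ln 2 \<le> (L / 2 + 3) * deficit b * ln 2" by (rule mult_right_mono) simp
  then have "L - ln 2 \<le> (L / 2 + 3) * (deficit b * ln 2)" by (simp only: L(3) mult.assoc)
  moreover have "(L / 2 + 3) * (2 - 3 / 10000) = 19997 / 20000 * L + 59991 / 10000" by (simp add: field_simps)
  ultimately have "(L / 2 + 3) * (2 - 3 / 10000) \<le> (L / 2 + 3) * (deficit b * ln 2)"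
    using L(1) A_large ln2_bounds by linarith
  moreover have "0 < L / 2 + 3" using L(1) A_large by linarith
  ultimately show ?thesis by (simp only: mult_le_cancel_left_pos)
qed

lemma tilt_exponent_le:
  assumes j: "j \<in> {1..J}"
  shows "2 * (\<Lambda> b * (real j - deficit b) / (A - real j)) \<le> 3 / 1000 + (real j * ln 2 - (2 - 3 / 10000))"
proof -
  let ?N = "(real j - deficit b) * (2 * \<Lambda> b - A * ln 2 + real j * ln 2)"
  have size: "A * (8191 / 8192) \<le> A - real j" using j J_le(1) by simp
  then have pos: "0 < A - real j" using A_large by linarith
  have "\<bar>real j - deficit b\<bar> \<le> real J" using j deficit_bounds[of b] by auto
  moreover have "\<bar>2 * \<Lambda> b - A * ln 2 + real j * ln 2\<bar> \<le> 8 + real J"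
  proof -
    have "real j * ln 2 \<le> real J * 1" by (rule mult_mono) (use j ln2_bounds in auto)
    moreover have "0 \<le> real j * ln 2" by simp
    ultimately show ?thesis using \<Lambda>_bounds[OF b_bounds] unfolding abs_le_iff by (intro conjI; linarith)
  qed
  ultimately have "\<bar>?N\<bar> \<le> real J * (8 + real J)" unfolding abs_mult by (intro mult_mono) auto
  also have "real J * (8 + real J) \<le> 3 / 2 * (real J)\<^sup>2"
    using J_ge_16 mult_left_mono[of 16 "real J" "real J"] by (simp add: power2_eq_square algebra_simps)
  also have "\<dots> \<le> 3 / 2 * (A / 512)" using J_square_le by simp
  also have "\<dots> \<le> 3 / 1000 * (A - real j)" using size A_large by simp
  finally have "?N / (A - real j) \<le> 3 / 1000" using pos by (simp add: pos_divide_le_eq)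
  moreover have "2 * (\<Lambda> b * (real j - deficit b) / (A - real j)) - ln 2 * (real j - deficit b) = ?N / (A - real j)"
    using pos by (simp add: field_simps)
  moreover have "ln 2 * (real j - deficit b) = real j * ln 2 - deficit b * ln 2"
    by (simp add: right_diff_distrib mult.commute)
  ultimately show ?thesis using deficit_ln2_ge by linarith
qed

lemma exp_tilt_constant_le: "1283 / 100 * exp (3 / 1000 - (2 - 3 / 10000)) \<le> 9 / 5 * (8191 / 8192 :: real)"
proof -
  have "exp (3 / 1000 - (2 - 3 / 10000)) = exp (33 / 10000) / (exp 1 :: real)\<^sup>2"
    by (simp add: exp_diff[symmetric] exp_double[symmetric])
  also have "\<dots> \<le> (10034 / 10000) / (27166 / 10000)\<^sup>2"
  proof (intro frac_le power_mono exp_1_ge)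
    show "exp (33 / 10000 :: real) \<le> 10034 / 10000"
      using exp_bound[of "33 / 10000"] by (simp add: power2_eq_square)
  qed auto
  finally show ?thesis by (simp add: power2_eq_square)
qed

lemma sum_tilt_weight_two_powr_le: "(\<Sum>j=1..J. tilt_weight b j * 2 powr j) \<le> 1283 / 100 * tilt_mass b"
proof -
  have "(\<Sum>j=1..J. tilt_weight b j * 2 powr j) \<le> (\<Sum>j=1..J. gauss_weight b j * 2 powr j)"
    by (intro sum_mono mult_right_mono tilt_weight_le) auto
  also have "\<dots> \<le> 1283 / 100 * (998 / 1000 * (\<Sum>j=1..J. gauss_weight b j))"
    using J_ge_16 by (intro sum_gauss_weight_two_powr_le b_bounds) simp
  also have "998 / 1000 * (\<Sum>j=1..J. gauss_weight b j) \<le> tilt_mass b"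
    unfolding tilt_mass_def sum_distrib_left by (intro sum_mono tilt_weight_ge) auto
  finally show ?thesis by simp
qed

lemma gibbs_weight_le:
  "(\<Sum>j=1..J. (A - real j) * profile b j * exp (2 * (\<Lambda> b * (real j - deficit b) / (A - real j)))) \<le> 9 / 5 * real n0"
proof -
  let ?tilt = "\<lambda>j. exp (2 * (\<Lambda> b * (real j - deficit b) / (A - real j)))"
  define E :: real where "E = exp (3 / 1000 - (2 - 3 / 10000))"
  have "(A - real j) * profile b j * ?tilt j \<le> A * class_scale b * E * (tilt_weight b j * 2 powr j)"
    if j: "j \<in> {1..J}" for j
  proof -
    have "?tilt j \<le> exp (3 / 1000 - (2 - 3 / 10000) + j * ln 2)" using tilt_exponent_le[OF j] by simp
    also have "\<dots> = E * 2 powr j" unfolding E_def by (simp only: exp_add powr_def) simp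
    finally have "(A - real j) * profile b j * ?tilt j \<le> A * profile b j * (E * 2 powr j)"
      using profile_nonneg[of b j] by (intro mult_mono mult_nonneg_nonneg) auto
    then show ?thesis by (simp add: profile_def mult_ac)
  qed
  then have "(\<Sum>j=1..J. (A - real j) * profile b j * ?tilt j)
      \<le> (\<Sum>j=1..J. A * class_scale b * E * (tilt_weight b j * 2 powr j))"
    by (intro sum_mono)
  also have "\<dots> = A * class_scale b * E * (\<Sum>j=1..J. tilt_weight b j * 2 powr j)"
    by (simp only: sum_distrib_left)
  also have "\<dots> \<le> A * class_scale b * E * (1283 / 100 * tilt_mass b)"
    using sum_tilt_weight_two_powr_le class_scale_pos[of b]
    by (intro mult_left_mono mult_nonneg_nonneg) (auto simp: E_def)
  also have "\<dots> = A * colors b * (1283 / 100 * E)" by (simp add: colors_def)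
  also have "\<dots> \<le> A * colors b * (9 / 5 * (8191 / 8192))"
    using exp_tilt_constant_le colors_pos[of b] by (intro mult_left_mono) (auto simp: E_def)
  also have "\<dots> = 9 / 5 * (colors b * (A * (8191 / 8192)))" by simp
  also have "\<dots> \<le> 9 / 5 * (colors b * (A - deficit b))"
    using deficit_small[of b] colors_pos[of b] by (intro mult_left_mono) auto
  finally show ?thesis by (simp only: colors_mult)
qed

sublocale critical: critical_profile "{1..J}" "profile b" a n0 "real J" "\<Lambda> b" "deficit b" "10 * ln A" "\<rho> b" "\<zeta> b"
proof
  show "1 \<le> real J" using J_ge_16 by simp
  show "real J < real a" using J_le(2) by simp
  show "0 < n0" using n0_pos by simp
  show "0 \<le> \<Lambda> b" using \<Lambda>_pos by simp
  show "deficit b \<le> A" using deficit_small[of b] A_pos by linarith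
  show "0 \<le> 10 * ln A" using ln_ge_30 by simp
  show "profile b j * indep_weight (a - j) = \<zeta> b * \<rho> b ^ (a - j)" if "j \<in> {1..J}" for j
    using that J_le(2) by (intro profile_weight) auto
qed (fact profile_covers profile_mean_deficit deficit_bounds slack_tilt slack_large_classes gibbs_weight_le
  \<rho>_pos \<zeta>_pos \<Lambda>_def ln_\<zeta> | simp)+

definition "class_count j = nat \<lfloor>profile b j\<rfloor>"

lemma class_count_bounds: "real (class_count j) \<le> profile b j" "profile b j - 1 \<le> real (class_count j)"
  using profile_nonneg[of b j] by (auto simp: class_count_def)

lemma inj_on_sizes: "inj_on (\<lambda>j. a - j) {1..J}"
  using J_le(2) by (auto simp: inj_on_def)

lemma colors_le_n0: "colors b \<le> real n0"
proof -
  have "2 * real n0 / A \<le> real n0" using A_large n0_pos by (simp add: divide_le_eq)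
  then show ?thesis using colors_le[of b] by linarith
qed

lemma n0_Suc_le_exp: "real n0 + 1 \<le> exp A"
proof -
  have "real n0 + 1 = exp (ln (real n0 + 1))" by (simp add: add_pos_nonneg)
  also have "\<dots> \<le> exp A" by (simp only: exp_le_cancel_iff ln_n0_Suc_le)
  finally show ?thesis .
qed

lemma J_le_A: "real J \<le> A"
  using J_le(2) by simp

text \<open>The parameters \<open>M\<close>, \<open>\<beta>\<close> and \<open>\<epsilon>\<close> of the second moment estimate
  \<open>colorable_prob_second_moment_profile\<close>.\<close>

definition "M = real n0 / A ^ 10"
definition "\<beta> = A ^ 5 / M\<^sup>2"
definition "\<epsilon> = A * sqrt (2 * A ^ 3 * 2 powr ((real J + 1) / 2 - A / 4))"

lemma M_pos: "0 < M"
  using n0_pos A_pos by (simp add: M_def)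

lemma large_overlap_decay: "2 * A ^ 3 * 2 powr ((real J + 1) / 2 - A / 4) \<le> 1 / A ^ 96"
proof -
  have "2 * A ^ 3 * 2 powr ((real J + 1) / 2 - A / 4) \<le> A ^ 4 * 2 powr (- A / 8)"
  proof (intro mult_mono powr_mono)
    have "2 * A ^ 3 \<le> A * A ^ 3" using A_large by (intro mult_right_mono) auto
    then show "2 * A ^ 3 \<le> A ^ 4" by (simp add: power_Suc[symmetric])
    show "(real J + 1) / 2 - A / 4 \<le> - A / 8" using J_le(1) A_large by argo
  qed auto
  also have "\<dots> \<le> 1 / A ^ (100 - 4)" by (rule power_mult_powr_le) simp
  finally show ?thesis by simp
qed

lemma \<epsilon>_nonneg: "0 \<le> \<epsilon>"
  by (simp add: \<epsilon>_def)

lemma sqrt_\<epsilon>_le: "sqrt \<epsilon> \<le> 1 / A ^ 23"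
proof (rule real_le_lsqrt)
  have "\<epsilon> \<le> A * sqrt (1 / A ^ 96)" unfolding \<epsilon>_def using large_overlap_decay by (intro mult_left_mono) auto
  also have "sqrt (1 / A ^ 96) = 1 / A ^ 48"
    using A_pos by (intro real_sqrt_unique) (auto simp: power_divide power_mult[symmetric])
  also have "A * (1 / A ^ 48) = 1 / A ^ 47" using A_pos power_Suc[of A 47] by simp
  also have "\<dots> \<le> 1 / A ^ 46" by (rule inverse_power_le) simp
  finally show "\<epsilon> \<le> (1 / A ^ 23)\<^sup>2" by (simp add: power_divide power_mult[symmetric])
qed (use A_pos in auto)

lemma exp_slack: "exp (- (10 * ln A)) = 1 / A ^ 10"
proof -
  have "exp (10 * ln A) = exp (ln A) ^ 10" using exp_of_nat_mult[of 10 "ln A"] by simp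
  then show ?thesis using A_pos by (simp add: exp_minus inverse_eq_divide)
qed

lemma profile_cost_le: "critical.profile_cost \<le> exp (2 * M + (real J + 1) * (1 + A))"
proof -
  have "2 * exp (- (10 * ln A)) * (\<Sum>j=1..J. profile b j) \<le> 2 * M"
    unfolding exp_slack sum_profile M_def using colors_le_n0 A_pos by (simp add: divide_right_mono)
  moreover have "(\<Prod>j=1..J. exp 1 * (profile b j + 1)) \<le> (\<Prod>j=1..J. exp (1 + A))"
  proof (intro prod_mono conjI)
    fix j assume j: "j \<in> {1..J}"
    have "profile b j \<le> colors b"
      unfolding sum_profile[symmetric] using j profile_nonneg by (intro member_le_sum) auto
    then have "profile b j + 1 \<le> exp A" using colors_le_n0 n0_Suc_le_exp by linarith
    then show "exp 1 * (profile b j + 1) \<le> exp (1 + A)" unfolding exp_add by (intro mult_left_mono) auto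
    show "0 \<le> exp 1 * (profile b j + 1)" using profile_nonneg[of b j] by simp
  qed
  moreover have "exp 1 * (real n0 + 1) \<le> exp (1 + A)"
    unfolding exp_add using n0_Suc_le_exp by (intro mult_left_mono) auto
  ultimately have "critical.profile_cost \<le> exp (2 * M) * (\<Prod>j=1..J. exp (1 + A)) * exp (1 + A)"
    unfolding critical.profile_cost_def using profile_nonneg
    by (intro mult_mono mult_nonneg_nonneg prod_nonneg) (auto intro!: add_nonneg_nonneg)
  also have "(\<Prod>j=1..J. exp (1 + A)) = exp (real J * (1 + A))" by (simp add: exp_of_nat_mult)
  finally show ?thesis by (simp add: exp_add[symmetric] algebra_simps)
qed

lemma profile_cost_nonneg: "0 \<le> critical.profile_cost"
  unfolding critical.profile_cost_def using profile_nonneg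
  by (intro mult_nonneg_nonneg prod_nonneg) (auto intro!: add_nonneg_nonneg)

end

section \<open>Few colors suffice for \<open>n0\<close> vertices\<close>

locale rounded_profile = tilted +
  fixes k :: nat and u :: "nat \<Rightarrow> nat"
  assumes size_in: "i < k \<Longrightarrow> u i \<in> (\<lambda>j. a - j) ` {1..J}"
    and type_count_size: "j \<in> {1..J} \<Longrightarrow> type_count u {..<k} (a - j) = class_count j"
begin

lemma size_bounds: "i < k \<Longrightarrow> a - J \<le> u i \<and> u i < a"
  using size_in[of i] J_le(2) by auto

lemma card_sizes_le: "card (u ` {..<k}) \<le> J"
proof -
  have "card (u ` {..<k}) \<le> card ((\<lambda>j. a - j) ` {1..J})" using size_in by (intro card_mono) auto
  then show ?thesis using card_image_le[of "{1..J}" "\<lambda>j. a - j"] by simp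
qed

lemma sum_by_deficit:
  fixes g :: "nat \<Rightarrow> nat"
  assumes I: "I \<subseteq> {..<k}"
  shows "(\<Sum>i\<in>I. g (u i)) = (\<Sum>j=1..J. type_count u I (a - j) * g (a - j))"
proof -
  have "(\<Sum>i\<in>I. g (u i)) = (\<Sum>s\<in>(\<lambda>j. a - j) ` {1..J}. \<Sum>i\<in>{i \<in> I. u i = s}. g (u i))"
    using I size_in finite_subset[OF I] by (intro sum.group[symmetric]) auto
  also have "\<dots> = (\<Sum>j=1..J. type_count u I (a - j) * g (a - j))"
    unfolding sum.reindex[OF inj_on_sizes] o_def type_count_def by (intro sum.cong refl) simp
  finally show ?thesis .
qed

lemma prod_by_deficit:
  fixes g :: "nat \<Rightarrow> real"
  assumes I: "I \<subseteq> {..<k}"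
  shows "(\<Prod>i\<in>I. g (u i)) = (\<Prod>j=1..J. g (a - j) ^ type_count u I (a - j))"
proof -
  have "(\<Prod>i\<in>I. g (u i)) = (\<Prod>s\<in>(\<lambda>j. a - j) ` {1..J}. \<Prod>i\<in>{i \<in> I. u i = s}. g (u i))"
    using I size_in finite_subset[OF I] by (intro prod.group[symmetric]) auto
  also have "\<dots> = (\<Prod>j=1..J. g (a - j) ^ type_count u I (a - j))"
    unfolding prod.reindex[OF inj_on_sizes] o_def type_count_def by (intro prod.cong refl) simp
  finally show ?thesis .
qed

lemma k_le_colors: "real k \<le> colors b"
proof -
  have "k = (\<Sum>j=1..J. class_count j)"
    using sum_by_deficit[of "{..<k}" "\<lambda>_. 1"] by (simp add: type_count_size)
  then have "real k = (\<Sum>j=1..J. real (class_count j))" by simp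
  also have "\<dots> \<le> colors b" unfolding sum_profile[symmetric] by (intro sum_mono class_count_bounds)
  finally show ?thesis .
qed

lemma k_le_n0: "real k \<le> real n0"
  using k_le_colors colors_le_n0 by linarith

lemma n0_minus_sizes: "real n0 - real (\<Sum>i<k. u i) = (\<Sum>j=1..J. (A - real j) * (profile b j - class_count j))"
proof -
  have "(\<Sum>i<k. u i) = (\<Sum>j=1..J. class_count j * (a - j))"
    using sum_by_deficit[of "{..<k}" "\<lambda>s. s"] by (simp add: type_count_size)
  then have "real (\<Sum>i<k. u i) = (\<Sum>j=1..J. real (class_count j) * (A - j))"
    using J_le(2) by (simp add: of_nat_diff)
  then show ?thesis by (simp add: profile_covers[of b] sum_subtractf[symmetric] algebra_simps)
qed

lemma sum_sizes_le: "(\<Sum>i<k. u i) \<le> n0"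
proof -
  have "0 \<le> real n0 - real (\<Sum>i<k. u i)"
    unfolding n0_minus_sizes using J_le(2) class_count_bounds by (intro sum_nonneg mult_nonneg_nonneg) auto
  then show ?thesis by linarith
qed

definition "leftover = n0 - (\<Sum>i<k. u i)"

lemma leftover_le: "real leftover \<le> real J * A"
proof -
  have "real leftover = (\<Sum>j=1..J. (A - real j) * (profile b j - class_count j))"
    using sum_sizes_le n0_minus_sizes by (simp add: leftover_def of_nat_diff)
  also have "\<dots> \<le> (\<Sum>j=1..J. A * 1)"
    using J_le(2) class_count_bounds by (intro sum_mono mult_mono) (auto simp: algebra_simps)
  finally show ?thesis by simp
qed

lemma type_choices_arrangements_eq:
  assumes I: "I \<subseteq> {..<k}"
  shows "type_choices k u I * type_arrangements k u I
       = (\<Prod>j=1..J. real (class_count j choose type_count u I (a - j)) * ffact (class_count j) (type_count u I (a - j)))"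
proof -
  let ?F = "\<lambda>s. real (type_count u {..<k} s choose type_count u I s) * ffact (type_count u {..<k} s) (type_count u I s)"
  have "type_choices k u I * type_arrangements k u I = (\<Prod>s\<in>u ` {..<k}. ?F s)"
    by (simp add: type_choices_def type_arrangements_def prod.distrib)
  also have "\<dots> = (\<Prod>s\<in>(\<lambda>j. a - j) ` {1..J}. ?F s)"
  proof (rule prod.mono_neutral_left)
    show "\<forall>s\<in>(\<lambda>j. a - j) ` {1..J} - u ` {..<k}. ?F s = 1"
    proof
      fix s assume "s \<in> (\<lambda>j. a - j) ` {1..J} - u ` {..<k}"
      then have "{i \<in> {..<k}. u i = s} = {}" "{i \<in> I. u i = s} = {}" using I by blast+
      then show "?F s = 1" unfolding type_count_def by (simp only: card.empty) simp
    qed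
  qed (use size_in in auto)
  also have "\<dots> = (\<Prod>j=1..J. real (class_count j choose type_count u I (a - j))
      * ffact (class_count j) (type_count u I (a - j)))"
    unfolding prod.reindex[OF inj_on_sizes] o_def by (intro prod.cong refl) (simp add: type_count_size)
  finally show ?thesis .
qed

lemma subprofile_cost_le:
  assumes I: "I \<subseteq> {..<k}"
  shows "type_choices k u I * type_arrangements k u I * placement_cost n0 u I \<le> critical.profile_cost"
proof -
  let ?q = "\<lambda>j. type_count u I (a - j)"
  have sum_sizes: "(\<Sum>i\<in>I. u i) = (\<Sum>j=1..J. (a - j) * ?q j)"
    using sum_by_deficit[OF I, of "\<lambda>s. s"] by (simp add: mult.commute)
  have "(\<Sum>i\<in>I. u i) \<le> (\<Sum>i<k. u i)" using I by (intro sum_mono2) auto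
  then have pos: "0 < ffact n0 (\<Sum>i\<in>I. u i)" using sum_sizes_le by (intro ffact_pos) simp
  have "type_choices k u I * type_arrangements k u I * (\<Prod>i\<in>I. indep_weight (u i))
      = (\<Prod>j=1..J. real (class_count j choose ?q j) * ffact (class_count j) (?q j) * indep_weight (a - j) ^ ?q j)"
    by (simp only: type_choices_arrangements_eq[OF I] prod_by_deficit[OF I] prod.distrib)
  also have "\<dots> \<le> critical.profile_cost * ffact n0 (\<Sum>j=1..J. (a - j) * ?q j)"
  proof (rule critical.prod_class_choices_le[OF class_count_bounds(1)])
    show "?q j \<le> class_count j" if "j \<in> {1..J}" for j
      unfolding type_count_size[OF that, symmetric] using I by (intro type_count_mono) auto
  qed
  finally show ?thesis
    unfolding placement_cost_def sum_sizes[symmetric] using pos by (simp add: pos_divide_le_eq)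
qed

lemma sizes_pair_weight_le:
  assumes "i < k" "j < k"
  shows "pair_weight (u i) (u j) (J ^ 4) (1 / M) \<le> \<beta>"
  unfolding \<beta>_def
proof (rule pair_weight_le)
  show "u i \<le> a" "u j \<le> a" using size_bounds assms by (auto simp: less_imp_le)
  show "2 powr (A / 2) \<le> A ^ 10 * M" using half_power_le_n0 A_pos by (simp add: M_def half_power_def)
  have "A ^ 12 * 2 powr (- A / 4) \<le> 1 / A ^ (100 - 12)" by (rule power_mult_powr_quarter_le) simp
  also have "\<dots> \<le> 1 / A ^ 0" by (rule inverse_power_le) simp
  finally show "A ^ 12 * 2 powr (- A / 4) \<le> 1" by simp
  show "2 * J ^ 4 \<le> a" by (simp add: a_eq)
qed (rule M_pos)

lemma sizes_overlap_ratio_le: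
  assumes "i < k" "j < k"
  shows "(\<Sum>t\<in>{J ^ 4..u i}. real (u i choose t) * overlap_ratio n0 (u i) (u j) t) \<le> of_bool (u i = u j) + \<epsilon>"
  unfolding \<epsilon>_def
proof (rule sum_overlap_ratio_le)
  show "real n0 \<le> 2 * A * 2 powr (A / 2)" using n0_le_double by (simp add: half_power_def)
  have "2 * A ^ 3 * 2 powr ((real J + 1) / 2 - A / 4) \<le> 1 / A ^ 96" by (rule large_overlap_decay)
  also have "\<dots> \<le> 1 / A ^ 0" by (rule inverse_power_le) simp
  finally show "2 * A ^ 3 * 2 powr ((real J + 1) / 2 - A / 4) \<le> 1" by simp
qed (use size_bounds assms J_le(2) in \<open>auto simp: a_eq\<close>)

lemma exponent_le:
  "M + real k ^ 2 * \<beta> + real J * (2 * real k * sqrt \<epsilon> + A) + (2 * M + (real J + 1) * (1 + A)) \<le> 4 * M"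
proof -
  have small: "real n0 / A ^ i \<le> M / 100" if "10 < i" for i
    using n0_div_power_le_div_100[OF that] by (simp add: M_def)
  have "real k ^ 2 * \<beta> \<le> (real n0)\<^sup>2 * \<beta>"
    using k_le_n0 by (intro mult_right_mono power_mono) (auto simp: \<beta>_def)
  also have "\<dots> = A ^ 25"
    using A_pos n0_pos by (simp add: \<beta>_def M_def power_divide power_mult[symmetric] power_add[symmetric])
  also have "\<dots> \<le> M / 100" using order_trans[OF power_le_n0 small, of 25] by simp
  finally have pairs: "real k ^ 2 * \<beta> \<le> M / 100" .
  have "real J * (2 * real k * sqrt \<epsilon>) \<le> A * (2 * real n0 * (1 / A ^ 23))"
    using J_le_A k_le_n0 \<epsilon>_nonneg sqrt_\<epsilon>_le by (intro mult_mono mult_nonneg_nonneg) auto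
  also have "\<dots> = 2 * (real n0 / A ^ 22)" using A_pos power_Suc[of A 22] by simp
  finally have overlaps: "real J * (2 * real k * sqrt \<epsilon>) \<le> 2 * (M / 100)" using small[of 22] by linarith
  have "real J * A \<le> A\<^sup>2" "1 * A \<le> A\<^sup>2"
    unfolding power2_eq_square using J_le_A A_large by (intro mult_right_mono; simp)+
  moreover have "real J * A + (real J + 1) * (1 + A) = 2 * (real J * A) + real J + A + 1"
    by (simp add: algebra_simps)
  ultimately have "real J * A + (real J + 1) * (1 + A) \<le> 6 * A\<^sup>2" using J_le_A A_large by linarith
  then have "real J * A + (real J + 1) * (1 + A) \<le> 6 * (M / 100)" using power_le_n0[of 2] small[of 98] by simp
  then show ?thesis using pairs overlaps M_pos by (simp add: distrib_left)
qed

lemma exp_le_colorable_prob: "exp (- (4 * M)) \<le> colorable_prob n0 (leftover + k)"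
proof -
  let ?r = "exp (2 * real k * sqrt \<epsilon>) * (real k + 1)" and ?p = "colorable_prob n0 (leftover + k)"
  have "?r ^ card (u ` {..<k}) \<le> exp (2 * real k * sqrt \<epsilon> + A) ^ card (u ` {..<k})"
    unfolding exp_add using k_le_n0 n0_Suc_le_exp by (intro power_mono mult_left_mono) auto
  also have "\<dots> \<le> exp (2 * real k * sqrt \<epsilon> + A) ^ J"
    using card_sizes_le \<epsilon>_nonneg by (intro power_increasing) (auto intro: add_nonneg_nonneg)
  also have "\<dots> = exp (real J * (2 * real k * sqrt \<epsilon> + A))" by (simp only: exp_of_nat_mult)
  finally have types: "?r ^ card (u ` {..<k}) \<le> exp (real J * (2 * real k * sqrt \<epsilon> + A))" .
  have "1 = (colorable_prob leftover leftover)\<^sup>2" by (simp add: colorable_prob_eq_1)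
  also have "\<dots> \<le> exp (M + real k ^ 2 * \<beta>) * ?r ^ card (u ` {..<k}) * critical.profile_cost * ?p"
    unfolding leftover_def
  proof (rule colorable_prob_second_moment_profile[OF sum_sizes_le _ _ M_pos _ sizes_pair_weight_le
        \<epsilon>_nonneg sizes_overlap_ratio_le profile_cost_nonneg subprofile_cost_le])
    show "0 < J ^ 4" using J_ge_16 by simp
    show "u i < 2 * J ^ 4" if "i < k" for i using size_bounds[OF that] by (simp add: a_eq)
    show "0 \<le> \<beta>" using A_pos by (simp add: \<beta>_def)
  qed
  also have "\<dots> \<le> exp (M + real k ^ 2 * \<beta>) * exp (real J * (2 * real k * sqrt \<epsilon> + A))
      * exp (2 * M + (real J + 1) * (1 + A)) * ?p"
    by (intro mult_mono mult_nonneg_nonneg types profile_cost_le profile_cost_nonneg colorable_prob_nonneg) auto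
  also have "\<dots> \<le> exp (4 * M) * ?p"
    unfolding exp_add[symmetric] using exponent_le by (intro mult_right_mono colorable_prob_nonneg) simp
  finally show ?thesis by (simp add: exp_minus field_simps)
qed

lemma exists_colorable_prob_ge_half:
  "\<exists>k0. real k0 \<le> colors b + 6 * real n0 / A ^ 5 \<and> 1 / 2 \<le> colorable_prob n0 k0"
proof -
  define m where "m = nat \<lceil>2 * sqrt (n0 * (4 * M)) + 2 * sqrt n0\<rceil>"
  have "1 / 2 \<le> colorable_prob n0 (leftover + k + m)"
  proof (rule colorable_prob_amplify[OF exp_le_colorable_prob])
    have "4 \<le> A ^ 1" using A_large by simp
    also have "\<dots> \<le> A ^ 10" using A_large by (intro power_increasing) auto
    finally show "4 * M \<le> real n0" using n0_pos A_pos by (simp add: M_def divide_le_eq)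
    show "2 * sqrt (n0 * (4 * M)) + 2 * sqrt n0 \<le> real m" unfolding m_def by linarith
  qed (simp add: M_pos)
  moreover have "real (leftover + k + m) \<le> colors b + 6 * real n0 / A ^ 5"
  proof -
    have small: "real n0 / A ^ i \<le> real n0 / A ^ 5 / 100" if "5 < i" for i
      by (rule n0_div_power_le_div_100[OF that])
    have "sqrt (n0 * (4 * M)) = 2 * real n0 / A ^ 5"
      using A_pos by (intro real_sqrt_unique)
        (auto simp: M_def power_divide power_mult_distrib power_mult[symmetric] power2_eq_square)
    moreover have "real m \<le> 2 * sqrt (n0 * (4 * M)) + 2 * sqrt n0 + 1"
      unfolding m_def using M_pos by (simp add: add_nonneg_nonneg)
    moreover have "real J * A \<le> A\<^sup>2" using J_le_A by (simp add: power2_eq_square mult_right_mono)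
    ultimately show ?thesis
      using k_le_colors leftover_le power_le_n0[of 2] power_le_n0[of 0] sqrt_n0_le[of 50] small[of 50]
          small[of 98] small[of 100]
      by simp
  qed
  ultimately show ?thesis by blast
qed

end

context tilted
begin

lemma few_colors_suffice:
  obtains k where "real k \<le> colors b + 6 * real n0 / A ^ 5" "1 / 2 \<le> colorable_prob n0 k"
proof (rule exists_type_counts[of "(\<lambda>j. a - j) ` {1..J}" "\<lambda>s. class_count (a - s)"])
  fix k and u :: "nat \<Rightarrow> nat"
  assume sizes: "\<And>i. i < k \<Longrightarrow> u i \<in> (\<lambda>j. a - j) ` {1..J}"
    and counts: "\<And>s. s \<in> (\<lambda>j. a - j) ` {1..J} \<Longrightarrow> type_count u {..<k} s = class_count (a - s)"
  have "type_count u {..<k} (a - j) = class_count j" if "j \<in> {1..J}" for j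
    using counts[OF imageI[OF that]] that J_le(2) by simp
  with sizes interpret rounded_profile J a b k u by unfold_locales
  show thesis using exists_colorable_prob_ge_half that by blast
qed simp

end

section \<open>Few colors do not suffice for more than \<open>n0\<close> vertices\<close>

lemma fact_le_exp:
  assumes "0 < n"
  shows "fact n \<le> exp (1 + ln (real n + 1) + (real n * ln n - n))"
  using fact_le_power_div_exp[of n] assms unfolding power_div_exp by (simp add: exp_add)

lemma mult_ln_le_tangent:
  fixes x y :: real
  assumes "0 < x" "0 < y"
  shows "y * ln y - y \<le> x * ln x - x + (y - x) * ln y"
proof -
  have "x * ln (y / x) \<le> x * (y / x - 1)" using assms by (intro mult_left_mono ln_le_minus_one) auto
  also have "\<dots> = y - x" using assms by (simp add: right_diff_distrib)
  finally show ?thesis using assms by (simp add: ln_div algebra_simps)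
qed

lemma indep_weight_Suc: "indep_weight (Suc a) = indep_weight a * ((real a + 1) * 2 powr a)"
proof -
  have "Suc a choose 2 = a + (a choose 2)" by (simp add: numeral_2_eq_2)
  then show ?thesis by (simp add: indep_weight_def power_add powr_realpow)
qed

context tilted
begin

lemma \<zeta>_le_1: "\<zeta> b \<le> 1"
proof -
  have "1 * 1 \<le> (A - deficit b) * \<Lambda> b"
  proof (intro mult_mono)
    show "1 \<le> A - deficit b" using deficit_small[of b] A_large by linarith
    then show "0 \<le> A - deficit b" by simp
    show "1 \<le> \<Lambda> b" using A_large \<Lambda>_bounds(1)[OF b_bounds] A_ln2_bounds by linarith
  qed auto
  then have "ln (\<zeta> b) \<le> 0" using ln_\<zeta> by simp
  then show ?thesis using \<zeta>_pos[of b] by simp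
qed

lemma minus_ln_\<zeta>_bounds: "0 \<le> - ln (\<zeta> b)" "- ln (\<zeta> b) \<le> A\<^sup>2 / 2"
proof -
  show "0 \<le> - ln (\<zeta> b)" using \<zeta>_le_1 \<zeta>_pos[of b] by simp
  have "- ln (\<zeta> b) \<le> (A - deficit b) * \<Lambda> b" using ln_\<zeta> by simp
  also have "\<dots> \<le> A * (A / 2)"
  proof (intro mult_mono)
    show "\<Lambda> b \<le> A / 2" using A_large \<Lambda>_bounds(2)[OF b_bounds] A_ln2_bounds by linarith
  qed (use deficit_bounds(1)[of b] \<Lambda>_pos in auto)
  finally show "- ln (\<zeta> b) \<le> A\<^sup>2 / 2" by (simp add: power2_eq_square)
qed

lemma sum_tilt_weight_tail_le: "(\<Sum>j\<in>{Suc J..<a}. tilt_weight b j) \<le> 1 / A"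
proof -
  define \<tau> where "\<tau> = 2 powr (- (real J * (real J / 2 - 4)))"
  have "(\<Sum>j\<in>{Suc J..<a}. tilt_weight b j) \<le> (\<Sum>j\<in>{Suc J..<a}. \<tau> * (1 / 2) ^ j)"
    unfolding \<tau>_def using b_bounds(2) J_ge_16
    by (intro sum_mono order_trans[OF tilt_weight_le gauss_weight_tail_le]) auto
  also have "\<dots> = \<tau> * (\<Sum>j\<in>{Suc J..<a}. (1 / 2) ^ j)" by (simp only: sum_distrib_left)
  also have "(\<Sum>j\<in>{Suc J..<a}. (1 / 2) ^ j) \<le> (\<Sum>j=1..a. (1 / 2 :: real) ^ j)" by (intro sum_mono2) auto
  also have "\<dots> \<le> 1" by (rule sum_half_powers_le)
  finally have "(\<Sum>j\<in>{Suc J..<a}. tilt_weight b j) \<le> \<tau>" by (simp add: \<tau>_def mult_left_le)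
  also have "\<tau> \<le> 1 / A" using tail_le A_pos by (simp add: \<tau>_def field_simps)
  finally show ?thesis .
qed

lemma sum_profile_le: "(\<Sum>j=1..<a. profile b j) \<le> colors b + class_scale b / A"
proof -
  have "(\<Sum>j=1..<a. profile b j) = (\<Sum>j\<in>{1..J} \<union> {Suc J..<a}. profile b j)"
    using J_le(2) by (intro sum.cong) auto
  also have "\<dots> = (\<Sum>j=1..J. profile b j) + (\<Sum>j\<in>{Suc J..<a}. profile b j)" by (intro sum.union_disjoint) auto
  also have "(\<Sum>j=1..J. profile b j) = colors b" by (rule sum_profile)
  also have "(\<Sum>j\<in>{Suc J..<a}. profile b j) = class_scale b * (\<Sum>j\<in>{Suc J..<a}. tilt_weight b j)"
    by (simp add: profile_def sum_distrib_left)
  also have "\<dots> \<le> class_scale b * (1 / A)"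
    using sum_tilt_weight_tail_le class_scale_pos[of b] by (intro mult_left_mono) auto
  finally show ?thesis by simp
qed

lemma \<zeta>_class_sum_le: "\<zeta> b * class_sum a (1 / A) (\<rho> b) \<le> colors b + 4 * real n0 / A\<^sup>2"
proof -
  have profile_eq: "\<zeta> b * (\<rho> b ^ i / indep_weight i) = profile b (a - i)" if "i \<le> a" for i
    using profile_weight[of "a - i" b] that by (simp add: field_simps)
  have "\<zeta> b * class_sum a (1 / A) (\<rho> b)
     = (\<Sum>i=1..<a. \<zeta> b * (\<rho> b ^ i / indep_weight i)) + 1 / A * (\<zeta> b * (\<rho> b ^ a / indep_weight a))"
    by (simp add: class_sum_def distrib_left sum_distrib_left)
  also have "\<zeta> b * (\<rho> b ^ a / indep_weight a) = class_scale b"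
    using profile_eq[of a] by (simp add: profile_def)
  also have "(\<Sum>i=1..<a. \<zeta> b * (\<rho> b ^ i / indep_weight i)) = (\<Sum>i=1..<a. profile b (a - i))"
    by (intro sum.cong refl profile_eq) auto
  also have "\<dots> = (\<Sum>j=1..<a. profile b j)"
    by (rule sum.reindex_bij_witness[of _ "\<lambda>j. a - j" "\<lambda>j. a - j"]) auto
  also have "\<dots> \<le> colors b + class_scale b / A" by (rule sum_profile_le)
  finally have "\<zeta> b * class_sum a (1 / A) (\<rho> b) \<le> colors b + 2 * (class_scale b / A)" by simp
  also have "class_scale b / A \<le> (2 * real n0 / A) / A"
    using class_scale_bounds(2)[OF b_bounds] by (intro divide_right_mono) auto
  finally show ?thesis by (simp add: power2_eq_square)
qed

end

text \<open>Adding \<open>a * R\<close> vertices and \<open>R\<close> colors saves \<open>R * ln A\<close> in the exponent of the expected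
  number of colorings, which \<open>\<Delta>\<close> further colors cannot compensate.\<close>

locale enlarged = tilted +
  fixes R k :: nat and \<Delta> :: real
  assumes R_bounds: "9 / 10 * (real n0 / A\<^sup>2) \<le> real R" "real R \<le> real n0 / A\<^sup>2"
    and k_le: "real k \<le> colors b + R + \<Delta>"
    and \<Delta>_bounds: "0 \<le> \<Delta>" "\<Delta> \<le> 1 / 10 * (real n0 * ln A / A ^ 4)"
begin

definition "n1 = n0 + a * R"

definition "unit = real n0 / A\<^sup>2"

definition "max_classes = nat \<lceil>24 / 50 * unit\<rceil>"

lemma real_n1: "real n1 = real n0 + A * R"
  by (simp add: n1_def)

lemma A_R_le: "A * R \<le> real n0 / A"
proof -
  have "A * R \<le> A * (real n0 / A\<^sup>2)" using R_bounds(2) by (intro mult_left_mono) auto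
  then show ?thesis using A_pos by (simp add: power2_eq_square)
qed

lemma n1_bounds: "0 < real n1" "real n1 \<le> 2 * real n0"
proof -
  show "0 < real n1" using real_n1 n0_pos by (simp add: add_pos_nonneg)
  have "real n0 / A \<le> real n0" using A_large n0_pos by (simp add: divide_le_eq)
  then show "real n1 \<le> 2 * real n0" using A_R_le real_n1 by linarith
qed

lemma unit_ge: "100 * A \<le> unit"
proof -
  have "100 * A \<le> A * A" using A_large by (intro mult_right_mono) auto
  also have "\<dots> \<le> real n0 / A ^ 98" using power_le_n0[of 2] by (simp add: power2_eq_square)
  also have "\<dots> \<le> unit" unfolding unit_def by (rule n0_div_power_le) simp
  finally show ?thesis .
qed

lemma unit_pos: "0 < unit"
  using unit_ge A_pos by linarith

lemma max_classes_bounds: "24 / 50 * unit \<le> real max_classes" "real max_classes \<le> 24 / 50 * unit + 1"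
  unfolding max_classes_def using unit_pos by linarith+

lemma indep_mean_n1_pos: "0 < indep_mean n1 a"
  using n1_bounds(1) by (intro indep_mean_pos) simp

lemma indep_mean_n1_le: "indep_mean n1 a \<le> 3 / 50 * unit"
proof -
  have "real n1 = real n0 * (1 + A * R / n0)" using n0_pos by (simp add: real_n1 field_simps)
  then have "real n1 ^ a = real n0 ^ a * (1 + A * R / n0) ^ a" by (simp add: power_mult_distrib)
  also have "(1 + A * R / n0) ^ a \<le> exp (A * R / n0) ^ a"
    using n0_pos by (intro power_mono) (auto simp: add_nonneg_nonneg)
  also have "\<dots> = exp (A * (A * R / n0))" by (rule exp_of_nat_mult[symmetric])
  also have "\<dots> \<le> exp 1"
  proof -
    have "A * (A * R) \<le> A * (real n0 / A)" using A_R_le by (intro mult_left_mono) auto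
    then show ?thesis using n0_pos A_pos by (simp add: field_simps)
  qed
  also have "exp (1::real) \<le> 3" by (rule exp_le)
  finally have "real n1 ^ a \<le> real n0 ^ a * 3" by (simp add: mult_left_mono)
  then have "indep_mean n1 a \<le> real n0 ^ a * 3 / indep_weight a"
    unfolding indep_mean_def by (intro divide_right_mono) (auto simp: less_imp_le)
  also have "\<dots> = 3 * indep_mean n0 a" by (simp add: indep_mean_def)
  also have "\<dots> \<le> 3 / 50 * unit" using indep_mean_n0_le by (simp add: unit_def)
  finally show ?thesis .
qed

lemma many_max_classes_le: "indep_mean n1 a / (real max_classes + 1) \<le> 1 / 8"
  using indep_mean_n1_le max_classes_bounds unit_pos by (simp add: pos_divide_le_eq)

lemma oversized_class_le: "indep_mean n1 (Suc a) \<le> 1 / 8"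
proof -
  have "indep_mean n1 (Suc a) = indep_mean n1 a * (real n1 / ((A + 1) * 2 powr A))"
    by (simp add: indep_mean_def indep_weight_Suc)
  also have "\<dots> \<le> (3 / 50 * unit) * (2 * real n0 / (A * 2 powr A))"
    using indep_mean_n1_le n1_bounds indep_mean_n1_pos unit_pos n0_pos A_pos by (intro mult_mono frac_le) auto
  also have "\<dots> = 3 / 25 * ((real n0)\<^sup>2 / (A ^ 3 * 2 powr A))"
    by (simp add: unit_def power2_eq_square power3_eq_cube)
  also have "\<dots> \<le> 3 / 25 * ((2 * A * half_power)\<^sup>2 / (A ^ 3 * 2 powr A))"
    using n0_le_double by (intro mult_left_mono divide_right_mono power_mono) auto
  also have "\<dots> = 12 / 25 / A"
  proof -
    have "half_power\<^sup>2 = 2 powr A" unfolding half_power_def two_powr_power by simp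
    then show ?thesis using A_pos by (simp add: power_mult_distrib power2_eq_square power3_eq_cube)
  qed
  also have "\<dots> \<le> 1 / 8" using A_large by (simp add: divide_le_eq)
  finally show ?thesis .
qed

definition "coloring_exponent = 1 + ln (real n1 + 1) + (n1 * ln n1 - n1) + max_classes * ln A - n1 * ln (\<rho> b)
  - k * ln (\<zeta> b) + \<zeta> b * class_sum a (1 / A) (\<rho> b)"

lemma colorings_le_exp:
  "fact n1 / ((1 / A) ^ max_classes * \<rho> b ^ n1 * \<zeta> b ^ k) * exp (\<zeta> b * class_sum a (1 / A) (\<rho> b))
     \<le> exp coloring_exponent"
proof -
  have power_eq_exp: "y ^ m = exp (real m * ln y)" if "0 < y" for y :: real and m
    using that by (simp add: exp_of_nat_mult)
  have "(1 / A) ^ max_classes = exp (- (max_classes * ln A))"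
    using power_eq_exp[of "1 / A" max_classes] A_pos by (simp add: ln_div)
  then have "(1 / A) ^ max_classes * \<rho> b ^ n1 * \<zeta> b ^ k
      = exp (- (max_classes * ln A) + n1 * ln (\<rho> b) + k * ln (\<zeta> b))"
    by (simp only: exp_add power_eq_exp[OF \<rho>_pos] power_eq_exp[OF \<zeta>_pos])
  then have "fact n1 / ((1 / A) ^ max_classes * \<rho> b ^ n1 * \<zeta> b ^ k) * exp (\<zeta> b * class_sum a (1 / A) (\<rho> b))
      \<le> exp (1 + ln (real n1 + 1) + (n1 * ln n1 - n1)) / exp (- (max_classes * ln A) + n1 * ln (\<rho> b) + k * ln (\<zeta> b))
        * exp (\<zeta> b * class_sum a (1 / A) (\<rho> b))"
    using fact_le_exp[of n1] n1_bounds(1) by (intro mult_right_mono) (auto intro!: divide_right_mono)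
  also have "\<dots> = exp coloring_exponent"
    unfolding coloring_exponent_def exp_diff[symmetric] exp_add[symmetric] by (simp add: algebra_simps)
  finally show ?thesis .
qed

lemma minus_k_ln_\<zeta>_le:
  "- (k * ln (\<zeta> b)) \<le> real n0 * \<Lambda> b - colors b + R * (- ln (\<zeta> b)) + 1 / 20 * (unit * ln A)"
proof -
  have "- (k * ln (\<zeta> b)) = k * (- ln (\<zeta> b))" by simp
  also have "\<dots> \<le> (colors b + R + \<Delta>) * (- ln (\<zeta> b))"
    using k_le minus_ln_\<zeta>_bounds(1) by (intro mult_right_mono) auto
  also have "\<dots> = colors b * (- ln (\<zeta> b)) + R * (- ln (\<zeta> b)) + \<Delta> * (- ln (\<zeta> b))" by (simp only: distrib_right)
  also have "colors b * (- ln (\<zeta> b)) = real n0 * \<Lambda> b - colors b"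
  proof -
    have "- ln (\<zeta> b) = (A - deficit b) * \<Lambda> b - 1" using ln_\<zeta> by simp
    moreover have "colors b * ((A - deficit b) * \<Lambda> b) = real n0 * \<Lambda> b"
      by (simp only: mult.assoc[symmetric] colors_mult)
    ultimately show ?thesis by (simp only: right_diff_distrib mult_1_right)
  qed
  also have "\<Delta> * (- ln (\<zeta> b)) \<le> 1 / 10 * (real n0 * ln A / A ^ 4) * (A\<^sup>2 / 2)"
    using \<Delta>_bounds minus_ln_\<zeta>_bounds by (intro mult_mono) auto
  also have "\<dots> = 1 / 20 * (unit * ln A)" using A_pos by (simp add: unit_def power2_eq_square power4_eq_xxxx)
  finally show ?thesis by simp
qed

lemma planted_exponent_le: "R * (- ln (\<zeta> b)) + A * R * ln n1 - A * R * ln (\<rho> b) \<le> - (R * (ln A - 3))"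
proof -
  have "- ln (\<zeta> b) + A * ln n1 - A * ln (\<rho> b) = ln (indep_mean n1 a / class_scale b)"
    unfolding indep_mean_def \<zeta>_def using class_scale_pos[of b] \<rho>_pos[of b] n1_bounds(1)
    by (simp add: ln_div ln_mult ln_realpow)
  also have "\<dots> \<le> ln (16 / A)"
  proof -
    have "indep_mean n1 a * A \<le> 3 / 50 * unit * A" using indep_mean_n1_le by (intro mult_right_mono) auto
    also have "\<dots> = 3 / 50 * (real n0 / A)" using A_pos by (simp add: unit_def power2_eq_square)
    also have "\<dots> \<le> 16 * (real n0 / (256 * A))" using n0_pos A_pos by (simp add: field_simps)
    also have "\<dots> \<le> 16 * class_scale b" using class_scale_bounds(1)[OF b_bounds] by (intro mult_left_mono) auto
    finally have "indep_mean n1 a / class_scale b \<le> 16 / A"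
      using class_scale_pos[of b] A_pos by (simp add: field_simps)
    then show ?thesis using indep_mean_n1_pos class_scale_pos[of b] A_pos by (subst ln_le_cancel_iff) auto
  qed
  also have "\<dots> \<le> - (ln A - 3)"
  proof -
    have "ln (16::real) = 4 * ln 2" using ln_realpow[of 2 4] by simp
    then show ?thesis using A_pos ln2_bounds by (simp add: ln_div)
  qed
  finally have "R * (- ln (\<zeta> b) + A * ln n1 - A * ln (\<rho> b)) \<le> R * (- (ln A - 3))"
    by (intro mult_left_mono) auto
  then show ?thesis by (simp add: algebra_simps)
qed

lemma coloring_exponent_le_n0_terms:
  "coloring_exponent \<le> 1 + ln (real n1 + 1) + max_classes * ln A + 4 * unit - R * (ln A - 3) + 1 / 20 * (unit * ln A)"
proof -
  have "n1 * ln n1 - n1 \<le> n0 * ln n0 - n0 + A * R * ln n1"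
    using mult_ln_le_tangent[OF n0_pos n1_bounds(1)] by (simp add: real_n1)
  moreover have "n0 * ln n0 - n0 - n0 * ln (\<rho> b) = - (real n0 * \<Lambda> b)"
    unfolding \<Lambda>_def using n0_pos \<rho>_pos[of b] by (simp add: ln_div algebra_simps)
  moreover have "n1 * ln (\<rho> b) = n0 * ln (\<rho> b) + A * R * ln (\<rho> b)" by (simp add: real_n1 distrib_right)
  ultimately show ?thesis
    unfolding coloring_exponent_def using minus_k_ln_\<zeta>_le planted_exponent_le \<zeta>_class_sum_le
    by (simp add: unit_def)
qed

lemma coloring_exponent_le: "coloring_exponent \<le> - 3"
proof -
  have "ln (real n1 + 1) \<le> ln (2 * (real n0 + 1))" using n1_bounds by (subst ln_le_cancel_iff) auto
  also have "\<dots> = ln 2 + ln (real n0 + 1)" by (subst ln_mult) auto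
  finally have "ln (real n1 + 1) \<le> 2 * A" using ln_n0_Suc_le ln2_bounds A_large by linarith
  moreover have "max_classes * ln A \<le> (24 / 50 * unit + 1) * ln A"
    using max_classes_bounds ln_ge_30 by (intro mult_right_mono) auto
  moreover have "9 / 10 * unit * (ln A - 3) \<le> R * (ln A - 3)"
    using R_bounds(1) ln_ge_30 by (intro mult_right_mono) (auto simp: unit_def)
  ultimately have "coloring_exponent \<le> 1 + 2 * A + (24 / 50 * unit + 1) * ln A + 4 * unit
      - 9 / 10 * unit * (ln A - 3) + 1 / 20 * (unit * ln A)"
    using coloring_exponent_le_n0_terms by linarith
  also have "\<dots> = 1 + 2 * A + ln A + unit * (67 / 10 - 37 / 100 * ln A)" by (simp add: field_simps)
  also have "\<dots> \<le> 1 + 2 * A + ln A + unit * (- 4)"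
    using ln_ge_30 unit_pos by (intro add_left_mono mult_left_mono) auto
  also have "\<dots> \<le> - 3" using unit_ge ln_le A_large ln_ge_30 by linarith
  finally show ?thesis .
qed

lemma exp_coloring_exponent_le: "exp coloring_exponent \<le> 1 / 8"
proof -
  have "(2::real) ^ 3 \<le> exp 1 ^ 3" using exp_1_ge by (intro power_mono) auto
  then have "exp (- 3 :: real) \<le> 1 / 8"
    by (simp add: exp_minus exp_of_nat_mult[of 3 1, simplified] field_simps)
  then show ?thesis using coloring_exponent_le by (meson exp_le_cancel_iff order_trans)
qed

lemma colorable_prob_n1_less_half: "colorable_prob (n0 + a * R) k < 1 / 2"
proof -
  have "colorable_prob n1 k \<le> indep_mean n1 a / (real max_classes + 1) + indep_mean n1 (Suc a)
     + fact n1 / ((1 / A) ^ max_classes * \<rho> b ^ n1 * \<zeta> b ^ k) * exp (\<zeta> b * class_sum a (1 / A) (\<rho> b))"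
    using A_large \<rho>_pos[of b] \<zeta>_pos[of b] \<zeta>_le_1 by (intro colorable_prob_first_moment) auto
  also have "\<dots> \<le> 1 / 8 + 1 / 8 + 1 / 8"
    by (intro add_mono many_max_classes_le oversized_class_le order_trans[OF colorings_le_exp exp_coloring_exponent_le])
  finally show ?thesis by (simp add: n1_def)
qed

end

section \<open>The gap between the chromatic and the cochromatic number\<close>

lemma prob_Gn_half_mono:
  assumes "\<And>E. P E \<Longrightarrow> Q E"
  shows "prob_Gn_half n P \<le> prob_Gn_half n Q"
  unfolding prob_Gn_half_eq_subset_avg using assms by (intro subset_avg_mono) auto

context tilted
begin

definition "root_n0 = sqrt (real n0)"

definition "batch = nat \<lfloor>root_n0 / (10 * A)\<rfloor>"

definition "rounds = nat \<lfloor>real n0 / (A\<^sup>2 * batch)\<rfloor>"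

definition "gap_bound = nat \<lceil>35 / 20000 * (root_n0 * ln A / A ^ 3)\<rceil>"

lemma root_n0_pos: "0 < root_n0"
  using n0_pos by (simp add: root_n0_def)

lemma root_n0_mult_self: "root_n0 * root_n0 = real n0"
  by (simp add: root_n0_def)

lemma batch_bounds: "real batch \<le> root_n0 / (10 * A)" "root_n0 / (11 * A) \<le> real batch"
proof -
  have "110 * A \<le> A * A" using A_large by (intro mult_right_mono) auto
  then have "110 * A \<le> root_n0" using power_le_sqrt_n0[of 2] by (simp add: root_n0_def power2_eq_square)
  then have "1 \<le> root_n0 / (110 * A)" using A_pos by (simp add: pos_le_divide_eq)
  moreover have "root_n0 / (10 * A) = root_n0 / (11 * A) + root_n0 / (110 * A)" using A_pos by (simp add: field_simps)
  moreover have "real batch \<le> root_n0 / (10 * A)" "root_n0 / (10 * A) - 1 \<le> real batch"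
    unfolding batch_def using root_n0_pos A_pos by (auto simp: of_nat_nat)
  ultimately show "real batch \<le> root_n0 / (10 * A)" "root_n0 / (11 * A) \<le> real batch" by linarith+
qed

lemma batch_pos: "0 < real batch"
proof -
  have "0 < root_n0 / (11 * A)" using root_n0_pos A_pos by simp
  then show ?thesis using batch_bounds(2) by linarith
qed

lemma batch_square_le: "real batch ^ 2 \<le> real n0 / (100 * A\<^sup>2)"
proof -
  have "real batch ^ 2 \<le> (root_n0 / (10 * A)) ^ 2" using batch_bounds by (intro power_mono) auto
  then show ?thesis by (simp add: root_n0_def power_divide power_mult_distrib)
qed

lemma rounds_bounds: "real rounds \<le> real n0 / (A\<^sup>2 * batch)" "real n0 / (A\<^sup>2 * batch) - 1 \<le> real rounds"
  unfolding rounds_def by (auto simp: of_nat_nat)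

lemma rounds_le: "real rounds \<le> 11 * root_n0 / A"
proof -
  have "real n0 / (A\<^sup>2 * batch) \<le> real n0 / (A\<^sup>2 * (root_n0 / (11 * A)))"
    using batch_bounds(2) batch_pos root_n0_pos A_pos n0_pos
    by (intro divide_left_mono mult_left_mono mult_pos_pos) auto
  also have "\<dots> = 11 * root_n0 / A"
    using root_n0_pos A_pos by (simp add: root_n0_mult_self[symmetric] power2_eq_square)
  finally show ?thesis using rounds_bounds(1) by linarith
qed

lemma rounds_batch_bounds:
  "real (rounds * batch) \<le> real n0 / A\<^sup>2" "9 / 10 * (real n0 / A\<^sup>2) \<le> real (rounds * batch)"
proof -
  have "real rounds * real batch \<le> real n0 / (A\<^sup>2 * batch) * real batch"
    using rounds_bounds(1) by (intro mult_right_mono) auto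
  then show "real (rounds * batch) \<le> real n0 / A\<^sup>2" using batch_pos by simp
  have "(real n0 / (A\<^sup>2 * batch) - 1) * real batch \<le> real rounds * real batch"
    using rounds_bounds(2) by (intro mult_right_mono) auto
  then have "real n0 / A\<^sup>2 - real batch \<le> real (rounds * batch)"
    using batch_pos by (simp add: left_diff_distrib)
  moreover have "root_n0 / (10 * A) \<le> root_n0 / 10" using root_n0_pos A_large by (intro divide_left_mono) auto
  then have "real batch \<le> 1 / 10 * (real n0 / A\<^sup>2)"
    using batch_bounds(1) sqrt_n0_le[of 2] by (simp add: root_n0_def)
  ultimately show "9 / 10 * (real n0 / A\<^sup>2) \<le> real (rounds * batch)" by linarith
qed

lemma A_rounds_batch_le: "A * real (rounds * batch) \<le> real n0 / A"
proof -
  have "A * real (rounds * batch) \<le> A * (real n0 / A\<^sup>2)"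
    using rounds_batch_bounds(1) by (intro mult_left_mono) auto
  then show ?thesis using A_pos by (simp add: power2_eq_square)
qed

lemma gap_bound_bounds:
  "35 / 20000 * (root_n0 * ln A / A ^ 3) \<le> real gap_bound"
  "real gap_bound \<le> 35 / 20000 * (root_n0 * ln A / A ^ 3) + 1"
proof -
  have "0 \<le> 35 / 20000 * (root_n0 * ln A / A ^ 3)"
    using root_n0_pos ln_ge_30 by (intro mult_nonneg_nonneg divide_nonneg_nonneg) auto
  then show "35 / 20000 * (root_n0 * ln A / A ^ 3) \<le> real gap_bound"
    "real gap_bound \<le> 35 / 20000 * (root_n0 * ln A / A ^ 3) + 1"
    unfolding gap_bound_def by linarith+
qed

lemma extra_colors_le:
  "6 * real n0 / A ^ 5 + real rounds * real gap_bound \<le> 1 / 10 * (real n0 * ln A / A ^ 4)"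
proof -
  define u where "u = real n0 * ln A / A ^ 4"
  have "real n0 / A ^ 5 \<le> real n0 / A ^ 4 / 100" by (rule n0_div_power_le_div_100) simp
  also have "\<dots> = real n0 / A ^ 4 * 30 / 3000" by simp
  also have "\<dots> \<le> real n0 / A ^ 4 * ln A / 3000"
    using ln_ge_30 by (intro divide_right_mono mult_left_mono) auto
  finally have small: "real n0 / A ^ 5 \<le> u / 3000" by (simp add: u_def)
  have "real rounds * real gap_bound \<le> (11 * root_n0 / A) * (35 / 20000 * (root_n0 * ln A / A ^ 3) + 1)"
    using rounds_le gap_bound_bounds(2) root_n0_pos A_pos by (intro mult_mono) auto
  also have "\<dots> = 385 / 20000 * u + 11 * root_n0 / A"
    unfolding u_def root_n0_mult_self[symmetric] using A_pos by (simp add: field_simps eval_nat_numeral)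
  also have "11 * root_n0 / A \<le> 11 * (real n0 / A ^ 5)"
  proof -
    have "root_n0 / A \<le> root_n0 / 1" using root_n0_pos A_large by (intro divide_left_mono) auto
    then show ?thesis using sqrt_n0_le[of 5] by (simp add: root_n0_def)
  qed
  finally have "6 * real n0 / A ^ 5 + real rounds * real gap_bound \<le> 385 / 20000 * u + 17 * (real n0 / A ^ 5)"
    by simp
  moreover have "0 \<le> u" using ln_ge_30 by (simp add: u_def)
  ultimately show ?thesis using small unfolding u_def[symmetric] by linarith
qed

lemma batch_pair_weight_le:
  assumes m: "n0 \<le> m" "real m \<le> real n0 + real n0 / A"
  shows "real batch ^ 2 * pair_weight a a (Suc a) (1 / m) \<le> 2"
proof (rule plant_pair_weight_le)
  show "2 \<le> a" using A_large by linarith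
  have "A ^ 4 * 2 powr (- A / 4) \<le> 1 / A ^ (100 - 4)" by (rule power_mult_powr_quarter_le) simp
  also have "\<dots> \<le> 1 / A ^ 1" by (rule inverse_power_le) simp
  finally show "A ^ 4 * 2 powr (- A / 4) \<le> 1 / A" by simp
  show "2 powr (A / 2) \<le> real m" using half_power_le_n0 m(1) by (simp add: half_power_def)
  have "real n0 / A \<le> real n0 / 4" using A_large n0_pos by (intro divide_left_mono) auto
  moreover have "131072 * 1 \<le> A * half_power" using A_large half_power_large by (intro mult_mono) auto
  ultimately show "real m \<le> 2 * A * 2 powr (A / 2)" using m(2) n0_le by (simp add: half_power_def)
  have "1 \<le> A\<^sup>2" using A_large by (intro one_le_power) simp
  then have "1 \<le> 100 * A\<^sup>2" by linarith
  then have "real n0 / (100 * A\<^sup>2) \<le> real n0 / 1" by (intro divide_left_mono) (use A_pos in auto)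
  then show "real batch ^ 2 \<le> m" using batch_square_le m(1) by linarith
  have "real batch ^ 2 \<le> indep_mean n0 a" using batch_square_le indep_mean_n0_ge by linarith
  also have "\<dots> \<le> indep_mean m a"
    unfolding indep_mean_def using m(1) by (intro divide_right_mono power_mono) (auto simp: less_imp_le)
  finally show "real batch ^ 2 \<le> indep_mean m a" .
qed

lemma colorable_prob_add_batch:
  assumes m: "n0 \<le> m" "real m \<le> real n0 + real n0 / A" and f: "1 / 2 \<le> colorable_prob m f"
  shows "1 / 36 \<le> colorable_prob (m + a * batch) (f + batch)"
proof -
  have "exp (real batch ^ 2 * pair_weight a a (Suc a) (1 / m)) \<le> exp 2"
    using batch_pair_weight_le[OF m] by simp
  also have "exp (2::real) = exp 1 ^ 2" by (simp add: exp_double[symmetric])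
  also have "\<dots> \<le> 3 ^ 2" by (intro power_mono exp_le) auto
  finally have exp_le_9: "exp (real batch ^ 2 * pair_weight a a (Suc a) (1 / m)) \<le> 9" by simp
  have "0 < m" using m(1) n0_pos by simp
  have "(1 / 2)\<^sup>2 \<le> (colorable_prob m f)\<^sup>2" using f by (intro power_mono) auto
  also have "\<dots> \<le> exp (real batch ^ 2 * pair_weight a a (Suc a) (1 / m)) * colorable_prob (m + a * batch) (f + batch)"
    by (rule colorable_prob_plant[OF \<open>0 < m\<close>])
  also have "\<dots> \<le> 9 * colorable_prob (m + a * batch) (f + batch)"
    using exp_le_9 by (intro mult_right_mono colorable_prob_nonneg)
  finally show ?thesis by (simp add: power2_eq_square)
qed

end

locale small_gap = tilted +
  fixes g :: "nat \<Rightarrow> int"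
  assumes gap: "prob_Gn_half n (\<lambda>E. int (chromatic_number n E) - int (cochromatic_number n E) \<le> g n) > 0.999"
    and small: "n0 \<le> n \<Longrightarrow> real_of_int (g n) \<le> 1 / 20000 * sqrt (real n) * ln (ln (real n)) / (ln (real n)) ^ 3"
begin

lemma ln_bounds:
  assumes m: "n0 \<le> m" "real m \<le> 2 * real n0"
  shows "693 / 2000 * A \<le> ln m" "ln m \<le> A"
proof -
  have pos: "0 < real m" "0 < half_power" using m(1) n0_pos half_power_large by linarith+
  have "ln half_power \<le> ln m" using half_power_le_n0 m(1) pos by (subst ln_le_cancel_iff) auto
  then show "693 / 2000 * A \<le> ln m" using A_ln2_bounds(1) by (simp add: ln_half_power)
  have "ln m \<le> ln (4 * A * half_power)" using m(2) n0_le_double pos by (subst ln_le_cancel_iff) auto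
  also have "\<dots> = ln 4 + ln A + A * ln 2 / 2" using A_pos pos by (simp add: ln_mult ln_half_power)
  also have "ln (4::real) \<le> 3" using ln_le_minus_one[of "4::real"] by simp
  finally show "ln m \<le> A" using ln_le A_ln2_bounds(2) A_large by linarith
qed

lemma g_le_gap_bound:
  assumes m: "n0 \<le> m" "real m \<le> 2 * real n0"
  shows "g m \<le> int gap_bound"
proof -
  have "1 \<le> ln m" using ln_bounds(1)[OF m] A_large by simp
  then have lnln: "0 \<le> ln (ln m)" "ln (ln m) \<le> ln A"
    using ln_bounds(2)[OF m] A_pos by (auto simp: ln_le_cancel_iff)
  have "sqrt m \<le> sqrt (2 * real n0)" using m(2) by simp
  also have "\<dots> = sqrt 2 * root_n0" by (simp add: root_n0_def real_sqrt_mult)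
  also have "\<dots> \<le> 14143 / 10000 * root_n0" using sqrt2_bounds root_n0_pos by (intro mult_right_mono) auto
  finally have root: "sqrt m \<le> 14143 / 10000 * root_n0" .
  have "real_of_int (g m) \<le> 1 / 20000 * sqrt m * ln (ln m) / (ln m) ^ 3" by (rule small[OF m(1)])
  also have "\<dots> \<le> (1 / 20000 * (14143 / 10000 * root_n0) * ln A) / (693 / 2000 * A) ^ 3"
    using root ln_bounds[OF m] lnln root_n0_pos A_pos ln_ge_30
    by (intro frac_le mult_mono power_mono mult_nonneg_nonneg) auto
  also have "\<dots> = (14143 / 10000 / (693 / 2000) ^ 3 / 20000) * (root_n0 * ln A / A ^ 3)"
    unfolding power_mult_distrib by simp
  also have "\<dots> \<le> 35 / 20000 * (root_n0 * ln A / A ^ 3)" using root_n0_pos A_pos ln_ge_30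
    by (intro mult_right_mono divide_nonneg_nonneg mult_nonneg_nonneg) (auto simp: power3_eq_cube)
  finally have "real_of_int (g m) \<le> real gap_bound" using gap_bound_bounds(1) by linarith
  then show ?thesis by linarith
qed

lemma colorable_prob_step:
  assumes m: "n0 \<le> m" "real (m + a * batch) \<le> real n0 + real n0 / A" and f: "1 / 2 \<le> colorable_prob m f"
  shows "1 / 2 \<le> colorable_prob (m + a * batch) (f + batch + gap_bound)"
proof -
  let ?m = "m + a * batch" and ?gap = "\<lambda>n E. int (chromatic_number n E) - int (cochromatic_number n E)"
  let ?p = "colorable_prob ?m (f + batch)" and ?q = "colorable_prob ?m (f + batch + gap_bound)"
  have "real m \<le> real ?m" by (intro of_nat_mono) simp
  then have planted: "1 / 36 \<le> ?p" using m f by (intro colorable_prob_add_batch order_trans[OF _ m(2)])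
  have "real n0 / A \<le> real n0" using A_large n0_pos by (simp add: divide_le_eq)
  then have "g ?m \<le> int gap_bound" using m by (intro g_le_gap_bound) auto
  then have "prob_Gn_half ?m (\<lambda>E. ?gap ?m E \<le> g ?m) \<le> prob_Gn_half ?m (\<lambda>E. ?gap ?m E \<le> int gap_bound)"
    by (intro prob_Gn_half_mono) linarith
  then have "?p * (1 - ?q) \<le> 1 - 0.999"
    using colorable_prob_gap[of ?m "f + batch" gap_bound] gap[of ?m] by linarith
  moreover have "1 / 36 * (1 - ?q) \<le> ?p * (1 - ?q)"
    using planted colorable_prob_le_1[of ?m "f + batch + gap_bound"] by (intro mult_right_mono) auto
  ultimately show ?thesis by simp
qed

lemma colorable_prob_rounds:
  assumes start: "1 / 2 \<le> colorable_prob n0 k" and "t \<le> rounds"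
  shows "1 / 2 \<le> colorable_prob (n0 + a * (t * batch)) (k + t * (batch + gap_bound))"
  using assms(2)
proof (induction t)
  case 0
  then show ?case using start by simp
next
  case (Suc t)
  have vertices: "n0 + a * (Suc t * batch) = n0 + a * (t * batch) + a * batch" by (simp add: algebra_simps)
  have colors: "k + Suc t * (batch + gap_bound) = k + t * (batch + gap_bound) + batch + gap_bound" by simp
  have "Suc t * batch \<le> rounds * batch" using Suc.prems by (intro mult_right_mono) auto
  then have "A * real (Suc t * batch) \<le> A * real (rounds * batch)" by (intro mult_left_mono of_nat_mono) auto
  then have "real (n0 + a * (t * batch) + a * batch) \<le> real n0 + real n0 / A"
    unfolding vertices[symmetric] using A_rounds_batch_le by simp
  then show ?case unfolding vertices colors using Suc by (intro colorable_prob_step) auto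
qed

lemma contradiction: False
proof -
  obtain k where k: "real k \<le> colors b + 6 * real n0 / A ^ 5" "1 / 2 \<le> colorable_prob n0 k"
    by (rule few_colors_suffice)
  interpret enlarged J a b "rounds * batch" "k + rounds * (batch + gap_bound)"
    "6 * real n0 / A ^ 5 + real rounds * real gap_bound"
    by unfold_locales (use k(1) rounds_batch_bounds extra_colors_le in \<open>simp_all add: distrib_left\<close>)
  show False using colorable_prob_n1_less_half colorable_prob_rounds[OF k(2) order_refl] by linarith
qed

end

lemma eventually_large_class_size: "eventually (\<lambda>J. large_class_size J (2 * J ^ 4)) sequentially"
proof -
  have "eventually (\<lambda>J::nat. 300 * (2 * real J ^ 4) \<le> 2 powr (2 * real J ^ 4 - 1)) sequentially"
    "eventually (\<lambda>J::nat. ln (200 * (2 * real J ^ 4)) + 20 \<le> 48 / 10000 * (2 * real J ^ 4)) sequentially"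
    "eventually (\<lambda>J::nat. 4100 * ln (2 * real J ^ 4) \<le> (2 * real J ^ 4)) sequentially"
    "eventually (\<lambda>J::nat. (2 * real J ^ 4) ^ 100 * 2 powr (- (2 * real J ^ 4) / 8) \<le> 1) sequentially"
    "eventually (\<lambda>J::nat. 30 \<le> ln (2 * real J ^ 4)) sequentially"
    "eventually (\<lambda>J::nat. 2 * real J ^ 4 * 2 powr (- (real J * (real J / 2 - 4))) \<le> 1) sequentially"
    by real_asymp+
  then show ?thesis using eventually_ge_at_top[of "16::nat"]
  proof eventually_elim
    case (elim J)
    show ?case by unfold_locales (use elim in simp_all)
  qed
qed

lemma gap_exceeds:
  fixes g :: "nat \<Rightarrow> int"
  assumes gap: "\<And>n. prob_Gn_half n (\<lambda>E. int (chromatic_number n E) - int (cochromatic_number n E) \<le> g n) > 0.999"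
  shows "\<exists>n\<ge>N. real_of_int (g n) > 1 / 20000 * sqrt (real n) * ln (ln (real n)) / (ln (real n)) ^ 3"
proof (rule ccontr)
  assume "\<not> ?thesis"
  then have small: "real_of_int (g n) \<le> 1 / 20000 * sqrt (real n) * ln (ln (real n)) / (ln (real n)) ^ 3"
    if "N \<le> n" for n using that by (meson not_le)
  have "eventually (\<lambda>J. large_class_size J (2 * J ^ 4) \<and> N \<le> J) sequentially"
    by (intro eventually_conj eventually_large_class_size eventually_ge_at_top)
  then obtain J where J: "large_class_size J (2 * J ^ 4)" "N \<le> J"
    using eventually_happens'[OF sequentially_bot] by blast
  interpret large_class_size J "2 * J ^ 4" by (rule J(1))
  obtain b where b: "0 \<le> b" "b \<le> 3" "tilt_excess b = 0" by (rule exists_tilt)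
  have "real J \<le> real n0" using J_le(2) n0_large A_pos by linarith
  then have "N \<le> n0" using J(2) by simp
  interpret small_gap J "2 * J ^ 4" b g
    by unfold_locales (use b gap small \<open>N \<le> n0\<close> in auto)
  show False by (rule contradiction)
qed

theorem theorem1:
  shows "\<exists>c::real. c > 0 \<and>
    (\<forall>g :: nat \<Rightarrow> int.
      (\<forall>n. prob_Gn_half n (\<lambda>E. int (chromatic_number n E) - int (cochromatic_number n E) \<le> g n) > 0.999)
      \<longrightarrow> infinite {n. real_of_int (g n) > c * sqrt (real n) * ln (ln (real n)) / (ln (real n)) ^ 3})"
proof (intro exI[of _ "1 / 20000"] conjI allI impI)
  fix g :: "nat \<Rightarrow> int"
  assume "\<forall>n. prob_Gn_half n (\<lambda>E. int (chromatic_number n E) - int (cochromatic_number n E) \<le> g n) > 0.999"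
  then show "infinite {n. real_of_int (g n) > 1 / 20000 * sqrt (real n) * ln (ln (real n)) / (ln (real n)) ^ 3}"
    unfolding infinite_nat_iff_unbounded_le using gap_exceeds[of g] by blast
qed simp

end
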